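(* For every prime integer $p>0$, there exist a Noetherian $F$-finite strongly $F$-regular ring $R$ of characteristic $p$ and maximal ideals $\mathfrak{n}_1,\mathfrak{n}_2\in\operatorname{Spec}(R)$ such that $$\operatorname{e}_{\operatorname{HK}}(R_{\mathfrak{n}_1})<\operatorname{e}_{\operatorname{HK}}(R_{\mathfrak{n}_2})\quad\text{and}\quad s(R_{\mathfrak{n}_1})<s(R_{\mathfrak{n}_2}).$$
   Context: All rings are commutative with identity. A ring $R$ of prime characteristic $p$ is $F$-finite if its Frobenius endomorphism is a finite map. For $e\geq 0$, $F^e_*R$ denotes $R$ viewed as an $R$-module via the $e$-th iterate of Frobenius (when $R$ is a domain it is identified with $R^{1/p^e}$). An $F$-finite Noetherian ring $R$ is strongly $F$-regular if for every $c\in R$ not in any minimal prime of $R$ there is $e>0$ such that the $R$-linear map $R\to F^e_*R$, $1\mapsto F^e_*c$, splits; the local rings of such a ring are domains. Let $(A,\mathfrak{m},k)$ be an $F$-finite Noetherian local domain of characteristic $p$ and Krull dimension $d$. For $e\ge 0$ let $\mathfrak{m}^{[p^e]}$ be the ideal generated by all $p^e$-th powers of elements of $\mathfrak{m}$, and let $\ell_A$ denote length. The Hilbert--Kunz multiplicity of $A$ is $$\operatorname{e}_{\operatorname{HK}}(A)=\lim_{e\to\infty}\frac{\ell_A(A/\mathfrak{m}^{[p^e]})}{p^{ed}}.$$ The free rank $\operatorname{frk}_A(M)$ of a finitely generated $A$-module $M$ is the largest $N$ such that there is a surjective $A$-linear map $M\twoheadrightarrow A^{\oplus N}$. The $F$-signature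 of $A$ is $$s(A)=\lim_{e\to\infty}\frac{\operatorname{frk}_A(F^e_*A)}{p^{e(d+\alpha)}},\qquad p^{\alpha}=[k:k^p],$$ so that when $k$ is perfect the denominator is $p^{ed}$. Both limits are known to exist. *)

theory Defs
  imports Complex_Main "HOL-Library.Extended_Nat" "HOL-Computational_Algebra.Primes" "HOL-Algebra.Module"
    "HOL-Algebra.Ring_Divisibility" "HOL-Algebra.Embedded_Algebras"
begin

section \<open>Rings\<close>

(* n generates the kernel of the canonical map \<int> \<rightarrow> R; in particular the zero
   ring has characteristic 1, so a ring of prime characteristic is nonzero. *)
definition has_characteristic :: "('a, 'r) ring_scheme \<Rightarrow> nat \<Rightarrow> bool" where
  "has_characteristic R n \<longleftrightarrow> (\<forall>m::nat. [m] \<cdot>\<^bsub>R\<^esub> \<one>\<^bsub>R\<^esub> = \<zero>\<^bsub>R\<^esub> \<longleftrightarrow> n dvd m)"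

definition minimal_prime :: "'a set \<Rightarrow> ('a, 'r) ring_scheme \<Rightarrow> bool" where
  "minimal_prime P R \<longleftrightarrow>
     primeideal P R \<and> (\<forall>Q. primeideal Q R \<longrightarrow> Q \<subseteq> P \<longrightarrow> Q = P)"

(* Supremum of the lengths n of strictly increasing chains C 0 < C 1 < ... < C n in \<C>. *)
definition chain_length :: "'a set set \<Rightarrow> enat" where
  "chain_length \<C> =
     Sup {enat n | n. \<exists>C::nat \<Rightarrow> 'a set. (\<forall>i\<le>n. C i \<in> \<C>) \<and> (\<forall>i<n. C i \<subset> C (Suc i))}"

definition krull_dim :: "('a, 'r) ring_scheme \<Rightarrow> enat" where
  "krull_dim R = chain_length {P. primeideal P R}"


subsection \<open>Localization at a prime ideal\<close>

definition fraction_rel :: "('a, 'r) ring_scheme \<Rightarrow> 'a set \<Rightarrow> (('a \<times> 'a) \<times> ('a \<times> 'a)) set" where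
  "fraction_rel R P =
     {((a, s), (b, t)) | a s b t.
        a \<in> carrier R \<and> b \<in> carrier R \<and> s \<in> carrier R - P \<and> t \<in> carrier R - P \<and>
        (\<exists>u \<in> carrier R - P. u \<otimes>\<^bsub>R\<^esub> (a \<otimes>\<^bsub>R\<^esub> t) = u \<otimes>\<^bsub>R\<^esub> (b \<otimes>\<^bsub>R\<^esub> s))}"

definition fraction :: "('a, 'r) ring_scheme \<Rightarrow> 'a set \<Rightarrow> 'a \<Rightarrow> 'a \<Rightarrow> ('a \<times> 'a) set" where
  "fraction R P a s = fraction_rel R P `` {(a, s)}"

(* Each of the unions below is a union of copies of one and the same class. *)
definition localization :: "('a, 'r) ring_scheme \<Rightarrow> 'a set \<Rightarrow> ('a \<times> 'a) set ring" where
  "localization R P =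
     \<lparr>carrier = (carrier R \<times> (carrier R - P)) // fraction_rel R P,
      mult = (\<lambda>U V. \<Union>(a, s)\<in>U. \<Union>(b, t)\<in>V. fraction R P (a \<otimes>\<^bsub>R\<^esub> b) (s \<otimes>\<^bsub>R\<^esub> t)),
      one = fraction R P \<one>\<^bsub>R\<^esub> \<one>\<^bsub>R\<^esub>,
      zero = fraction R P \<zero>\<^bsub>R\<^esub> \<one>\<^bsub>R\<^esub>,
      add = (\<lambda>U V. \<Union>(a, s)\<in>U. \<Union>(b, t)\<in>V.
               fraction R P ((a \<otimes>\<^bsub>R\<^esub> t) \<oplus>\<^bsub>R\<^esub> (b \<otimes>\<^bsub>R\<^esub> s)) (s \<otimes>\<^bsub>R\<^esub> t))\<rparr>"


section \<open>Modules\<close>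

definition module_hom ::
    "('a, 'r) ring_scheme \<Rightarrow> ('a, 'b, 'm) module_scheme \<Rightarrow> ('a, 'c, 'n) module_scheme \<Rightarrow> ('b \<Rightarrow> 'c) set"
  where
  "module_hom R M N =
     {f \<in> carrier M \<rightarrow> carrier N.
        (\<forall>x\<in>carrier M. \<forall>y\<in>carrier M. f (x \<oplus>\<^bsub>M\<^esub> y) = f x \<oplus>\<^bsub>N\<^esub> f y) \<and>
        (\<forall>a\<in>carrier R. \<forall>x\<in>carrier M. f (a \<odot>\<^bsub>M\<^esub> x) = a \<odot>\<^bsub>N\<^esub> f x)}"

definition fin_gen_module :: "('a, 'r) ring_scheme \<Rightarrow> ('a, 'b, 'm) module_scheme \<Rightarrow> bool" where
  "fin_gen_module R M \<longleftrightarrow>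
     (\<exists>G \<subseteq> carrier M. finite G \<and> \<Inter>{N. submodule N R M \<and> G \<subseteq> N} = carrier M)"

definition module_length :: "('a, 'r) ring_scheme \<Rightarrow> ('a, 'b, 'm) module_scheme \<Rightarrow> enat" where
  "module_length R M = chain_length {N. submodule N R M}"

definition regular_module :: "('a, 'r) ring_scheme \<Rightarrow> ('a, 'a) module" where
  "regular_module R =
     \<lparr>carrier = carrier R, mult = mult R, one = \<one>\<^bsub>R\<^esub>, zero = \<zero>\<^bsub>R\<^esub>, add = add R, smult = mult R\<rparr>"

definition quotient_module :: "('a, 'r) ring_scheme \<Rightarrow> 'a set \<Rightarrow> ('a, 'a set) module" where
  "quotient_module R I =
     \<lparr>carrier = carrier (R Quot I), mult = mult (R Quot I), one = \<one>\<^bsub>R Quot I\<^esub>,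
      zero = \<zero>\<^bsub>R Quot I\<^esub>, add = add (R Quot I),
      smult = (\<lambda>a U. (I +>\<^bsub>R\<^esub> a) \<otimes>\<^bsub>R Quot I\<^esub> U)\<rparr>"

(* The free module of rank N, consisting of the N-tuples indexed by 0, ..., N - 1. *)
definition free_module :: "('a, 'r) ring_scheme \<Rightarrow> nat \<Rightarrow> ('a, nat \<Rightarrow> 'a) module" where
  "free_module R N =
     \<lparr>carrier = {..<N} \<rightarrow>\<^sub>E carrier R,
      mult = (\<lambda>x y. \<lambda>i\<in>{..<N}. x i \<otimes>\<^bsub>R\<^esub> y i),
      one = (\<lambda>i\<in>{..<N}. \<one>\<^bsub>R\<^esub>),
      zero = (\<lambda>i\<in>{..<N}. \<zero>\<^bsub>R\<^esub>),
      add = (\<lambda>x y. \<lambda>i\<in>{..<N}. x i \<oplus>\<^bsub>R\<^esub> y i),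
      smult = (\<lambda>a x. \<lambda>i\<in>{..<N}. a \<otimes>\<^bsub>R\<^esub> x i)\<rparr>"

definition free_rank :: "('a, 'r) ring_scheme \<Rightarrow> ('a, 'b, 'm) module_scheme \<Rightarrow> nat" where
  "free_rank R M =
     (GREATEST N. \<exists>f \<in> module_hom R M (free_module R N). f ` carrier M = carrier (free_module R N))"


section \<open>Frobenius\<close>

(* R regarded as a module over itself through the e-th iterate of x \<mapsto> x^p. *)
definition frobenius_pushforward :: "nat \<Rightarrow> nat \<Rightarrow> ('a, 'r) ring_scheme \<Rightarrow> ('a, 'a) module" where
  "frobenius_pushforward p e R =
     \<lparr>carrier = carrier R, mult = mult R, one = \<one>\<^bsub>R\<^esub>, zero = \<zero>\<^bsub>R\<^esub>, add = add R,
      smult = (\<lambda>r x. (r [^]\<^bsub>R\<^esub> (p ^ e)) \<otimes>\<^bsub>R\<^esub> x)\<rparr>"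

definition F_finite :: "nat \<Rightarrow> ('a, 'r) ring_scheme \<Rightarrow> bool" where
  "F_finite p R \<longleftrightarrow> fin_gen_module R (frobenius_pushforward p 1 R)"

(* The R-linear map from R to the pushforward with 1 \<mapsto> c is r \<mapsto> r^(p^e) c. *)
definition strongly_F_regular :: "nat \<Rightarrow> ('a, 'r) ring_scheme \<Rightarrow> bool" where
  "strongly_F_regular p R \<longleftrightarrow>
     (\<forall>c \<in> carrier R. (\<forall>P. minimal_prime P R \<longrightarrow> c \<notin> P) \<longrightarrow>
        (\<exists>e>0. \<exists>\<phi> \<in> module_hom R (frobenius_pushforward p e R) (regular_module R).
           \<forall>r \<in> carrier R. \<phi> (r \<odot>\<^bsub>frobenius_pushforward p e R\<^esub> c) = r))"

definition frobenius_power :: "nat \<Rightarrow> nat \<Rightarrow> ('a, 'r) ring_scheme \<Rightarrow> 'a set \<Rightarrow> 'a set" where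
  "frobenius_power p e R I = Idl\<^bsub>R\<^esub> ((\<lambda>x. x [^]\<^bsub>R\<^esub> (p ^ e)) ` I)"


section \<open>Invariants of a local ring of characteristic p\<close>

definition max_ideal :: "('a, 'r) ring_scheme \<Rightarrow> 'a set" where
  "max_ideal A = (THE M. maximalideal M A)"

definition residue_field :: "('a, 'r) ring_scheme \<Rightarrow> 'a set ring" where
  "residue_field A = A Quot (max_ideal A)"

(* The exponent \<alpha> with p^\<alpha> = [k : k^p]. *)
definition frobenius_exponent :: "nat \<Rightarrow> ('a, 'r) ring_scheme \<Rightarrow> nat" where
  "frobenius_exponent p k =
     (THE \<alpha>. ring.dimension k (p ^ \<alpha>) ((\<lambda>x. x [^]\<^bsub>k\<^esub> p) ` carrier k) (carrier k))"

definition HK_multiplicity :: "nat \<Rightarrow> ('a, 'r) ring_scheme \<Rightarrow> real" where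
  "HK_multiplicity p A =
     (let d = the_enat (krull_dim A)
      in lim (\<lambda>e. real (the_enat (module_length A
                          (quotient_module A (frobenius_power p e A (max_ideal A)))))
                  / real p ^ (e * d)))"

definition F_signature :: "nat \<Rightarrow> ('a, 'r) ring_scheme \<Rightarrow> real" where
  "F_signature p A =
     (let d = the_enat (krull_dim A); \<alpha> = frobenius_exponent p (residue_field A)
      in lim (\<lambda>e. real (free_rank A (frobenius_pushforward p e A)) / real p ^ (e * (d + \<alpha>))))"

end

theory Submission
  imports Defs "HOL-Computational_Algebra.Formal_Power_Series" "HOL-Number_Theory.Residues"
    "HOL-Library.Product_Lexorder" "HOL-Library.Nat_Bijection"
begin

text \<open>For a prime \<open>p\<close> let \<open>A(n, w)\<close> be the local ring at the origin of the monomial algebra spanned over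
  \<open>F\<^sub>p\<close> by the \<open>u\<^sup>i v\<^sup>j\<close> with \<open>n dvd i + w j\<close>, where \<open>w\<close> is a unit modulo \<open>n\<close>. It is a direct summand of a
  two-dimensional regular ring, hence strongly F-regular. Counting monomials gives F-signature \<open>1/n\<close>
  (the free summands of \<open>F\<^sup>e\<^sub>* A\<close> are spanned by the monomials with \<open>i, j < p\<^sup>e\<close>), and Hilbert--Kunz
  multiplicity \<open>d/n\<close>, where \<open>d\<close> is the number of monomials of \<open>F\<^sub>p[u, v]\<close> that are not divisible by a
  nonconstant monomial of the algebra. For \<open>A(4, 3)\<close>, the \<open>A\<^sub>3\<close> singularity, these are \<open>1/4\<close> and \<open>7/4\<close>; for
  \<open>A(3, 1)\<close>, the third Veronese ring, they are \<open>1/3\<close> and \<open>6/3\<close>. The product of the two rings has both as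
  localizations.\<close>

section \<open>Power series in two variables\<close>

text \<open>The two invariants usually agree on which singularity is milder: small Hilbert--Kunz
  multiplicity goes with large F-signature. In this family the signature sees only \<open>n\<close>,
  whereas the multiplicity also depends on \<open>w\<close>. For \<open>w = n - 1\<close> the
  monomial with exponent \<open>(1, 1)\<close> is in the algebra, so the \<open>d = 2 n - 1\<close>
  exponents lie on the two axes and the multiplicity stays below 2 for every \<open>n\<close>. For
  \<open>w = 1\<close> they are the \<open>n (n + 1) / 2\<close> exponents of degree below
  \<open>n\<close>. A larger order of the first kind can thus beat a smaller order of the second in
  multiplicity: 7/4 < 2 while 1/4 < 1/3. Since \<open>p\<close> may divide \<open>n\<close>,
  averaging over a cyclic group of order \<open>n\<close> is no option; a congruence on exponents
  gives the projection onto the algebra in every characteristic. The residue field is the prime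
  field, a finite one, so lengths, free ranks and algebraic dependence all come from counting
  elements: a vector space of dimension \<open>m\<close> has \<open>p ^ m\<close> of them. As both
  factors are already local, localizing the product gives each of them back up to
  isomorphism.\<close>

type_synonym bps = "int fps fps"

definition cf :: "bps \<Rightarrow> nat \<Rightarrow> nat \<Rightarrow> int" where
  "cf x i j = fps_nth (fps_nth x i) j"

definition of_cf :: "(nat \<Rightarrow> nat \<Rightarrow> int) \<Rightarrow> bps" where
  "of_cf f = Abs_fps (\<lambda>i. Abs_fps (f i))"

lemma cf_of_cf [simp]: "cf (of_cf f) i j = f i j" by (simp add: cf_def of_cf_def)

lemma bps_eqI: "(\<And>i j. cf x i j = cf y i j) \<Longrightarrow> x = y" by (simp add: cf_def fps_ext)

lemma cf_add [simp]: "cf (x + y) i j = cf x i j + cf y i j"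
  and cf_diff [simp]: "cf (x - y) i j = cf x i j - cf y i j"
  and cf_uminus [simp]: "cf (- x) i j = - cf x i j"
  and cf_zero [simp]: "cf 0 i j = 0"
  and cf_one: "cf 1 i j = (if i = 0 \<and> j = 0 then 1 else 0)" by (simp_all add: cf_def)

lemma cf_sum [simp]: "cf (sum f S) i j = (\<Sum>s\<in>S. cf (f s) i j)" by (simp add: cf_def fps_sum_nth)

lemma cf_of_int_mult [simp]: "cf (of_int c * x) i j = c * cf x i j"
  by (simp add: cf_def flip: fps_of_int)

lemma cf_of_nat_mult [simp]: "cf (of_nat c * x) i j = int c * cf x i j"
  by (simp add: cf_def flip: fps_of_nat)

lemma cf_mult: "cf (x * y) i j = (\<Sum>k\<le>i. \<Sum>l\<le>j. cf x k l * cf y (i - k) (j - l))"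
  by (simp add: cf_def fps_mult_nth fps_sum_nth atMost_atLeast0)

lemma cf_mult_00 [simp]: "cf (x * y) 0 0 = cf x 0 0 * cf y 0 0" by (simp add: cf_mult)

definition bmon :: "nat \<times> nat \<Rightarrow> bps" where
  "bmon t = of_cf (\<lambda>i j. if t = (i, j) then 1 else 0)"

lemma cf_bmon: "cf (bmon t) i j = (if t = (i, j) then 1 else 0)" by (simp add: bmon_def)

lemma cf_bmon_mult: "cf (bmon (a, b) * x) i j = (if a \<le> i \<and> b \<le> j then cf x (i - a) (j - b) else 0)"
proof -
  have "cf (bmon (a, b) * x) i j =
      (\<Sum>k\<le>i. \<Sum>l\<le>j. if k = a then if l = b then cf x (i - k) (j - l) else 0 else 0)"
    unfolding cf_mult cf_bmon by (intro sum.cong refl) auto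
  also have "\<dots> = (\<Sum>k\<le>i. if k = a then (\<Sum>l\<le>j. if l = b then cf x (i - k) (j - l) else 0) else 0)"
    by (intro sum.cong refl) auto
  also have "\<dots> = (if a \<le> i \<and> b \<le> j then cf x (i - a) (j - b) else 0)" by (simp add: sum.delta)
  finally show ?thesis .
qed

lemma bmon_0: "bmon (0, 0) = 1" by (rule bps_eqI) (auto simp: cf_bmon cf_one)

lemma bmon_mult: "bmon (a, b) * bmon (c, d) = bmon (a + c, b + d)"
  by (rule bps_eqI) (auto simp: cf_bmon_mult cf_bmon)

lemma bmon_power: "bmon (a, b) ^ k = bmon (k * a, k * b)"
  by (induction k) (auto simp: bmon_0 bmon_mult)

text \<open>The zeroth coefficient is a series in the second variable with constant term 1, hence
  invertible, and then the whole series is. Units modulo \<open>p\<close> are normalised to 1 before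
  this is applied.\<close>

lemma ex_inverse:
  assumes "cf x 0 0 = 1"
  shows "\<exists>y. x * y = 1"
proof -
  have 1: "fps_nth x 0 * fps_right_inverse (fps_nth x 0) 1 = 1"
    using assms by (intro fps_right_inverse) (auto simp: cf_def)
  show ?thesis using fps_right_inverse[OF 1] by blast
qed

section \<open>Primality of constants in power series rings\<close>

lemma fps_const_dvd_iff:
  fixes c :: "'a::comm_ring_1"
  shows "fps_const c dvd f \<longleftrightarrow> (\<forall>n. c dvd fps_nth f n)"
proof
  assume "\<forall>n. c dvd fps_nth f n"
  then obtain g where "\<And>n. fps_nth f n = c * g n" unfolding dvd_def by metis
  then have "f = fps_const c * Abs_fps g" by (simp add: fps_ext)
  then show "fps_const c dvd f" by simp
qed auto

text \<open>Gauss's argument: if \<open>a\<close> and \<open>b\<close> are the least indices at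
  which \<open>f\<close> and \<open>g\<close> have coefficients not divisible by \<open>c\<close>,
  then modulo \<open>c\<close> the coefficient of \<open>f * g\<close> at \<open>a + b\<close> is
  the product of these two.\<close>

lemma prime_elem_fps_const:
  fixes c :: "'a::idom"
  assumes c: "prime_elem c"
  shows "prime_elem (fps_const c)"
proof (rule prime_elemI)
  show "fps_const c \<noteq> 0" using c by auto
  show "\<not> fps_const c dvd 1"
    using c fps_const_dvd_iff[of c 1] prime_elem_not_unit[OF c] by (auto dest!: spec[of _ 0])
  fix f g assume dvd: "fps_const c dvd f * g"
  show "fps_const c dvd f \<or> fps_const c dvd g"
  proof (rule ccontr)
    assume "\<not> ?thesis"
    then have ex: "\<exists>n. \<not> c dvd fps_nth f n" "\<exists>n. \<not> c dvd fps_nth g n"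
      by (auto simp: fps_const_dvd_iff)
    define a where "a = (LEAST n. \<not> c dvd fps_nth f n)"
    define b where "b = (LEAST n. \<not> c dvd fps_nth g n)"
    have a: "\<not> c dvd fps_nth f a" "\<And>k. k < a \<Longrightarrow> c dvd fps_nth f k"
      unfolding a_def using LeastI_ex[OF ex(1)] not_less_Least by auto
    have b: "\<not> c dvd fps_nth g b" "\<And>k. k < b \<Longrightarrow> c dvd fps_nth g k"
      unfolding b_def using LeastI_ex[OF ex(2)] not_less_Least by auto
    have "fps_nth (f * g) (a + b) = (\<Sum>k\<in>{0..a+b}. fps_nth f k * fps_nth g (a + b - k))"
      by (simp add: fps_mult_nth)
    also have "\<dots> = fps_nth f a * fps_nth g b + (\<Sum>k\<in>{0..a+b} - {a}. fps_nth f k * fps_nth g (a + b - k))"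
      by (subst sum.remove[of _ a]) auto
    finally have eq: "fps_nth (f * g) (a + b) =
      fps_nth f a * fps_nth g b + (\<Sum>k\<in>{0..a+b} - {a}. fps_nth f k * fps_nth g (a + b - k))" .
    have "c dvd (\<Sum>k\<in>{0..a+b} - {a}. fps_nth f k * fps_nth g (a + b - k))"
    proof (rule dvd_sum)
      fix k assume k: "k \<in> {0..a+b} - {a}"
      show "c dvd fps_nth f k * fps_nth g (a + b - k)"
      proof (cases "k < a")
        case False
        with k have "a + b - k < b" by auto
        then show ?thesis using b(2) by auto
      qed (use a(2) in auto)
    qed
    moreover have "c dvd fps_nth (f * g) (a + b)" using dvd by (simp add: fps_const_dvd_iff)
    ultimately have "c dvd fps_nth f a * fps_nth g b" unfolding eq by (simp only: dvd_add_left_iff)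
    then show False using a(1) b(1) prime_elem_dvd_multD[OF c] by blast
  qed
qed

lemma of_int_dvd_bps_iff: "(of_int c :: bps) dvd x \<longleftrightarrow> (\<forall>i j. c dvd cf x i j)"
  by (simp add: fps_const_dvd_iff cf_def flip: fps_of_int)

lemma prime_elem_of_int_bps:
  assumes "prime_elem (c :: int)"
  shows "prime_elem (of_int c :: bps)"
proof -
  have "(of_int c :: bps) = fps_const (fps_const c)"
    by (rule bps_eqI) (simp add: cf_def flip: fps_of_int)
  then show ?thesis using prime_elem_fps_const[OF prime_elem_fps_const[OF assms]] by simp
qed

subsection \<open>Frobenius modulo a prime\<close>

lemma dvd_freshman_add:
  fixes x y :: "'a::comm_ring_1"
  assumes p: "Factorial_Ring.prime p"
  shows "of_nat p dvd (x + y) ^ p - (x ^ p + y ^ p)"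
proof -
  have p0: "p > 0" using p prime_gt_0_nat by blast
  have "(x + y) ^ p = (\<Sum>k\<le>p. of_nat (p choose k) * x ^ k * y ^ (p - k))" by (rule binomial_ring)
  also have "{..p} = insert 0 (insert p {1..<p})" using p0 by auto
  finally have "(x + y) ^ p - (x ^ p + y ^ p) =
      (\<Sum>k\<in>{1..<p}. of_nat (p choose k) * x ^ k * y ^ (p - k))"
    using p0 by simp
  also have "of_nat p dvd \<dots>"
  proof (rule dvd_sum)
    fix k assume "k \<in> {1..<p}"
    then have "p dvd (p choose k)" using p by (intro dvd_choose_prime) auto
    then have "(of_nat p :: 'a) dvd of_nat (p choose k)" by (metis dvd_def of_nat_mult)
    then show "(of_nat p :: 'a) dvd of_nat (p choose k) * x ^ k * y ^ (p - k)"
      by (simp add: mult.assoc)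
  qed
  finally show ?thesis .
qed

lemma dvd_freshman_sum:
  fixes f :: "'b \<Rightarrow> 'a::comm_ring_1"
  assumes p: "Factorial_Ring.prime p" and "finite S"
  shows "of_nat p dvd (sum f S) ^ p - (\<Sum>s\<in>S. f s ^ p)" using assms(2)
proof (induction rule: finite_induct)
  case empty
  then show ?case using p prime_gt_0_nat by (simp add: power_0_left)
next
  case (insert s S)
  have "of_nat p dvd ((f s + sum f S) ^ p - (f s ^ p + sum f S ^ p)) + (sum f S ^ p - (\<Sum>s\<in>S. f s ^ p))"
    by (intro dvd_add dvd_freshman_add p insert.IH)
  then show ?case using insert.hyps by (simp add: algebra_simps)
qed

text \<open>Modulo \<open>p\<close> the \<open>p\<close>-th power of a finite sum is the sum of the
  \<open>p\<close>-th powers. The series enters through a polynomial \<open>g\<close> with the same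
  coefficients up to \<open>n\<close>, which determines coefficient \<open>n\<close> of the
  power.\<close>

lemma fps_nth_power_prime:
  fixes f :: "'a::comm_ring_1 fps"
  assumes p: "Factorial_Ring.prime p"
  shows "of_nat p dvd fps_nth (f ^ p) n - (if p dvd n then fps_nth f (n div p) ^ p else 0)"
proof -
  have p0: "p > 0" using p prime_gt_0_nat by blast
  define g where "g = (\<Sum>k\<le>n. fps_const (fps_nth f k) * fps_X ^ k)"
  have gk: "fps_nth g k = (if k \<le> n then fps_nth f k else 0)" for k
  proof -
    have "fps_nth g k = (\<Sum>l\<le>n. if l = k then fps_nth f l else 0)"
      unfolding g_def fps_sum_nth by (intro sum.cong) (auto simp: fps_X_power_nth)
    then show ?thesis by simp
  qed
  have pow: "(\<forall>k\<le>n. fps_nth (f ^ m) k = fps_nth (g ^ m) k)" for m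
  proof (induction m)
    case (Suc m)
    show ?case unfolding power_Suc fps_mult_nth by (auto intro!: sum.cong simp: gk Suc)
  qed simp
  have "of_nat p dvd g ^ p - (\<Sum>k\<le>n. (fps_const (fps_nth f k) * fps_X ^ k) ^ p)"
    unfolding g_def by (rule dvd_freshman_sum[OF p]) auto
  then have "fps_const (of_nat p) dvd g ^ p - (\<Sum>k\<le>n. (fps_const (fps_nth f k) * fps_X ^ k) ^ p)"
    by (simp add: fps_of_nat)
  then have "of_nat p dvd fps_nth (g ^ p) n - fps_nth (\<Sum>k\<le>n. (fps_const (fps_nth f k) * fps_X ^ k) ^ p) n"
    unfolding fps_const_dvd_iff fps_sub_nth by blast
  moreover have "fps_nth (\<Sum>k\<le>n. (fps_const (fps_nth f k) * fps_X ^ k) ^ p) n =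
       (if p dvd n then fps_nth f (n div p) ^ p else 0)"
  proof -
    have "fps_nth (\<Sum>k\<le>n. (fps_const (fps_nth f k) * fps_X ^ k) ^ p) n
        = (\<Sum>k\<le>n. if n = k * p then fps_nth f k ^ p else 0)"
      unfolding fps_sum_nth
      by (intro sum.cong) (auto simp: power_mult_distrib fps_X_power_nth fps_const_power simp flip: power_mult)
    also have "\<dots> = (\<Sum>k\<le>n. if k = n div p then (if p dvd n then fps_nth f k ^ p else 0) else 0)"
      using p0 by (intro sum.cong) (auto simp: dvd_def)
    also have "\<dots> = (if p dvd n then fps_nth f (n div p) ^ p else 0)" by simp
    finally show ?thesis .
  qed
  ultimately show ?thesis using pow[of p] by simp
qed

lemma int_power_prime_mod:
  assumes p: "Factorial_Ring.prime (p::nat)"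
  shows "int p dvd (a::int) ^ p - a"
proof (cases "int p dvd a")
  case True
  have "a dvd a ^ p" using prime_gt_0_nat[OF p] by (intro dvd_power) simp
  then have "int p dvd a ^ p" using True by (rule dvd_trans[rotated])
  then show ?thesis using True by (rule dvd_diff)
next
  case False
  define b where "b = nat (a mod int p)"
  have b: "int b = a mod int p" using p prime_gt_0_nat by (simp add: b_def)
  have "\<not> p dvd b" using b False by (metis dvd_mod_iff dvd_refl int_dvd_int_iff)
  then have "[b ^ (p - 1) = 1] (mod p)" by (rule fermat_theorem[OF p])
  then have "[int (b ^ (p-1)) = int 1] (mod int p)" by (subst cong_int_iff)
  then have "[int b ^ (p-1) * int b = 1 * int b] (mod int p)" by (intro cong_mult) auto
  moreover have "int b ^ (p-1) * int b = int b ^ p"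
    using p prime_gt_0_nat[of p] by (metis One_nat_def Suc_pred mult.commute power_Suc)
  ultimately have "[(a mod int p)^p = a mod int p] (mod int p)" using b by simp
  then have "[a^p = a] (mod int p)" by (simp add: cong_def power_mod)
  then show ?thesis by (simp add: cong_iff_dvd_diff)
qed

text \<open>The one-variable statement is applied to the outer and then to the inner series; the
  \<open>p\<close>-th power of an integer that remains is removed by Fermat's theorem.\<close>

lemma cf_power_prime:
  assumes p: "Factorial_Ring.prime (p::nat)"
  shows "int p dvd cf (x ^ p) i j - (if p dvd i \<and> p dvd j then cf x (i div p) (j div p) else 0)"
proof -
  have "of_nat p dvd fps_nth (x ^ p) i - (if p dvd i then fps_nth x (i div p) ^ p else 0)"
    by (rule fps_nth_power_prime[OF p])
  then have 1: "int p dvd fps_nth (fps_nth (x ^ p) i) j - fps_nth (if p dvd i then fps_nth x (i div p) ^ p else 0) j"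
    unfolding fps_of_nat[symmetric] fps_const_dvd_iff by auto
  have 2: "int p dvd fps_nth (fps_nth x (i div p) ^ p) j - (if p dvd j then fps_nth (fps_nth x (i div p)) (j div p) ^ p else 0)"
    using fps_nth_power_prime[OF p, of "fps_nth x (i div p)" j] by simp
  have 3: "int p dvd fps_nth (fps_nth x (i div p)) (j div p) ^ p - fps_nth (fps_nth x (i div p)) (j div p)"
    by (rule int_power_prime_mod[OF p])
  show ?thesis
  proof (cases "p dvd i \<and> p dvd j")
    case True
    then show ?thesis using dvd_add[OF dvd_add[OF 1 2] 3] by (simp add: cf_def)
  next
    case False
    show ?thesis
    proof (cases "p dvd i")
      case True
      with False have "\<not> p dvd j" by simp
      with True show ?thesis using dvd_add[OF 1 2] by (simp add: cf_def)
    next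
      case False
      then show ?thesis using 1 by (simp add: cf_def)
    qed
  qed
qed

subsection \<open>Reduction modulo a prime\<close>

locale charp =
  fixes p :: nat
  assumes p: "Factorial_Ring.prime p"
begin

lemma p_gt_1: "p > 1" and p_gt_0: "p > 0" using p prime_gt_1_nat prime_gt_0_nat by auto

lemma prime_int_p: "Factorial_Ring.prime (int p)" using p by simp

lemma ex_inverse_mod_p:
  assumes "\<not> int p dvd c"
  obtains m where "[c * m = 1] (mod int p)"
proof -
  have "coprime (int p) c" using assms prime_int_p by (intro prime_imp_coprime)
  then show ?thesis using that cong_solve_coprime_int[of c "int p"] by (auto simp: coprime_commute)
qed

text \<open>Power series over \<open>F\<^sub>p\<close> are represented by integral power series with coefficients in
  \<open>{0..<p}\<close>; \<open>red x = red y\<close> is congruence modulo \<open>p\<close>.\<close>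

definition red :: "bps \<Rightarrow> bps" where
  "red x = of_cf (\<lambda>i j. cf x i j mod int p)"

definition supp :: "bps \<Rightarrow> (nat \<times> nat) set" where
  "supp x = {(i, j). \<not> int p dvd cf x i j}"

lemma cf_red: "cf (red x) i j = cf x i j mod int p" by (simp add: red_def)

lemma red_red [simp]: "red (red x) = red x" by (rule bps_eqI) (simp add: cf_red)

lemma red_0 [simp]: "red 0 = 0" and red_1 [simp]: "red 1 = 1" and red_bmon [simp]: "red (bmon t) = bmon t"
  using p_gt_1 by (auto intro!: bps_eqI simp: cf_red cf_one cf_bmon)

lemma red_eq_iff_cf: "red x = red y \<longleftrightarrow> (\<forall>i j. int p dvd cf x i j - cf y i j)"
proof
  assume "red x = red y"
  then have "cf x i j mod int p = cf y i j mod int p" for i j by (metis cf_red)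
  then show "\<forall>i j. int p dvd cf x i j - cf y i j" by (simp add: mod_eq_dvd_iff)
next
  assume "\<forall>i j. int p dvd cf x i j - cf y i j"
  then show "red x = red y" by (intro bps_eqI) (simp add: mod_eq_dvd_iff cf_red)
qed

lemma red_eqI: "(\<And>i j. int p dvd cf x i j - cf y i j) \<Longrightarrow> red x = red y" by (simp add: red_eq_iff_cf)

lemma red_eq_iff: "red x = red y \<longleftrightarrow> of_nat p dvd x - y"
  using of_int_dvd_bps_iff[of "int p" "x - y"] by (simp add: red_eq_iff_cf)

lemma red_add_cong: "red x = red x' \<Longrightarrow> red y = red y' \<Longrightarrow> red (x + y) = red (x' + y')"
  unfolding red_eq_iff by (drule (1) dvd_add) (simp add: algebra_simps)

lemma red_diff_cong: "red x = red x' \<Longrightarrow> red y = red y' \<Longrightarrow> red (x - y) = red (x' - y')"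
  unfolding red_eq_iff by (drule (1) dvd_diff) (simp add: algebra_simps)

lemma red_mult_cong:
  assumes "red x = red x'" "red y = red y'"
  shows "red (x * y) = red (x' * y')"
proof -
  have "of_nat p dvd (x - x') * y + x' * (y - y')"
    using assms unfolding red_eq_iff by (intro dvd_add dvd_mult2 dvd_mult)
  then show ?thesis unfolding red_eq_iff by (simp add: algebra_simps)
qed

lemma red_power_cong: "red x = red y \<Longrightarrow> red (x ^ k) = red (y ^ k)"
  by (induction k) (auto intro: red_mult_cong)

lemma red_sum_cong: "(\<And>s. s \<in> S \<Longrightarrow> red (f s) = red (g s)) \<Longrightarrow> red (sum f S) = red (sum g S)"
  by (induction S rule: infinite_finite_induct) (auto intro: red_add_cong)

lemma red_simps [simp]:
  "red (red x + y) = red (x + y)" "red (x + red y) = red (x + y)"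
  "red (red x * y) = red (x * y)" "red (x * red y) = red (x * y)"
  "red (red x - y) = red (x - y)" "red (x - red y) = red (x - y)"
  "red (red x ^ k) = red (x ^ k)"
  by (auto intro: red_add_cong red_mult_cong red_diff_cong red_power_cong)

lemma supp_red [simp]: "supp (red x) = supp x" by (auto simp: supp_def cf_red dvd_mod_iff)

lemma supp_cong: "red x = red y \<Longrightarrow> supp x = supp y" using supp_red by metis

lemma supp_empty_iff: "supp x = {} \<longleftrightarrow> red x = 0" using red_eq_iff_cf[of x 0] by (auto simp: supp_def)

lemma supp_0 [simp]: "supp 0 = {}" by (simp add: supp_def)
lemma supp_bmon [simp]: "supp (bmon t) = {t}" using p_gt_1 by (auto simp: supp_def cf_bmon)
lemma supp_1 [simp]: "supp 1 = {(0, 0)}" using supp_bmon[of "(0, 0)"] by (simp add: bmon_0)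

lemma supp_add: "supp (x + y) \<subseteq> supp x \<union> supp y"
  and supp_diff: "supp (x - y) \<subseteq> supp x \<union> supp y" by (auto simp: supp_def)

lemma supp_uminus [simp]: "supp (- x) = supp x" by (auto simp: supp_def)

lemma supp_mult: "supp (x * y) \<subseteq> (\<lambda>((a, b), (c, d)). (a + c, b + d)) ` (supp x \<times> supp y)"
proof (clarsimp)
  fix i j assume "(i, j) \<in> supp (x * y)"
  then have "\<not> int p dvd (\<Sum>k\<le>i. \<Sum>l\<le>j. cf x k l * cf y (i - k) (j - l))"
    by (simp add: supp_def cf_mult)
  then obtain k l where kl: "k \<le> i" "l \<le> j" "\<not> int p dvd cf x k l * cf y (i - k) (j - l)"
    by (meson dvd_sum atMost_iff)
  then have "(k, l) \<in> supp x" "(i - k, j - l) \<in> supp y" by (auto simp: supp_def)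
  then show "(i, j) \<in> (\<lambda>x. case x of (x, xa) \<Rightarrow> (case x of (a, b) \<Rightarrow> \<lambda>(c, d). (a + c, b + d)) xa) ` (supp x \<times> supp y)"
    using kl by (intro image_eqI[of _ _ "((k, l), (i - k, j - l))"]) auto
qed

lemma supp_multE:
  assumes "t \<in> supp (x * y)"
  obtains a b c d where "(a, b) \<in> supp x" "(c, d) \<in> supp y" "t = (a + c, b + d)"
  using supp_mult assms by fastforce

lemma finite_supp_mult: "finite (supp x) \<Longrightarrow> finite (supp y) \<Longrightarrow> finite (supp (x * y))"
  by (rule finite_subset[OF supp_mult]) auto

lemma supp_mult_00: "(0, 0) \<in> supp (x * y) \<longleftrightarrow> (0, 0) \<in> supp x \<and> (0, 0) \<in> supp y"
  using prime_int_p by (auto simp: supp_def prime_dvd_mult_iff)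

text \<open>Primality of \<open>p\<close> among the integral power series means that the series over
  the prime field have no zero divisors; this makes \<open>A\<close> a domain.\<close>

lemma red_mult_eq_0: "red (x * y) = 0 \<longleftrightarrow> red x = 0 \<or> red y = 0"
proof -
  have "prime_elem (of_nat p :: bps)" using prime_elem_of_int_bps[of "int p"] prime_int_p by auto
  then show ?thesis using red_eq_iff[of "x * y" 0] red_eq_iff[of x 0] red_eq_iff[of y 0]
    by (simp add: prime_elem_dvd_mult_iff)
qed

lemma red_eq_sum_bmon:
  assumes "finite (supp f)"
  shows "red f = red (\<Sum>t\<in>supp f. of_nat (nat (cf f (fst t) (snd t) mod int p)) * bmon t)"
proof (rule red_eqI)
  fix i j
  let ?g = "\<Sum>t\<in>supp f. of_nat (nat (cf f (fst t) (snd t) mod int p)) * bmon t"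
  have "cf ?g i j = (\<Sum>t\<in>supp f. if t = (i, j) then cf f (fst t) (snd t) mod int p else 0)"
    using p_gt_0 unfolding cf_sum by (intro sum.cong) (auto simp: cf_bmon)
  also have "\<dots> = (if (i, j) \<in> supp f then cf f i j mod int p else 0)" using assms by simp
  finally show "int p dvd cf f i j - cf ?g i j"
    by (auto simp: supp_def simp flip: minus_mod_eq_div_mult)
qed

text \<open>Every residue modulo \<open>p\<close> is a sum of ones, so monomials generate the
  polynomials additively and no case for scalars occurs. Polynomials are only determined modulo
  \<open>p\<close>, hence \<open>cong\<close>.\<close>

lemma polynomial_induct:
  assumes "finite (supp f)" "supp f \<subseteq> U"
    and zero: "P 0"
    and add: "\<And>x y. P x \<Longrightarrow> P y \<Longrightarrow> P (x + y)"
    and mon: "\<And>t. t \<in> U \<Longrightarrow> P (bmon t)"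
    and cong: "\<And>x y. red x = red y \<Longrightarrow> P x \<Longrightarrow> P y"
  shows "P f"
proof -
  have 1: "P (of_nat k * bmon t)" if "t \<in> U" for k t
  proof (induction k)
    case (Suc k)
    then show ?case using add mon[OF that] by (simp add: distrib_right)
  qed (use zero in auto)
  have "P (\<Sum>t\<in>S. of_nat (c t) * bmon t)" if "finite S" "S \<subseteq> U" for S and c :: "nat \<times> nat \<Rightarrow> nat"
    using that by (induction S rule: finite_induct) (auto intro: zero add 1)
  from this[OF assms(1,2)] show ?thesis by (rule cong[OF red_eq_sum_bmon[OF assms(1), symmetric]])
qed

subsection \<open>Iterated Frobenius\<close>

text \<open>The substitution of \<open>u ^ q\<close> and \<open>v ^ q\<close> for the variables. For
  \<open>q\<close> a power of \<open>p\<close> it agrees modulo \<open>p\<close> with the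
  \<open>q\<close>-th power map, because the coefficients lie in the prime field.\<close>

definition frob :: "nat \<Rightarrow> bps \<Rightarrow> bps" where
  "frob q x = of_cf (\<lambda>i j. if q dvd i \<and> q dvd j then cf x (i div q) (j div q) else 0)"

lemma red_power_p: "red (x ^ p) = red (frob p x)"
  using cf_power_prime[OF p] by (intro red_eqI) (simp add: frob_def)

lemma frob_cong: "red x = red y \<Longrightarrow> red (frob q x) = red (frob q y)"
  by (auto simp: red_eq_iff_cf frob_def)

lemma frob_frob:
  assumes "q > 0"
  shows "frob q (frob r x) = frob (q * r) x"
proof (rule bps_eqI)
  fix i j
  have *: "q dvd k \<and> r dvd k div q \<longleftrightarrow> q * r dvd k" for k
    using assms by (metis dvd_mult_div_cancel dvd_mult_left dvd_mult_cancel1 nat_mult_dvd_cancel1)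
  have "cf (frob q (frob r x)) i j = (if (q dvd i \<and> r dvd i div q) \<and> (q dvd j \<and> r dvd j div q)
      then cf x (i div q div r) (j div q div r) else 0)"
    by (simp add: frob_def)
  then show "cf (frob q (frob r x)) i j = cf (frob (q * r) x) i j"
    unfolding * by (simp add: frob_def div_mult2_eq)
qed

lemma red_power_pe: "red (x ^ (p ^ e)) = red (frob (p ^ e) x)"
proof (induction e)
  case 0
  then show ?case by (auto intro!: red_eqI simp: frob_def)
next
  case (Suc e)
  have "red (x ^ (p ^ Suc e)) = red ((x ^ (p ^ e)) ^ p)"
    by (simp add: power_mult[symmetric] mult.commute)
  also have "\<dots> = red (frob p (x ^ (p ^ e)))" by (rule red_power_p)
  also have "\<dots> = red (frob p (frob (p ^ e) x))" using Suc by (rule frob_cong)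
  finally show ?case using p_gt_0 by (simp add: frob_frob)
qed

lemma supp_power_pe: "supp (x ^ (p ^ e)) = (\<lambda>(a, b). (p ^ e * a, p ^ e * b)) ` supp x"
proof -
  have "supp (x ^ (p ^ e)) = supp (frob (p ^ e) x)" by (rule supp_cong[OF red_power_pe])
  also have "\<dots> = (\<lambda>(a, b). (p ^ e * a, p ^ e * b)) ` supp x"
    using p_gt_0 by (force simp: frob_def supp_def split: if_splits)
  finally show ?thesis .
qed

text \<open>A Cartier-type operator: the power series form a free module over the image of
  \<open>frob q\<close>, with the monomials of exponents below \<open>q\<close> as a basis, and
  \<open>phi q t\<close> is the coordinate at \<open>t\<close> if both entries of \<open>t\<close>
  are below \<open>q\<close>.\<close>

definition phi :: "nat \<Rightarrow> nat \<times> nat \<Rightarrow> bps \<Rightarrow> bps" where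
  "phi q t x = of_cf (\<lambda>i j. cf x (q * i + fst t) (q * j + snd t))"

lemma sum_multiples:
  fixes g :: "nat \<Rightarrow> 'a::comm_monoid_add"
  assumes "a < q"
  shows "(\<Sum>k\<le>q * i + a. if q dvd k then g k else 0) = (\<Sum>k\<le>i. g (q * k))"
proof -
  have *: "{k \<in> {..q * i + a}. q dvd k} = (\<lambda>k. q * k) ` {..i}"
  proof (intro equalityI subsetI)
    fix k assume "k \<in> {k \<in> {..q * i + a}. q dvd k}"
    then obtain l where l: "k = q * l" "q * l \<le> q * i + a" by auto
    have "q * l < q * Suc i" using l(2) assms by simp
    then have "l < Suc i" using assms by (simp only: mult_less_cancel1)
    then show "k \<in> (\<lambda>k. q * k) ` {..i}" using l by auto
  qed (use assms in \<open>auto intro: trans_le_add1\<close>)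
  have "(\<Sum>k\<le>q * i + a. if q dvd k then g k else 0) = sum g {k \<in> {..q * i + a}. q dvd k}"
    by (rule sum.inter_filter[symmetric]) simp
  also have "\<dots> = (\<Sum>k\<le>i. g (q * k))"
    unfolding * using assms by (subst sum.reindex) (auto simp: inj_on_def)
  finally show ?thesis .
qed

lemma phi_frob_mult:
  assumes "fst t < q" "snd t < q"
  shows "phi q t (frob q x * y) = x * phi q t y"
proof (rule bps_eqI)
  fix i j
  let ?I = "q * i + fst t" and ?J = "q * j + snd t"
  have "cf (phi q t (frob q x * y)) i j =
      (\<Sum>k\<le>?I. \<Sum>l\<le>?J. cf (frob q x) k l * cf y (?I - k) (?J - l))"
    by (simp add: phi_def cf_mult)
  also have "\<dots> = (\<Sum>k\<le>?I. if q dvd k then (\<Sum>l\<le>?J. if q dvd l then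
      cf x (k div q) (l div q) * cf y (?I - k) (?J - l) else 0) else 0)"
    by (intro sum.cong refl) (auto simp: frob_def intro!: sum.cong sum.neutral)
  also have "\<dots> = (\<Sum>k\<le>i. \<Sum>l\<le>j. cf x k l * cf y (?I - q * k) (?J - q * l))"
    using assms by (simp add: sum_multiples)
  also have "\<dots> = (\<Sum>k\<le>i. \<Sum>l\<le>j. cf x k l * cf y (q * (i - k) + fst t) (q * (j - l) + snd t))"
    by (intro sum.cong refl) (auto simp: diff_mult_distrib2)
  also have "\<dots> = cf (x * phi q t y) i j" by (simp add: phi_def cf_mult)
  finally show "cf (phi q t (frob q x * y)) i j = cf (x * phi q t y) i j" .
qed

lemma phi_cong: "red x = red y \<Longrightarrow> red (phi q t x) = red (phi q t y)"
  by (auto simp: red_eq_iff_cf phi_def)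

lemma phi_power_mult:
  assumes "fst t < p ^ e" "snd t < p ^ e"
  shows "red (phi (p ^ e) t (x ^ (p ^ e) * y)) = red (x * phi (p ^ e) t y)"
proof -
  have "red (x ^ (p ^ e) * y) = red (frob (p ^ e) x * y)"
    by (rule red_mult_cong[OF red_power_pe refl])
  from phi_cong[OF this] show ?thesis by (simp add: phi_frob_mult assms)
qed

lemma phi_add: "phi q t (x + y) = phi q t x + phi q t y" by (rule bps_eqI) (simp add: phi_def)

lemma phi_bmon:
  assumes "fst t < q" "snd t < q" "fst t' < q" "snd t' < q"
  shows "phi q t (bmon t') = (if t = t' then 1 else 0)"
proof (rule bps_eqI)
  fix i j
  have *: "a < q \<Longrightarrow> b < q \<Longrightarrow> b = q * k + a \<longleftrightarrow> k = 0 \<and> a = b" for a b k :: nat by (cases k) auto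
  have "cf (phi q t (bmon t')) i j = (if fst t' = q * i + fst t \<and> snd t' = q * j + snd t then 1 else 0)"
    by (cases t') (auto simp: phi_def cf_bmon)
  also have "\<dots> = cf (if t = t' then 1 else 0) i j" using assms by (auto simp: * cf_one prod_eq_iff)
  finally show "cf (phi q t (bmon t')) i j = cf (if t = t' then 1 else 0) i j" .
qed

lemma finite_supp_phi:
  assumes "finite (supp x)" "q > 0"
  shows "finite (supp (phi q t x))"
proof (rule finite_imageD)
  show "finite ((\<lambda>(i, j). (q * i + fst t, q * j + snd t)) ` supp (phi q t x))"
    by (rule finite_subset[OF _ assms(1)]) (auto simp: supp_def phi_def)
  show "inj_on (\<lambda>(i, j). (q * i + fst t, q * j + snd t)) (supp (phi q t x))"
    using assms(2) by (auto simp: inj_on_def)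
qed

end

section \<open>Cyclic quotient singularities of dimension two\<close>

text \<open>The inverse \<open>w'\<close> puts \<open>(n - 1, w')\<close> into the semigroup, next
  to \<open>(w, n - 1)\<close>. Subtracting \<open>(n, 0)\<close> and \<open>(0, n)\<close> gives
  lattice vectors with entry -1 in either coordinate; they show that monomials with an exponent of
  at least \<open>p ^ e\<close> contribute no free summand.\<close>

locale toric = charp +
  fixes n w w' :: nat
  assumes n: "n > 1" and ww': "[w * w' = 1] (mod n)"
begin

section \<open>The semigroup of exponents and its local ring\<close>

definition Sg :: "(nat \<times> nat) set" where
  "Sg = {(i, j). n dvd i + w * j}"

lemma Sg_0 [simp]: "(0, 0) \<in> Sg" by (simp add: Sg_def)

text \<open>The semigroup consists of all points of a lattice in the quadrant, so a difference that
  stays in the quadrant stays in the semigroup. The projection \<open>rho\<close> and all divisions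
  by monomials rest on this.\<close>

lemma Sg_add_iff: "(a, b) \<in> Sg \<Longrightarrow> (a + c, b + d) \<in> Sg \<longleftrightarrow> (c, d) \<in> Sg"
proof -
  have "a + c + w * (b + d) = (a + w * b) + (c + w * d)" by (simp add: algebra_simps)
  then show "(a, b) \<in> Sg \<Longrightarrow> (a + c, b + d) \<in> Sg \<longleftrightarrow> (c, d) \<in> Sg"
    unfolding Sg_def mem_Collect_eq case_prod_conv by (simp only: dvd_add_right_iff)
qed

lemma Sg_add: "(a, b) \<in> Sg \<Longrightarrow> (c, d) \<in> Sg \<Longrightarrow> (a + c, b + d) \<in> Sg" by (simp add: Sg_add_iff)

lemma Sg_mult: "(a, b) \<in> Sg \<Longrightarrow> (k * a, k * b) \<in> Sg"
proof -
  have "k * a + w * (k * b) = k * (a + w * b)" by (simp add: algebra_simps)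
  then show "(a, b) \<in> Sg \<Longrightarrow> (k * a, k * b) \<in> Sg" by (simp add: Sg_def)
qed

lemma Sg_n: "(n * a, n * b) \<in> Sg" by (auto simp: Sg_def)

lemma Sg_w: "(w, n - 1) \<in> Sg"
proof -
  have "w + w * (n - 1) = w * n" using n by (cases n) auto
  then show ?thesis by (simp add: Sg_def)
qed

lemma Sg_w': "(n - 1, w') \<in> Sg"
proof -
  have "[n - 1 + w * w' = n - 1 + 1] (mod n)" by (rule cong_add[OF cong_refl ww'])
  then have "[n - 1 + w * w' = 0] (mod n)" using n by (simp add: cong_def)
  then show ?thesis by (simp add: Sg_def cong_0_iff)
qed

text \<open>\<open>A\<close> is the local ring at the origin of \<open>F\<^sub>p[Sg]\<close>, realized inside the ring of power series:
  \<open>InA x\<close> says that \<open>s x\<close> is in \<open>F\<^sub>p[Sg]\<close> for some \<open>s\<close> in \<open>F\<^sub>p[Sg]\<close> that does not vanish at the origin.\<close>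

definition InR :: "bps \<Rightarrow> bool" where
  "InR x \<longleftrightarrow> finite (supp x) \<and> supp x \<subseteq> Sg"

definition InA :: "bps \<Rightarrow> bool" where
  "InA x \<longleftrightarrow> supp x \<subseteq> Sg \<and> (\<exists>s. InR s \<and> (0, 0) \<in> supp s \<and> InR (s * x))"

definition A :: "bps ring" where
  "A = \<lparr>carrier = {x. red x = x \<and> InA x}, mult = (\<lambda>x y. red (x * y)), one = 1, zero = 0,
        add = (\<lambda>x y. red (x + y))\<rparr>"

lemma A_simps [simp]:
  "mult A x y = red (x * y)" "add A x y = red (x + y)" "\<one>\<^bsub>A\<^esub> = 1" "\<zero>\<^bsub>A\<^esub> = 0"
  by (simp_all add: A_def)

lemma carrier_A: "carrier A = {x. red x = x \<and> InA x}" by (simp add: A_def)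

lemma InR_cong: "red x = red y \<Longrightarrow> InR x \<longleftrightarrow> InR y" unfolding InR_def using supp_cong[of x y] by simp

lemma InR_red [simp]: "InR (red x) = InR x" by (rule InR_cong) simp

lemma InA_cong: "red x = red y \<Longrightarrow> InA x \<longleftrightarrow> InA y"
proof -
  assume xy: "red x = red y"
  have "InR (s * x) \<longleftrightarrow> InR (s * y)" for s by (rule InR_cong, rule red_mult_cong[OF refl xy])
  then show ?thesis unfolding InA_def supp_cong[OF xy] by (simp only:)
qed

lemma InA_red [simp]: "InA (red x) = InA x" by (rule InA_cong) simp

lemma supp_mult_Sg: "supp x \<subseteq> Sg \<Longrightarrow> supp y \<subseteq> Sg \<Longrightarrow> supp (x * y) \<subseteq> Sg"
proof
  fix t assume *: "supp x \<subseteq> Sg" "supp y \<subseteq> Sg" and "t \<in> supp (x * y)"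
  then obtain a b c d where "(a, b) \<in> supp x" "(c, d) \<in> supp y" "t = (a + c, b + d)"
    by (elim supp_multE)
  then show "t \<in> Sg" using * Sg_add by blast
qed

lemma InR_mult: "InR x \<Longrightarrow> InR y \<Longrightarrow> InR (x * y)"
  unfolding InR_def by (blast intro: supp_mult_Sg[THEN subsetD] finite_supp_mult)

lemma InR_add: "InR x \<Longrightarrow> InR y \<Longrightarrow> InR (x + y)"
  unfolding InR_def using supp_add[of x y] by (auto intro: finite_subset)

lemma InR_bmon: "t \<in> Sg \<Longrightarrow> InR (bmon t)" by (simp add: InR_def)

lemma InR_1 [simp]: "InR 1" and InR_0 [simp]: "InR 0" by (simp_all add: InR_def)

lemma InR_power: "InR x \<Longrightarrow> InR (x ^ k)" by (induction k) (auto intro: InR_mult)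

lemma InR_imp_InA: "InR x \<Longrightarrow> InA x" unfolding InA_def by (auto simp: InR_def intro!: exI[of _ 1])

lemma InA_supp: "InA x \<Longrightarrow> supp x \<subseteq> Sg" by (simp add: InA_def)

lemma InAE:
  assumes "InA x"
  obtains s where "InR s" "(0, 0) \<in> supp s" "InR (s * x)" using assms by (auto simp: InA_def)

lemma InA_add:
  assumes "InA x" "InA y"
  shows "InA (x + y)"
proof -
  obtain s where s: "InR s" "(0, 0) \<in> supp s" "InR (s * x)" using assms(1) by (rule InAE)
  obtain t where t: "InR t" "(0, 0) \<in> supp t" "InR (t * y)" using assms(2) by (rule InAE)
  have "InR (t * (s * x) + s * (t * y))" using s t by (meson InR_add InR_mult)
  then have "InR ((s * t) * (x + y))" by (simp add: algebra_simps)
  moreover have "supp (x + y) \<subseteq> Sg" using supp_add[of x y] assms InA_supp by blast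
  ultimately show ?thesis unfolding InA_def
    using s t by (blast intro: InR_mult supp_mult_00[THEN iffD2])
qed

lemma InA_mult:
  assumes "InA x" "InA y"
  shows "InA (x * y)"
proof -
  obtain s where s: "InR s" "(0, 0) \<in> supp s" "InR (s * x)" using assms(1) by (rule InAE)
  obtain t where t: "InR t" "(0, 0) \<in> supp t" "InR (t * y)" using assms(2) by (rule InAE)
  have "InR ((s * x) * (t * y))" using s t by (meson InR_mult)
  then have "InR ((s * t) * (x * y))" by (simp add: algebra_simps)
  moreover have "supp (x * y) \<subseteq> Sg" using supp_mult_Sg assms InA_supp by blast
  ultimately show ?thesis unfolding InA_def
    using s t by (blast intro: InR_mult supp_mult_00[THEN iffD2])
qed

lemma InA_uminus: "InA x \<Longrightarrow> InA (- x)" by (simp add: InA_def InR_def)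

lemma InA_1 [simp]: "InA 1" and InA_0 [simp]: "InA 0" by (auto intro: InR_imp_InA)

lemma InA_power: "InA x \<Longrightarrow> InA (x ^ k)" by (induction k) (auto intro: InA_mult)

lemma carrier_AI: "InA x \<Longrightarrow> red x \<in> carrier A" by (simp add: carrier_A)

lemma carrier_AD: "x \<in> carrier A \<Longrightarrow> red x = x" "x \<in> carrier A \<Longrightarrow> InA x" by (simp_all add: carrier_A)

lemma bmon_in_A: "t \<in> Sg \<Longrightarrow> bmon t \<in> carrier A" by (simp add: carrier_A InR_imp_InA InR_bmon)

lemma A_cring: "cring A"
proof (rule cringI)
  show "abelian_group A"
  proof (rule abelian_groupI)
    fix x assume x: "x \<in> carrier A"
    have "red (- x) \<in> carrier A" using x by (intro carrier_AI InA_uminus) (simp add: carrier_A)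
    moreover have "red (- x) \<oplus>\<^bsub>A\<^esub> x = \<zero>\<^bsub>A\<^esub>" by simp
    ultimately show "\<exists>y\<in>carrier A. y \<oplus>\<^bsub>A\<^esub> x = \<zero>\<^bsub>A\<^esub>" by blast
  next
    fix x y z assume "x \<in> carrier A" "y \<in> carrier A" "z \<in> carrier A"
    show "x \<oplus>\<^bsub>A\<^esub> y \<oplus>\<^bsub>A\<^esub> z = x \<oplus>\<^bsub>A\<^esub> (y \<oplus>\<^bsub>A\<^esub> z)" by (simp add: add.assoc)
  next
    fix x y assume "x \<in> carrier A" "y \<in> carrier A"
    show "x \<oplus>\<^bsub>A\<^esub> y = y \<oplus>\<^bsub>A\<^esub> x" by (simp add: add.commute)
  qed (simp_all add: carrier_A InA_add)
  show "comm_monoid A"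
  proof (rule comm_monoidI)
    fix x y z assume "x \<in> carrier A" "y \<in> carrier A" "z \<in> carrier A"
    show "x \<otimes>\<^bsub>A\<^esub> y \<otimes>\<^bsub>A\<^esub> z = x \<otimes>\<^bsub>A\<^esub> (y \<otimes>\<^bsub>A\<^esub> z)" by (simp add: mult.assoc)
  next
    fix x y assume "x \<in> carrier A" "y \<in> carrier A"
    show "x \<otimes>\<^bsub>A\<^esub> y = y \<otimes>\<^bsub>A\<^esub> x" by (simp add: mult.commute)
  qed (simp_all add: carrier_A InA_mult)
qed (simp add: distrib_right)

sublocale A: cring A by (rule A_cring)

lemma A_pow [simp]: "x [^]\<^bsub>A\<^esub> (k::nat) = red (x ^ k)"
  by (induction k) (auto simp: nat_pow_def mult.commute)

lemma A_minus: "x \<in> carrier A \<Longrightarrow> \<ominus>\<^bsub>A\<^esub> x = red (- x)"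
  by (rule A.minus_equality) (auto simp: carrier_A InA_uminus)

lemma A_domain: "domain A"
proof (rule domain.intro[OF A_cring], rule domain_axioms.intro)
  fix a b assume "a \<otimes>\<^bsub>A\<^esub> b = \<zero>\<^bsub>A\<^esub>" "a \<in> carrier A" "b \<in> carrier A"
  then show "a = \<zero>\<^bsub>A\<^esub> \<or> b = \<zero>\<^bsub>A\<^esub>"
    using red_mult_eq_0[of a b] carrier_AD(1)[of a] carrier_AD(1)[of b] by simp
qed simp

lemma A_add_pow_one: "[(k::nat)] \<cdot>\<^bsub>A\<^esub> \<one>\<^bsub>A\<^esub> = red (of_nat k)"
proof (induction k)
  case (Suc k)
  then show ?case using A.add.nat_pow_Suc[of k "\<one>\<^bsub>A\<^esub>"] by (simp add: add.commute)
qed (simp add: A.add.nat_pow_0)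

lemma A_characteristic: "has_characteristic A p"
proof -
  have cf: "cf (of_nat m) i j = (if i = 0 \<and> j = 0 then int m else 0)" for m i j
    using cf_of_nat_mult[of m 1 i j] by (simp add: cf_one)
  have "red (of_nat m) = 0 \<longleftrightarrow> p dvd m" for m using red_eq_iff_cf[of "of_nat m" 0] by (auto simp: cf)
  then show ?thesis using A_add_pow_one by (simp add: has_characteristic_def)
qed

definition rho :: "bps \<Rightarrow> bps" where
  "rho x = of_cf (\<lambda>i j. if (i, j) \<in> Sg then cf x i j else 0)"

lemma rho_cong: "red x = red y \<Longrightarrow> red (rho x) = red (rho y)" by (auto simp: red_eq_iff_cf rho_def)

lemma rho_add: "rho (x + y) = rho x + rho y" by (rule bps_eqI) (simp add: rho_def)

lemma supp_rho: "supp (rho x) = supp x \<inter> Sg" by (auto simp: supp_def rho_def)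

lemma rho_id: "supp x \<subseteq> Sg \<Longrightarrow> red (rho x) = red x" by (rule red_eqI) (auto simp: rho_def supp_def)

text \<open>\<open>rho\<close> splits the inclusion of the series supported in \<open>Sg\<close>
  into all power series. It is linear because multiplying by a monomial of \<open>Sg\<close> moves
  no exponent into \<open>Sg\<close> or out of it.\<close>

lemma rho_mult:
  assumes "supp x \<subseteq> Sg"
  shows "red (rho (x * y)) = red (x * rho y)"
proof (rule red_eqI)
  fix i j
  have "cf (rho (x * y)) i j - cf (x * rho y) i j =
     (\<Sum>k\<le>i. \<Sum>l\<le>j. cf x k l * ((if (i, j) \<in> Sg then cf y (i - k) (j - l) else 0) - cf (rho y) (i - k) (j - l)))"
    by (simp add: rho_def cf_mult right_diff_distrib sum_subtractf)
  also have "int p dvd \<dots>"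
  proof (intro dvd_sum)
    fix k l assume kl: "k \<in> {..i}" "l \<in> {..j}"
    show "int p dvd cf x k l * ((if (i, j) \<in> Sg then cf y (i - k) (j - l) else 0) - cf (rho y) (i - k) (j - l))"
    proof (cases "int p dvd cf x k l")
      case False
      with assms have "(k, l) \<in> Sg" by (auto simp: supp_def)
      with kl show ?thesis using Sg_add_iff[of k l "i - k" "j - l"] by (simp add: rho_def)
    qed simp
  qed
  finally show "int p dvd cf (rho (x * y)) i j - cf (x * rho y) i j" .
qed

text \<open>The inverse is formed among all power series and then projected by \<open>rho\<close>,
  whose linearity keeps it an inverse of \<open>x\<close>. If \<open>s\<close> is a denominator of
  \<open>x\<close>, then \<open>s * x\<close> is one of the inverse.\<close>

lemma ex_inverse_A:
  assumes x: "InA x" and x0: "(0, 0) \<in> supp x"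
  shows "\<exists>y. InA y \<and> red (x * y) = 1"
proof -
  obtain m where m: "[cf x 0 0 * m = 1] (mod int p)"
    using ex_inverse_mod_p[of "cf x 0 0"] x0 by (auto simp: supp_def)
  \<comment> \<open>The correction is a multiple of \<open>p\<close>, so \<open>z\<close> and
    \<open>m\<close> times \<open>x\<close> have the same reduction, while the constant coefficient
    of \<open>z\<close> is exactly 1.\<close>
  define z where "z = of_int m * x - of_int (m * cf x 0 0 - 1) * 1"
  have "cf z 0 0 = 1" unfolding z_def cf_diff cf_of_int_mult by (simp add: cf_one)
  then obtain y0 where y0: "z * y0 = 1" using ex_inverse by blast
  have "int p dvd m * cf x 0 0 - 1" using m by (simp add: cong_iff_dvd_diff mult.commute)
  then have "red z = red (of_int m * x)"
    unfolding z_def by (intro red_eqI) (simp add: dvd_mult2 del: of_int_diff of_int_mult mult_1_right)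
  then have "red (z * y0) = red (of_int m * x * y0)" by (rule red_mult_cong) simp
  then have "red (x * (of_int m * y0)) = 1" using y0 by (simp add: mult_ac)
  then have "red (x * (of_int m * y0)) = red 1" by simp
  from rho_cong[OF this] have "red (x * rho (of_int m * y0)) = red (rho 1)"
    using rho_mult[OF InA_supp[OF x]] by simp
  also have "\<dots> = 1" using rho_id[of 1] by simp
  finally have y: "red (x * rho (of_int m * y0)) = 1" .
  define y where "y = rho (of_int m * y0)"
  obtain s where s: "InR s" "(0, 0) \<in> supp s" "InR (s * x)" using x by (rule InAE)
  have "red (s * (x * y)) = red (s * 1)" using y by (intro red_mult_cong) (auto simp: y_def)
  then have "InR (s * x * y)" using s(1) InR_cong[of "s * (x * y)" s] by (simp add: mult.assoc)
  moreover have "supp y \<subseteq> Sg" by (simp add: y_def supp_rho)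
  moreover have "(0, 0) \<in> supp (s * x)" using s(2) x0 by (simp add: supp_mult_00)
  ultimately have "InA y" unfolding InA_def using s(3) by blast
  with y show ?thesis unfolding y_def by blast
qed

text \<open>Writing an element with denominator \<open>s\<close> as a polynomial times a \<open>q\<close>-th power
  separates what Frobenius-linear maps see from what they do not.\<close>

lemma InA_decompose:
  assumes "InA x" "q > 0"
  obtains f r where "InR f" "InA r" "(0, 0) \<in> supp r" "red x = red (r ^ q * f)"
    "\<And>U. supp x \<subseteq> U \<Longrightarrow> (\<And>a b c d. (a, b) \<in> U \<Longrightarrow> (c, d) \<in> Sg \<Longrightarrow> (a + c, b + d) \<in> U) \<Longrightarrow> supp f \<subseteq> U"
proof -
  obtain s where s: "InR s" "(0, 0) \<in> supp s" "InR (s * x)" using assms(1) by (rule InAE)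
  obtain r where r: "InA r" "red (s * r) = 1"
    using ex_inverse_A[OF InR_imp_InA[OF s(1)] s(2)] by blast
  \<comment> \<open>This is \<open>s ^ q * x\<close>, written with a single factor \<open>s\<close>
    next to \<open>x\<close> so that it is visibly a product of polynomials.\<close>
  define f where "f = s ^ (q - 1) * (s * x)"
  have f: "f = s ^ q * x" unfolding f_def using assms(2) by (metis mult.assoc power_minus_mult)
  have "red (r ^ q * f) = red ((s * r) ^ q * x)" by (simp add: f power_mult_distrib mult_ac)
  also have "\<dots> = red (1 ^ q * x)" using r(2) by (intro red_mult_cong red_power_cong) auto
  finally have eq: "red x = red (r ^ q * f)" by simp
  have "(0, 0) \<in> supp (s * r)" using supp_red[of "s * r"] r(2) by (metis insertI1 supp_1)
  then have r0: "(0, 0) \<in> supp r" by (simp add: supp_mult_00)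
  have "supp f \<subseteq> U" if "supp x \<subseteq> U"
    "\<And>a b c d. (a, b) \<in> U \<Longrightarrow> (c, d) \<in> Sg \<Longrightarrow> (a + c, b + d) \<in> U" for U
  proof
    fix t assume "t \<in> supp f"
    then obtain a b c d where "(a, b) \<in> supp x" "(c, d) \<in> supp (s ^ q)" "t = (a + c, b + d)"
      unfolding f by (subst (asm) mult.commute) (erule supp_multE)
    moreover have "supp (s ^ q) \<subseteq> Sg" using InR_power[OF s(1)] by (simp add: InR_def)
    ultimately show "t \<in> U" using that by blast
  qed
  moreover have "InR f" unfolding f_def using s by (meson InR_mult InR_power)
  ultimately show ?thesis using that r r0 eq by blast
qed

end

section \<open>Ideals and submodules from closure conditions\<close>

lemma (in cring) ideal_if_closed:
  assumes "I \<subseteq> carrier R" "\<zero> \<in> I"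
    and add: "\<And>x y. x \<in> I \<Longrightarrow> y \<in> I \<Longrightarrow> x \<oplus> y \<in> I"
    and mult: "\<And>a x. a \<in> carrier R \<Longrightarrow> x \<in> I \<Longrightarrow> a \<otimes> x \<in> I"
  shows "ideal I R"
proof (rule idealI[OF ring_axioms])
  show "subgroup I (add_monoid R)"
  proof (rule add.subgroupI)
    fix x assume x: "x \<in> I"
    then have "\<ominus> x = (\<ominus> \<one>) \<otimes> x" using assms(1) by (auto simp: l_minus)
    then show "\<ominus> x \<in> I" using mult[of "\<ominus> \<one>" x] x by auto
  qed (use assms in auto)
next
  fix a x assume "a \<in> I" "x \<in> carrier R"
  then show "x \<otimes> a \<in> I" "a \<otimes> x \<in> I" using mult[of x a] m_comm[of a x] assms(1) by auto
qed

text \<open>The \<^const>\<open>add_monoid\<close>s of records of different type are not comparable as terms.\<close>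

lemma submodule_iff:
  assumes "carrier M = carrier S" "add M = add S" "\<zero>\<^bsub>M\<^esub> = \<zero>\<^bsub>S\<^esub>"
  shows "submodule N R M \<longleftrightarrow>
    subgroup N (add_monoid S) \<and> (\<forall>a\<in>carrier R. \<forall>x\<in>N. a \<odot>\<^bsub>M\<^esub> x \<in> N)"
  unfolding submodule_def submodule_axioms_def subgroup_def m_inv_def using assms by auto

lemma frobenius_pushforward_simps [simp]:
  "carrier (frobenius_pushforward p e R) = carrier R"
  "add (frobenius_pushforward p e R) = add R"
  "zero (frobenius_pushforward p e R) = zero R"
  "smult (frobenius_pushforward p e R) r x = (r [^]\<^bsub>R\<^esub> (p ^ e)) \<otimes>\<^bsub>R\<^esub> x"
  by (simp_all add: frobenius_pushforward_def)

lemma regular_module_simps [simp]: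
  "carrier (regular_module R) = carrier R"
  "add (regular_module R) = add R"
  "zero (regular_module R) = zero R"
  "smult (regular_module R) r x = r \<otimes>\<^bsub>R\<^esub> x" by (simp_all add: regular_module_def)

context toric
begin

section \<open>Monomial ideals and the maximal ideal\<close>

definition Sg_ideal :: "(nat \<times> nat) set \<Rightarrow> bool" where
  "Sg_ideal U \<longleftrightarrow> U \<subseteq> Sg \<and> (\<forall>a b c d. (a, b) \<in> U \<longrightarrow> (c, d) \<in> Sg \<longrightarrow> (a + c, b + d) \<in> U)"

text \<open>The monomial ideals of \<open>A\<close>. The maximal ideal, its Frobenius powers and the
  set of elements that no Frobenius-linear functional maps to a unit are all of this form.\<close>

definition J :: "(nat \<times> nat) set \<Rightarrow> bps set" where
  "J U = {x \<in> carrier A. supp x \<subseteq> U}"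

lemma Sg_idealD: "Sg_ideal U \<Longrightarrow> (a, b) \<in> U \<Longrightarrow> (c, d) \<in> Sg \<Longrightarrow> (a + c, b + d) \<in> U"
  by (simp add: Sg_ideal_def)

lemma supp_mult_Sg_ideal:
  assumes "Sg_ideal U" "supp x \<subseteq> Sg" "supp y \<subseteq> U"
  shows "supp (x * y) \<subseteq> U"
proof
  fix t assume "t \<in> supp (x * y)"
  then obtain a b c d where "(a, b) \<in> supp x" "(c, d) \<in> supp y" "t = (a + c, b + d)"
    by (elim supp_multE)
  then show "t \<in> U" using Sg_idealD[OF assms(1), of c d a b] assms(2,3) by (auto simp: add.commute)
qed

lemma J_ideal: "Sg_ideal U \<Longrightarrow> ideal (J U) A"
proof (rule A.ideal_if_closed)
  fix x y assume "x \<in> J U" "y \<in> J U"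
  then have "InA (x + y)" "supp (x + y) \<subseteq> U"
    using supp_add[of x y] by (auto simp: J_def carrier_A InA_add)
  then show "x \<oplus>\<^bsub>A\<^esub> y \<in> J U" by (simp add: J_def carrier_A)
next
  fix a x assume U: "Sg_ideal U" and *: "a \<in> carrier A" "x \<in> J U"
  then have "InA (a * x)" by (simp add: J_def carrier_A InA_mult)
  moreover have "supp (a * x) \<subseteq> U"
    using * InA_supp by (intro supp_mult_Sg_ideal[OF U]) (auto simp: J_def carrier_A)
  ultimately show "a \<otimes>\<^bsub>A\<^esub> x \<in> J U" by (simp add: J_def carrier_A)
qed (auto simp: J_def carrier_A)

lemma Sg_ideal_nonzero: "Sg_ideal (Sg - {(0, 0)})" by (auto simp: Sg_ideal_def intro: Sg_add)

lemma J_Sg: "J Sg = carrier A" using InA_supp by (auto simp: J_def carrier_A)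

lemma Sg_ideal_Sg: "Sg_ideal Sg" by (auto simp: Sg_ideal_def intro: Sg_add)

lemma J_decompose:
  assumes x: "x \<in> J U" and U: "Sg_ideal U" and q: "q > 0"
  obtains f r where "InR f" "r \<in> carrier A" "x = red (r ^ q * f)" "supp f \<subseteq> U"
proof -
  have xA: "InA x" "red x = x" "supp x \<subseteq> U" using x by (auto simp: J_def carrier_A)
  obtain f r where f: "InR f" "InA r" "red x = red (r ^ q * f)" "supp f \<subseteq> U"
    using InA_decompose[OF xA(1) q] Sg_idealD[OF U] xA(3) by metis
  show ?thesis using that[of f "red r"] f xA red_mult_cong[OF red_simps(7)[of r q] refl[of "red f"]]
    by (simp add: carrier_A)
qed

lemmas A_decompose = J_decompose[of _ Sg, unfolded J_Sg, OF _ Sg_ideal_Sg]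

definition mm :: "bps set" where "mm = J (Sg - {(0, 0)})"

lemma mm_iff: "x \<in> mm \<longleftrightarrow> x \<in> carrier A \<and> (0, 0) \<notin> supp x"
  using InA_supp by (auto simp: mm_def J_def carrier_A)

lemma mm_ideal: "ideal mm A" by (simp add: mm_def J_ideal Sg_ideal_nonzero)

lemma A_unit:
  assumes "x \<in> carrier A" "x \<notin> mm"
  obtains y where "y \<in> carrier A" "x \<otimes>\<^bsub>A\<^esub> y = \<one>\<^bsub>A\<^esub>"
proof -
  have "(0, 0) \<in> supp x" using assms by (simp add: mm_iff)
  then obtain y where "InA y" "red (x * y) = 1"
    using ex_inverse_A[of x] assms(1) by (auto simp: carrier_A)
  then show ?thesis using that[of "red y"] by (simp add: carrier_A)
qed

lemma proper_ideal_subset_mm: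
  assumes "ideal I A" "I \<noteq> carrier A"
  shows "I \<subseteq> mm"
proof
  interpret I: ideal I A by fact
  fix x assume x: "x \<in> I"
  show "x \<in> mm"
  proof (rule ccontr)
    assume "x \<notin> mm"
    then obtain y where "y \<in> carrier A" "x \<otimes>\<^bsub>A\<^esub> y = \<one>\<^bsub>A\<^esub>" using A_unit x I.a_subset by blast
    then have "\<one>\<^bsub>A\<^esub> \<in> I" using I.I_r_closed[OF x, of y] by simp
    then show False using assms(2) I.one_imp_carrier by blast
  qed
qed

lemma one_notin_mm: "1 \<notin> mm" by (simp add: mm_iff)

lemma one_in_A: "1 \<in> carrier A" using A.one_closed by simp

lemma mm_maximal: "maximalideal mm A"
proof (rule maximalidealI[OF mm_ideal])
  show "carrier A \<noteq> mm" using one_notin_mm one_in_A by blast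
  fix I assume "ideal I A" "mm \<subseteq> I" "I \<subseteq> carrier A"
  then show "I = mm \<or> I = carrier A" using proper_ideal_subset_mm by blast
qed

lemma maximal_eq_mm: "maximalideal M A \<Longrightarrow> M = mm"
proof -
  assume M: "maximalideal M A"
  interpret M: maximalideal M A by fact
  have "M \<subseteq> mm" using proper_ideal_subset_mm M.ideal_axioms M.I_notcarr by blast
  then have "mm = M \<or> mm = carrier A"
    using M.I_maximal[OF mm_ideal] mm_ideal by (auto simp: mm_def J_def)
  then show "M = mm" using one_notin_mm one_in_A by blast
qed

lemma max_ideal_A: "max_ideal A = mm"
  unfolding max_ideal_def by (rule the_equality) (fact mm_maximal, fact maximal_eq_mm)

lemma polynomial_in_ideal:
  assumes "ideal I A" "finite (supp f)" "supp f \<subseteq> U" "\<And>t. t \<in> U \<Longrightarrow> bmon t \<in> I"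
  shows "red f \<in> I"
proof -
  interpret I: ideal I A by fact
  show ?thesis
  proof (rule polynomial_induct[OF assms(2,3), where P = "\<lambda>f. red f \<in> I"])
    fix x y assume "red x \<in> I" "red y \<in> I"
    then show "red (x + y) \<in> I" using I.a_closed[of "red x" "red y"] by simp
  qed (use assms(4) I.zero_closed in auto)
qed

subsection \<open>Frobenius powers of the maximal ideal\<close>

definition Uq :: "nat \<Rightarrow> (nat \<times> nat) set" where
  "Uq q = {(i, j) \<in> Sg. \<exists>a b. (a, b) \<in> Sg \<and> (a, b) \<noteq> (0, 0) \<and> q * a \<le> i \<and> q * b \<le> j}"

lemma Sg_ideal_Uq: "Sg_ideal (Uq q)"
  unfolding Sg_ideal_def Uq_def by (auto intro: Sg_add trans_le_add1)

text \<open>Raising to the power \<open>p ^ e\<close> multiplies all exponents of the support by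
  \<open>p ^ e\<close>, which gives one inclusion. Conversely a monomial with exponent in
  \<open>Uq (p ^ e)\<close> is such a power of a nonconstant monomial times a cofactor, and the
  cofactor has its exponent in \<open>Sg\<close> by cancellation.\<close>

lemma frobenius_power_mm: "frobenius_power p e A mm = J (Uq (p ^ e))"
proof
  let ?q = "p ^ e"
  let ?X = "(\<lambda>x. x [^]\<^bsub>A\<^esub> ?q) ` mm"
  have sub: "?X \<subseteq> J (Uq ?q)"
  proof
    fix y assume "y \<in> ?X"
    then obtain x where x: "x \<in> carrier A" "(0, 0) \<notin> supp x" "y = red (x ^ ?q)"
      by (auto simp: mm_iff)
    have "(?q * a, ?q * b) \<in> Uq ?q" if "(a, b) \<in> supp x" for a b
    proof -
      have "(a, b) \<in> Sg" using that InA_supp[OF carrier_AD(2)[OF x(1)]] by blast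
      moreover have "(a, b) \<noteq> (0, 0)" using that x(2) by metis
      ultimately
      show ?thesis unfolding Uq_def using Sg_mult by blast
    qed
    then have "supp (x ^ ?q) \<subseteq> Uq ?q" unfolding supp_power_pe by auto
    then show "y \<in> J (Uq ?q)" using x carrier_AD(2)[OF x(1)] by (simp add: J_def carrier_A InA_power)
  qed
  then show "frobenius_power p e A mm \<subseteq> J (Uq ?q)"
    unfolding frobenius_power_def by (rule A.genideal_minimal[OF J_ideal[OF Sg_ideal_Uq]])
  let ?I = "frobenius_power p e A mm"
  have "?X \<subseteq> carrier A" using sub by (auto simp: J_def)
  then have id: "ideal ?I A" and self: "?X \<subseteq> ?I"
    unfolding frobenius_power_def by (auto intro: A.genideal_ideal A.genideal_self[THEN subsetD])
  interpret I: ideal ?I A by (rule id)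
  have mon: "bmon t \<in> ?I" if tU: "t \<in> Uq ?q" for t
  proof -
    obtain i j where t: "t = (i, j)" by fastforce
    obtain a b where ab: "(a, b) \<in> Sg" "(a, b) \<noteq> (0, 0)" "?q * a \<le> i" "?q * b \<le> j" "(i, j) \<in> Sg"
      using tU unfolding t Uq_def by blast
    have "bmon (a, b) \<in> mm" using ab by (simp add: mm_iff bmon_in_A)
    then have 1: "red (bmon (a, b) ^ ?q) \<in> ?I" using self by auto
    have "(?q * a + (i - ?q * a), ?q * b + (j - ?q * b)) \<in> Sg" using ab by simp
    then have "(i - ?q * a, j - ?q * b) \<in> Sg" using Sg_add_iff[OF Sg_mult[OF ab(1)]] by blast
    from I.I_l_closed[OF 1 bmon_in_A[OF this]] show ?thesis
      using ab by (simp add: bmon_power bmon_mult t)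
  qed
  show "J (Uq ?q) \<subseteq> ?I"
  proof
    fix x assume x: "x \<in> J (Uq ?q)"
    \<comment> \<open>With exponent 1 the decomposition merely clears the denominator, which leaves
      a polynomial with exponents in \<open>Uq\<close>.\<close>
    obtain f r where f: "InR f" "r \<in> carrier A" "x = red (r ^ 1 * f)" "supp f \<subseteq> Uq ?q"
      using J_decompose[OF x Sg_ideal_Uq zero_less_one] .
    have "red f \<in> ?I" using f polynomial_in_ideal[OF id _ f(4) mon] by (auto simp: InR_def)
    then have "r \<otimes>\<^bsub>A\<^esub> red f \<in> ?I" using f by (intro I.I_l_closed)
    then show "x \<in> ?I" using f by simp
  qed
qed

subsection \<open>Frobenius-linear functionals\<close>

text \<open>For \<open>t\<close> in \<open>Sg\<close> with entries below \<open>p ^ e\<close> these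
  are the coordinate functions on the free part of the pushforward: coordinates over the power
  series ring, projected back to \<open>A\<close>.\<close>

definition psi :: "nat \<Rightarrow> nat \<times> nat \<Rightarrow> bps \<Rightarrow> bps" where
  "psi e t x = red (rho (phi (p ^ e) t x))"

lemma psi_cong: "red x = red y \<Longrightarrow> psi e t x = psi e t y"
  unfolding psi_def by (rule rho_cong, rule phi_cong)

lemma psi_red [simp]: "psi e t (red x) = psi e t x" by (rule psi_cong) simp

lemma psi_add: "psi e t (x + y) = red (psi e t x + psi e t y)"
  by (simp add: psi_def phi_add rho_add)

lemma psi_mult:
  assumes "fst t < p ^ e" "snd t < p ^ e" "supp x \<subseteq> Sg"
  shows "psi e t (x ^ (p ^ e) * y) = red (x * psi e t y)"
proof -
  have "psi e t (x ^ (p ^ e) * y) = red (rho (x * phi (p ^ e) t y))"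
    unfolding psi_def by (rule rho_cong[OF phi_power_mult[OF assms(1,2)]])
  also have "\<dots> = red (x * psi e t y)" using rho_mult[OF assms(3)] by (simp add: psi_def)
  finally show ?thesis .
qed

lemma psi_bmon:
  assumes "fst t < p ^ e" "snd t < p ^ e" "fst t' < p ^ e" "snd t' < p ^ e"
  shows "psi e t (bmon t') = (if t = t' then 1 else 0)"
  using rho_id[of 0] rho_id[of 1] by (simp add: psi_def phi_bmon assms)

lemma supp_psi_00: "(0, 0) \<in> supp (psi e t x) \<longleftrightarrow> t \<in> supp x"
  by (auto simp: psi_def supp_rho) (auto simp: supp_def phi_def)

text \<open>A denominator enters only through \<open>r ^ (p ^ e)\<close>, which leaves
  \<open>psi\<close> as the factor \<open>r\<close> in \<open>A\<close>; the other factor is a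
  polynomial and is mapped to a polynomial.\<close>

lemma psi_in_A:
  assumes "x \<in> carrier A" "fst t < p ^ e" "snd t < p ^ e"
  shows "psi e t x \<in> carrier A"
proof -
  obtain f r where f: "InR f" "r \<in> carrier A" "x = red (r ^ (p ^ e) * f)"
    using A_decompose[OF assms(1), of "p ^ e"] p_gt_0 by (metis zero_less_power)
  have "InR (psi e t f)" using f(1) p_gt_0 by (simp add: InR_def psi_def supp_rho finite_supp_phi)
  then have "InA (r * psi e t f)" using carrier_AD(2)[OF f(2)] by (metis InA_mult InR_imp_InA)
  moreover have "psi e t x = red (r * psi e t f)"
    unfolding f(3) psi_red by (rule psi_mult[OF assms(2,3) InA_supp[OF carrier_AD(2)[OF f(2)]]])
  ultimately show ?thesis by (simp add: carrier_A)
qed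

text \<open>The homomorphisms from the pushforward to \<open>A\<close>, unfolded to the arithmetic
  of reduced series.\<close>

definition FL :: "nat \<Rightarrow> (bps \<Rightarrow> bps) \<Rightarrow> bool" where
  "FL e f \<longleftrightarrow> f \<in> carrier A \<rightarrow> carrier A \<and>
     (\<forall>x\<in>carrier A. \<forall>y\<in>carrier A. f (red (x + y)) = red (f x + f y)) \<and>
     (\<forall>a\<in>carrier A. \<forall>x\<in>carrier A. f (red (a ^ (p ^ e) * x)) = red (a * f x))"

lemma module_hom_iff_FL:
  "f \<in> module_hom A (frobenius_pushforward p e A) (regular_module A) \<longleftrightarrow> FL e f"
  by (simp add: module_hom_def FL_def)

lemma FL_psi: "fst t < p ^ e \<Longrightarrow> snd t < p ^ e \<Longrightarrow> FL e (psi e t)"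
  unfolding FL_def using psi_in_A[of _ t e] psi_mult[of t e] InA_supp[OF carrier_AD(2)]
  by (simp add: psi_add)

text \<open>An exponent of the support of \<open>c\<close> with entries below \<open>p ^ e\<close>
  is turned by its functional \<open>psi\<close> into the constant term, so the value at
  \<open>c\<close> is a unit and can be rescaled to 1. All large \<open>e\<close> are covered so
  that the two factors of a product can share one.\<close>

lemma strong_splitting:
  assumes c: "c \<in> carrier A" "c \<noteq> 0"
  obtains e0 where "\<And>e. e \<ge> e0 \<Longrightarrow> \<exists>f. FL e f \<and> f c = 1"
proof -
  have "supp c \<noteq> {}" using c supp_empty_iff[of c] by (auto simp: carrier_A)
  then obtain i j where ij: "(i, j) \<in> supp c" by auto
  have "\<exists>f. FL e f \<and> f c = 1" if e: "e \<ge> i + j" for e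
  proof -
    have "e < p ^ e" using p_gt_1 by (simp add: power_gt_expt)
    then have t: "fst (i, j) < p ^ e" "snd (i, j) < p ^ e" using e by auto
    have "psi e (i, j) c \<in> carrier A" "psi e (i, j) c \<notin> mm"
      using psi_in_A[OF c(1) t] ij by (auto simp: mm_iff supp_psi_00)
    then obtain u where u: "u \<in> carrier A" "red (psi e (i, j) c * u) = 1"
      using A_unit by (metis A_simps(1) A_simps(3))
    have F: "FL e (psi e (i, j))" by (rule FL_psi[OF t])
    have "FL e (\<lambda>x. red (psi e (i, j) x * u))" using F u(1) unfolding FL_def
      by (auto simp: Pi_iff carrier_A InA_mult distrib_right mult.assoc)
    with u(2) show ?thesis by blast
  qed
  then show ?thesis using that by blast
qed

lemma F_finite_A: "F_finite p A"
proof -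
  let ?M = "frobenius_pushforward p 1 A"
  \<comment> \<open>A shift of an exponent by multiples of \<open>p * n\<close> multiplies the
    monomial by the \<open>p\<close>-th power of one whose exponents are divisible by
    \<open>n\<close>, and that one lies in \<open>A\<close>; so remainders modulo
    \<open>p * n\<close> suffice.\<close>
  let ?G = "bmon ` (Sg \<inter> {..<p * n} \<times> {..<p * n})"
  have G: "?G \<subseteq> carrier A" using bmon_in_A by auto
  have "submodule (carrier A) A ?M"
    using A.add.subgroup_self by (subst submodule_iff[of _ A]) (auto simp: carrier_A InA_mult InA_power)
  moreover have "carrier A \<subseteq> N" if N: "submodule N A ?M" and GN: "?G \<subseteq> N" for N
  proof
    interpret N: submodule N A ?M by (rule N)
    have add: "red (x + y) \<in> N" if "x \<in> N" "y \<in> N" for x y using N.m_closed[OF that] by simp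
    have smult: "red (r ^ p * x) \<in> N" if "r \<in> carrier A" "x \<in> N" for r x
      using N.smult_closed[OF that] by simp
    fix x assume x: "x \<in> carrier A"
    obtain f r where f: "InR f" "r \<in> carrier A" "x = red (r ^ p * f)"
      using A_decompose[OF x p_gt_0] .
    have "red f \<in> N"
    proof (rule polynomial_induct[where U = Sg and P = "\<lambda>f. red f \<in> N"])
      show "finite (supp f)" "supp f \<subseteq> Sg" using f(1) by (auto simp: InR_def)
      show "red 0 \<in> N" using N.one_closed by simp
      fix t assume t: "t \<in> Sg"
      obtain i j where ij: "t = (i, j)" by fastforce
      let ?i = "i mod (p * n)" and ?j = "j mod (p * n)"
      let ?u = "(n * (i div (p * n)), n * (j div (p * n)))"
      have eq: "t = (p * (n * (i div (p * n))) + ?i, p * (n * (j div (p * n))) + ?j)"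
        unfolding ij by (simp flip: mult.assoc)
      then have "(?i, ?j) \<in> Sg" using t Sg_add_iff[OF Sg_mult[OF Sg_n]] by metis
      then have "bmon (?i, ?j) \<in> N" using GN p_gt_0 n by auto
      from smult[OF bmon_in_A[OF Sg_n] this, of "i div (p * n)" "j div (p * n)"]
      have "bmon (p * (n * (i div (p * n))) + ?i, p * (n * (j div (p * n))) + ?j) \<in> N"
        by (simp only: bmon_power bmon_mult red_bmon)
      then show "red (bmon t) \<in> N" using eq by simp
    qed (use add in fastforce)+
    then show "x \<in> N" using smult[of r "red f"] f by simp
  qed
  ultimately have "\<Inter>{N. submodule N A ?M \<and> ?G \<subseteq> N} = carrier A" using G by auto
  moreover have "finite ?G" by simp
  ultimately show ?thesis
    unfolding F_finite_def fin_gen_module_def frobenius_pushforward_simps using G by blast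
qed

text \<open>Each of \<open>(-1, w')\<close> and \<open>(w, -1)\<close> is a fraction \<open>z\<close> of monomials; if \<open>z\<^sup>q\<close> times a
  monomial \<open>x\<close> is still a monomial, then \<open>z\<close> times \<open>f x\<close> has no pole for \<open>f\<close> Frobenius-linear.\<close>

lemma FL_bmon_in_mm:
  assumes f: "FL e f" and t: "(i, j) \<in> Sg" "i \<ge> p ^ e \<or> j \<ge> p ^ e"
  shows "f (bmon (i, j)) \<in> mm"
proof -
  let ?q = "p ^ e"
  have fA: "f x \<in> carrier A" if "x \<in> carrier A" for x using f that by (auto simp: FL_def)
  \<comment> \<open>Here \<open>h - g\<close> is the exponent of the fraction \<open>z\<close>.
    Applying \<open>f\<close> to \<open>eq\<close> takes out \<open>g\<close> and \<open>h\<close>;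
    at the exponent \<open>h\<close> one side has the constant term in question and the other side
    vanishes, as \<open>g\<close> is not below \<open>h\<close>.\<close>
  have key: "int p dvd cf (f (bmon (i, j))) 0 0"
    if g: "g \<in> Sg" "h \<in> Sg" "y \<in> Sg"
      and eq: "bmon g ^ ?q * bmon y = bmon h ^ ?q * bmon (i, j)" and nle: "\<not> (fst g \<le> fst h \<and> snd g \<le> snd h)"
    for g h y
  proof -
    have "red (bmon g * f (bmon y)) = f (red (bmon g ^ ?q * bmon y))"
      using f g bmon_in_A unfolding FL_def by simp
    also have "\<dots> = f (red (bmon h ^ ?q * bmon (i, j)))" by (simp add: eq)
    also have "\<dots> = red (bmon h * f (bmon (i, j)))" using f g t bmon_in_A unfolding FL_def by simp
    finally have "int p dvd cf (bmon g * f (bmon y)) (fst h) (snd h) - cf (bmon h * f (bmon (i, j))) (fst h) (snd h)"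
      unfolding red_eq_iff_cf by blast
    moreover have "cf (bmon g * f (bmon y)) (fst h) (snd h) = 0"
      using nle cf_bmon_mult[of "fst g" "snd g"] by auto
    moreover have "cf (bmon h * f (bmon (i, j))) (fst h) (snd h) = cf (f (bmon (i, j))) 0 0"
      using cf_bmon_mult[of "fst h" "snd h"] by simp
    ultimately show ?thesis by simp
  qed
  have "int p dvd cf (f (bmon (i, j))) 0 0"
  proof (cases "i \<ge> ?q")
    case True
    have *: "?q * n + (i - ?q) = ?q * (n - 1) + i" using True n by (cases n) auto
    have "(?q * (n - 1) + i, ?q * w' + j) \<in> Sg" by (rule Sg_add[OF Sg_mult[OF Sg_w'] t(1)])
    then have y: "(i - ?q, ?q * w' + j) \<in> Sg"
      using Sg_add_iff[OF Sg_mult[OF Sg_n[of 1 0], of ?q], of "i - ?q" "?q * w' + j"] * by simp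
    show ?thesis
      by (rule key[OF Sg_n[of 1 0] Sg_w' y]) (use n * in \<open>auto simp: bmon_power bmon_mult\<close>)
  next
    case False
    then have j: "j \<ge> ?q" using t by simp
    have *: "?q * n + (j - ?q) = ?q * (n - 1) + j" using j n by (cases n) auto
    have "(?q * w + i, ?q * (n - 1) + j) \<in> Sg" by (rule Sg_add[OF Sg_mult[OF Sg_w] t(1)])
    then have y: "(?q * w + i, j - ?q) \<in> Sg"
      using Sg_add_iff[OF Sg_mult[OF Sg_n[of 0 1], of ?q], of "?q * w + i" "j - ?q"] * by simp
    show ?thesis
      by (rule key[OF Sg_n[of 0 1] Sg_w y]) (use n * in \<open>auto simp: bmon_power bmon_mult\<close>)
  qed
  then show ?thesis using fA[OF bmon_in_A[OF t(1)]] by (simp add: mm_iff supp_def)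
qed

definition Vq :: "nat \<Rightarrow> (nat \<times> nat) set" where
  "Vq q = {(i, j) \<in> Sg. i \<ge> q \<or> j \<ge> q}"

lemma Sg_ideal_Vq: "Sg_ideal (Vq q)" unfolding Sg_ideal_def Vq_def by (auto intro: Sg_add)

text \<open>Additivity reduces polynomials to monomials, and denominators come out linearly. Hence
  modulo the maximal ideal a functional depends only on the coefficients at exponents below
  \<open>p ^ e\<close>, which is what bounds the free rank.\<close>

lemma FL_in_mm:
  assumes f: "FL e f" and x: "x \<in> J (Vq (p ^ e))"
  shows "f x \<in> mm"
proof -
  interpret mm: ideal mm A by (rule mm_ideal)
  obtain h r where h: "InR h" "r \<in> carrier A" "x = red (r ^ (p ^ e) * h)" "supp h \<subseteq> Vq (p ^ e)"
    using J_decompose[OF x Sg_ideal_Vq, of "p ^ e"] p_gt_0 by auto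
  have "InA h \<and> f (red h) \<in> mm"
  proof (rule polynomial_induct[OF _ h(4), where P = "\<lambda>h. InA h \<and> f (red h) \<in> mm"])
    show "finite (supp h)" using h(1) by (simp add: InR_def)
    have "f (red (0 + 0)) = red (f 0 + f 0)" using f A.zero_closed unfolding FL_def A_simps by blast
    then have "red (f 0 + f 0) = f 0" by simp
    moreover have "f 0 \<in> carrier A" using f A.zero_closed unfolding FL_def by auto
    ultimately have "f 0 = 0" using A.add.r_cancel_one[of "f 0" "f 0"] by simp
    then show "InA 0 \<and> f (red 0) \<in> mm" using mm.zero_closed by simp
  next
    fix x y assume *: "InA x \<and> f (red x) \<in> mm" "InA y \<and> f (red y) \<in> mm"
    then have "f (red (red x + red y)) = red (f (red x) + f (red y))"
      using f by (auto simp: FL_def carrier_A simp del: red_simps)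
    then show "InA (x + y) \<and> f (red (x + y)) \<in> mm"
      using * mm.a_closed[of "f (red x)" "f (red y)"] by (auto intro: InA_add)
  next
    fix t assume "t \<in> Vq (p ^ e)"
    then show "InA (bmon t) \<and> f (red (bmon t)) \<in> mm"
      using FL_bmon_in_mm[OF f, of "fst t" "snd t"] by (auto simp: Vq_def intro: InR_imp_InA InR_bmon)
  next
    fix x y assume eq: "red x = red y" and *: "InA x \<and> f (red x) \<in> mm"
    from * show "InA y \<and> f (red y) \<in> mm" unfolding eq InA_cong[OF eq] .
  qed
  then have "red (r * f (red h)) \<in> mm" using mm.I_l_closed[of "f (red h)" r] h(2) by simp
  moreover have "f (red (r ^ (p ^ e) * red h)) = red (r * f (red h))"
  proof -
    have "\<forall>a\<in>carrier A. \<forall>x\<in>carrier A. f (red (a ^ (p ^ e) * x)) = red (a * f x)"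
      using f by (simp add: FL_def)
    from this[THEN bspec, OF h(2), THEN bspec, OF carrier_AI[OF InR_imp_InA[OF h(1)]]]
    show ?thesis .
  qed
  ultimately show ?thesis unfolding h(3) by (simp only: red_simps)
qed

end

subsection \<open>The Noetherian property\<close>

text \<open>Let column \<open>i0\<close> attain the least height \<open>j0\<close> of all. Its
  lowest point is below every point of a later column, so the lowest points of the finitely many
  columns up to \<open>i0\<close> suffice.\<close>

lemma dickson_nat_pairs:
  fixes X :: "(nat \<times> nat) set"
  shows "\<exists>F. finite F \<and> F \<subseteq> X \<and> (\<forall>(i, j)\<in>X. \<exists>(a, b)\<in>F. a \<le> i \<and> b \<le> j)"
proof (cases "X = {}")
  case False
  define col where "col i = (LEAST j. (i, j) \<in> X)" for i
  have col: "(i, col i) \<in> X" "col i \<le> j" if "(i, j) \<in> X" for i j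
    unfolding col_def using that by (auto intro: LeastI Least_le)
  from False have ex: "\<exists>j i. (i, j) \<in> X" by auto
  define j0 where "j0 = (LEAST j. \<exists>i. (i, j) \<in> X)"
  obtain i0 where i0: "(i0, j0) \<in> X" using LeastI_ex[OF ex] unfolding j0_def by auto
  have j0: "j0 \<le> j" if "(i, j) \<in> X" for i j unfolding j0_def using that by (auto intro: Least_le)
  let ?F = "(\<lambda>i. (i, col i)) ` {i. i \<le> i0 \<and> (\<exists>j. (i, j) \<in> X)}"
  have "\<exists>(a, b)\<in>?F. a \<le> i \<and> b \<le> j" if ij: "(i, j) \<in> X" for i j
  proof (cases "i \<le> i0")
    case True
    then show ?thesis using ij col(2)[OF ij] by auto
  next
    case False
    then have "i0 \<le> i" "col i0 \<le> j" using col(2)[OF i0] j0[OF ij] by auto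
    then show ?thesis using i0 by auto
  qed
  moreover have "?F \<subseteq> X" using col by auto
  ultimately show ?thesis by (intro exI[of _ ?F]) auto
qed auto

lemma chain_length_leI:
  assumes "\<And>C k. (\<forall>i\<le>k. C i \<in> \<C>) \<Longrightarrow> (\<forall>i<k. C i \<subset> C (Suc i)) \<Longrightarrow> k \<le> N"
  shows "chain_length \<C> \<le> enat N" unfolding chain_length_def using assms by (intro Sup_least) auto

lemma chain_length_geI:
  assumes "\<And>i. i \<le> N \<Longrightarrow> C i \<in> \<C>" "\<And>i. i < N \<Longrightarrow> C i \<subset> C (Suc i)"
  shows "enat N \<le> chain_length \<C>" unfolding chain_length_def using assms by (intro Sup_upper) auto

section \<open>Algebraic dependence of three polynomials in two variables\<close>

context charp
begin

abbreviation box :: "nat \<Rightarrow> (nat \<times> nat) set" where "box k \<equiv> {..k} \<times> {..k}"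

lemma supp_mult_box:
  "supp x \<subseteq> box a \<Longrightarrow> supp y \<subseteq> box b \<Longrightarrow> supp (x * y) \<subseteq> box (a + b)" by (fastforce elim!: supp_multE)

lemma supp_power_box: "supp x \<subseteq> box a \<Longrightarrow> supp (x ^ k) \<subseteq> box (k * a)"
  by (induction k) (auto dest: supp_mult_box)

lemma supp_of_int: "supp (of_int c) \<subseteq> {(0, 0)}"
  and supp_of_int_00: "(0, 0) \<in> supp (of_int c) \<longleftrightarrow> \<not> int p dvd c"
proof -
  have "cf (of_int c) i j = (if i = 0 \<and> j = 0 then c else 0)" for i j
    using cf_of_int_mult[of c 1 i j] by (simp add: cf_one)
  then show "supp (of_int c) \<subseteq> {(0, 0)}" "(0, 0) \<in> supp (of_int c) \<longleftrightarrow> \<not> int p dvd c"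
    by (auto simp: supp_def split: if_splits)
qed

lemma supp_sum:
  assumes "\<And>s. s \<in> S \<Longrightarrow> supp (f s) \<subseteq> U"
  shows "supp (sum f S) \<subseteq> U" using assms
proof (induction S rule: infinite_finite_induct)
  case (insert s S)
  then show ?case using supp_add[of "f s" "sum f S"] by auto
qed auto

text \<open>Grouped by variable instead of expanded, because the argument on prime chains takes
  lowest coefficients in \<open>x\<close>, then in \<open>y\<close>, then in
  \<open>z\<close>.\<close>

definition polyval :: "nat \<Rightarrow> bps \<Rightarrow> bps \<Rightarrow> bps \<Rightarrow> (nat \<Rightarrow> nat \<Rightarrow> nat \<Rightarrow> int) \<Rightarrow> bps" where
  "polyval N x y z a = (\<Sum>i\<le>N. x ^ i * (\<Sum>j\<le>N. y ^ j * (\<Sum>k\<le>N. z ^ k * of_int (a i j k))))"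

lemma polyval_diff:
  "polyval N x y z a - polyval N x y z b = polyval N x y z (\<lambda>i j k. a i j k - b i j k)"
  by (simp add: polyval_def right_diff_distrib sum_subtractf)

lemma supp_polyval_box:
  assumes "supp x \<subseteq> box D" "supp y \<subseteq> box D" "supp z \<subseteq> box D"
  shows "supp (polyval N x y z a) \<subseteq> box (3 * D * N)"
proof -
  have pow: "supp (u ^ k) \<subseteq> box (N * D)" if "supp u \<subseteq> box D" "k \<le> N" for u k
  proof -
    have "k * D \<le> N * D" using that by simp
    then have "box (k * D) \<subseteq> box (N * D)" by (meson Sigma_mono atMost_subset_iff)
    then show ?thesis using supp_power_box[OF that(1)] by blast
  qed
  have "supp (of_int c) \<subseteq> box 0" for c using supp_of_int[of c] by auto
  then have "supp (polyval N x y z a) \<subseteq> box (N * D + (N * D + (N * D + 0)))"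
    unfolding polyval_def by (intro supp_sum supp_mult_box pow assms) auto
  moreover have "N * D + (N * D + (N * D + 0)) = 3 * D * N" by simp
  ultimately show ?thesis by (simp only:)
qed

text \<open>Pigeonhole over a finite field: there are \<open>p ^ ((N + 1) ^ 3)\<close> tables of
  coefficients, their values are among at most \<open>p ^ ((M + 1) ^ 2)\<close> reduced polynomials,
  and the difference of two tables with the same value is a relation.\<close>

lemma algebraically_dependent:
  assumes fin: "finite (supp x)" "finite (supp y)" "finite (supp z)"
  obtains N a where "red (polyval N x y z a) = 0" "\<exists>i\<le>N. \<exists>j\<le>N. \<exists>k\<le>N. \<not> int p dvd a i j k"
proof -
  have "finite (fst ` (supp x \<union> supp y \<union> supp z) \<union> snd ` (supp x \<union> supp y \<union> supp z))"
    using fin by simp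
  then obtain D where D: "\<forall>d \<in> fst ` (supp x \<union> supp y \<union> supp z) \<union> snd ` (supp x \<union> supp y \<union> supp z). d \<le> D"
    using finite_nat_set_iff_bounded_le by blast
  then have box: "supp x \<subseteq> box D" "supp y \<subseteq> box D" "supp z \<subseteq> box D" by force+
  \<comment> \<open>With this choice \<open>((3 * D + 1) * (N + 1)) ^ 2\<close> equals
    \<open>N * (N + 1) ^ 2\<close>, which is at most \<open>(N + 1) ^ 3\<close>, and
    \<open>(M + 1) ^ 2\<close> is strictly smaller.\<close>
  define N where "N = (3 * D + 1) ^ 2"
  define M where "M = 3 * D * N"
  have "N \<ge> 1" by (simp add: N_def)
  then have "M + 1 < (3 * D + 1) * (N + 1)" by (simp add: M_def algebra_simps)
  then have "(M + 1) ^ 2 < ((3 * D + 1) * (N + 1)) ^ 2" by (intro power_strict_mono) auto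
  also have "\<dots> = N * (N + 1) ^ 2" by (simp only: N_def power_mult_distrib)
  also have "\<dots> \<le> (N + 1) ^ 3" by (simp add: power3_eq_cube power2_eq_square)
  finally have less: "(M + 1) ^ 2 < (N + 1) ^ 3" .
  define S where "S = ({..N} \<times> {..N} \<times> {..N}) \<rightarrow>\<^sub>E {..<p}"
  define Y where "Y = {y. red y = y \<and> supp y \<subseteq> box M}"
  define F where "F f = red (polyval N x y z (\<lambda>i j k. int (f (i, j, k))))" for f
  have "card ({..N} \<times> {..N} \<times> {..N}) = (N + 1) ^ 3" by (simp add: power3_eq_cube mult.assoc)
  then have cardS: "card S = p ^ ((N + 1) ^ 3)"
    unfolding S_def by (subst card_PiE) (simp_all only: finite_cartesian_product finite_atMost prod_constant card_lessThan)
  let ?T = "(box M) \<rightarrow>\<^sub>E {0..<int p}"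
  let ?r = "\<lambda>y. \<lambda>t\<in>box M. cf y (fst t) (snd t)"
  have inj: "inj_on ?r Y"
  proof (rule inj_onI, rule bps_eqI)
    fix u v i j assume uv: "u \<in> Y" "v \<in> Y" "?r u = ?r v"
    show "cf u i j = cf v i j"
    proof (cases "(i, j) \<in> box M")
      case True
      then show ?thesis using fun_cong[OF uv(3), of "(i, j)"] by simp
    next
      case False
      have "cf u i j = cf (red u) i j" "cf v i j = cf (red v) i j" using uv by (auto simp: Y_def)
      moreover have "int p dvd cf u i j" "int p dvd cf v i j"
        using False uv by (auto simp: Y_def supp_def)
      ultimately show ?thesis by (simp add: cf_red)
    qed
  qed
  have sub: "?r ` Y \<subseteq> ?T"
  proof (clarsimp simp: Y_def)
    fix u i j assume "red u = u"
    then have "cf u i j = cf u i j mod int p" using cf_red[of u i j] by simp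
    then show "0 \<le> cf u i j \<and> cf u i j < int p"
      using p_gt_0 by (metis of_nat_0_less_iff pos_mod_bound pos_mod_sign)
  qed
  have finT: "finite ?T" by (intro finite_PiE) auto
  then have finY: "finite Y" using inj sub by (meson finite_imageD finite_subset)
  have "card Y \<le> card ?T" by (rule card_inj_on_le[OF inj sub finT])
  also have "card ?T = p ^ ((M + 1) ^ 2)" by (simp add: card_PiE power2_eq_square)
  also have "\<dots> < card S" unfolding cardS using less p_gt_1 by simp
  finally have "card Y < card S" .
  moreover have "F ` S \<subseteq> Y" unfolding F_def Y_def M_def using supp_polyval_box[OF box]
    by (intro image_subsetI CollectI conjI) (simp_all only: red_red supp_red)
  then have "card (F ` S) \<le> card Y" using finY by (intro card_mono)
  ultimately have "\<not> inj_on F S" by (intro pigeonhole) simp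
  then obtain f g where fg: "f \<in> S" "g \<in> S" "f \<noteq> g" "F f = F g" by (auto simp: inj_on_def)
  define a where "a i j k = int (f (i, j, k)) - int (g (i, j, k))" for i j k
  have "red (polyval N x y z a) = red (F f - F g)"
    unfolding a_def F_def polyval_diff[symmetric] by simp
  then have 1: "red (polyval N x y z a) = 0" using fg(4) by simp
  obtain i j k where ijk: "i \<le> N" "j \<le> N" "k \<le> N" "f (i, j, k) \<noteq> g (i, j, k)"
  proof -
    have "\<exists>t\<in>{..N} \<times> {..N} \<times> {..N}. f t \<noteq> g t"
    proof (rule ccontr)
      assume neg: "\<not> ?thesis"
      have "f = g" by (rule PiE_ext[OF fg(1,2)[unfolded S_def]]) (use neg in blast)
      then show False using fg(3) by simp
    qed
    then show ?thesis using that by auto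
  qed
  then have box3: "(i, j, k) \<in> {..N} \<times> {..N} \<times> {..N}" by simp
  have "f (i, j, k) < p" "g (i, j, k) < p"
    using PiE_mem[OF fg(1)[unfolded S_def] box3] PiE_mem[OF fg(2)[unfolded S_def] box3] by simp_all
  then have "0 < \<bar>a i j k\<bar>" "\<bar>a i j k\<bar> < int p" using ijk(4) unfolding a_def by linarith+
  then have "\<not> int p dvd a i j k" using zdvd_not_zless by (metis dvd_abs_iff)
  then show ?thesis using that[OF 1] ijk(1-3) by blast
qed

end

context toric
begin

lemma InA_of_int [simp]: "InA (of_int c)"
  using supp_of_int[of c] by (intro InR_imp_InA) (auto simp: InR_def intro: finite_subset)

lemma InA_sum: "(\<And>s. s \<in> S \<Longrightarrow> InA (f s)) \<Longrightarrow> InA (sum f S)"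
  by (induction S rule: infinite_finite_induct) (auto intro: InA_add)

text \<open>Differences of comparable exponents of the semigroup lie in the semigroup, so domination
  in each coordinate becomes divisibility by a monomial of the algebra.\<close>

lemma dickson_Sg:
  assumes "X \<subseteq> Sg"
  shows "\<exists>F. finite F \<and> F \<subseteq> X \<and> (\<forall>t\<in>X. \<exists>a b c d. (a, b) \<in> F \<and> (c, d) \<in> Sg \<and> t = (a + c, b + d))"
proof -
  define Y where "Y u = {t \<in> X. fst t mod n = fst u \<and> snd t mod n = snd u}" for u
  have "\<forall>u. \<exists>F. finite F \<and> F \<subseteq> Y u \<and> (\<forall>(i, j)\<in>Y u. \<exists>(a, b)\<in>F. a \<le> i \<and> b \<le> j)"
    using dickson_nat_pairs by blast
  from choice[OF this] obtain F where
    F': "\<forall>u. finite (F u) \<and> F u \<subseteq> Y u \<and> (\<forall>(i, j)\<in>Y u. \<exists>(a, b)\<in>F u. a \<le> i \<and> b \<le> j)" ..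
  then have F: "finite (F u)" "F u \<subseteq> Y u" "(i, j) \<in> Y u \<Longrightarrow> \<exists>(a, b)\<in>F u. a \<le> i \<and> b \<le> j" for u i j
    using F'[rule_format, of u] by auto
  have "\<exists>a b c d. (a, b) \<in> (\<Union>u\<in>{..<n} \<times> {..<n}. F u) \<and> (c, d) \<in> Sg \<and> (i, j) = (a + c, b + d)"
    if ij: "(i, j) \<in> X" for i j
  proof -
    let ?u = "(i mod n, j mod n)"
    have "(i, j) \<in> Y ?u" using ij by (simp add: Y_def)
    then obtain a b where ab: "(a, b) \<in> F ?u" "a \<le> i" "b \<le> j" using F(3) by blast
    then have "(a, b) \<in> Y ?u" using F(2) by blast
    then have "(a, b) \<in> Sg" using assms by (auto simp: Y_def)
    moreover have "(a + (i - a), b + (j - b)) \<in> Sg" using ab ij assms by auto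
    ultimately have "(i - a, j - b) \<in> Sg" using Sg_add_iff by blast
    moreover have "?u \<in> {..<n} \<times> {..<n}" using n by simp
    ultimately show ?thesis using ab
      by (intro exI[of _ a] exI[of _ b] exI[of _ "i - a"] exI[of _ "j - b"]) auto
  qed
  moreover have "(\<Union>u\<in>{..<n} \<times> {..<n}. F u) \<subseteq> X" using F(2) by (auto simp: Y_def)
  ultimately show ?thesis using F(1) by (intro exI[of _ "\<Union>u\<in>{..<n} \<times> {..<n}. F u"]) auto
qed

lemma A_ideal_diff:
  assumes "ideal I A" "red x \<in> I" "red y \<in> I"
  shows "red (x - y) \<in> I"
proof -
  interpret I: ideal I A by fact
  show ?thesis using I.a_closed[OF assms(2) I.I_l_closed[OF assms(3), of "red (of_int (- 1))"]]
    by (simp add: carrier_A InA_uminus)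
qed

text \<open>Division by a Groebner basis of the ideal of numerators, in the lexicographic order.\<close>

lemma A_noetherian: "noetherian_ring A"
proof (rule A.noetherian_ringI)
  fix I assume id: "ideal I A"
  interpret I: ideal I A by (rule id)
  \<comment> \<open>The leading exponents of the polynomials in the ideal. \<open>Max\<close> refers
    to the lexicographic order on pairs, a well-order, so that reduction terminates.\<close>
  define L where "L = {Max (supp f) | f. f \<in> I \<and> InR f \<and> supp f \<noteq> {}}"
  have "L \<subseteq> Sg" unfolding L_def InR_def using Max_in by blast
  from dickson_Sg[OF this] obtain T where T: "finite T" "T \<subseteq> L"
    "\<And>t. t \<in> L \<Longrightarrow> \<exists>a b c d. (a, b) \<in> T \<and> (c, d) \<in> Sg \<and> t = (a + c, b + d)" by metis
  have "\<forall>t\<in>T. \<exists>f. f \<in> I \<and> InR f \<and> supp f \<noteq> {} \<and> t = Max (supp f)"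
    using T(2) unfolding L_def by blast
  then obtain g where g: "\<And>t. t \<in> T \<Longrightarrow> g t \<in> I" "\<And>t. t \<in> T \<Longrightarrow> InR (g t)"
    "\<And>t. t \<in> T \<Longrightarrow> supp (g t) \<noteq> {}" "\<And>t. t \<in> T \<Longrightarrow> t = Max (supp (g t))" by metis
  have gI: "g ` T \<subseteq> I" using g(1) by auto
  then have gA: "g ` T \<subseteq> carrier A" using I.a_subset by blast
  let ?K = "Idl\<^bsub>A\<^esub> (g ` T)"
  have K: "ideal ?K A" by (rule A.genideal_ideal[OF gA])
  interpret K: ideal ?K A by (rule K)
  have gK: "g t \<in> ?K" if "t \<in> T" for t using A.genideal_self[OF gA] that by blast
  have KI: "?K \<subseteq> I" by (rule A.genideal_minimal[OF id gI])
  have poly: "red f \<in> ?K" if "InR f" "red f \<in> I" "supp f \<noteq> {} \<Longrightarrow> Max (supp f) = t" for f t using that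
  proof (induction t arbitrary: f rule: less_induct)
    case (less t)
    show ?case
    proof (cases "supp f = {}")
      case True
      then show ?thesis using K.zero_closed by (simp add: supp_empty_iff)
    next
      case False
      have t: "t = Max (supp f)" and fin: "finite (supp f)"
        using less.prems False by (auto simp: InR_def)
      have "t \<in> L" unfolding L_def using False less.prems t
        by (intro CollectI exI[of _ "red f"]) simp
      then obtain a b c d where abcd: "(a, b) \<in> T" "(c, d) \<in> Sg" "t = (a + c, b + d)"
        using T(3) by blast
      let ?g = "g (a, b)"
      have maxg: "(a, b) = Max (supp ?g)" "finite (supp ?g)" "supp ?g \<noteq> {}"
        using g[OF abcd(1)] by (auto simp: InR_def)
      then have "(a, b) \<in> supp ?g" using Max_in by metis
      then obtain m where m: "[cf ?g a b * m = 1] (mod int p)"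
        using ex_inverse_mod_p[of "cf ?g a b"] by (auto simp: supp_def)
      \<comment> \<open>\<open>m\<close> inverts the leading coefficient of \<open>?g\<close> modulo
        \<open>p\<close>; with this factor the shifted \<open>?g\<close> cancels the leading term of
        \<open>f\<close>.\<close>
      define k where "k = m * cf f (a + c) (b + d)"
      define u where "u = of_int k * bmon (c, d)"
      define h where "h = f - u * ?g"
      have uA: "red u \<in> carrier A"
        unfolding u_def using abcd(2) by (intro carrier_AI InA_mult InR_imp_InA[OF InR_bmon]) auto
      have cfu: "cf (u * ?g) i j = (if c \<le> i \<and> d \<le> j then k * cf ?g (i - c) (j - d) else 0)" for i j
        by (simp add: u_def mult.assoc cf_bmon_mult)
      have ug: "red (u * ?g) \<in> ?K" using K.I_l_closed[OF gK[OF abcd(1)] uA] by simp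
      have InRh: "InR h"
      proof -
        have "InR (u * ?g)" unfolding u_def using abcd(2) g(2)[OF abcd(1)] supp_of_int[of k]
          by (intro InR_mult InR_bmon) (auto simp: InR_def intro: finite_subset)
        then show ?thesis unfolding h_def InR_def
          using less.prems(1) supp_diff[of f "u * ?g"] unfolding InR_def
          by (meson finite_UnI finite_subset Un_least order_trans)
      qed
      have hI: "red h \<in> I"
        unfolding h_def using less.prems(2) KI ug by (intro A_ideal_diff[OF id]) auto
      have le: "s \<le> t" if "s \<in> supp h" for s
      proof -
        obtain i j where s: "s = (i, j)" by fastforce
        from that supp_diff[of f "u * ?g"] consider "s \<in> supp f" | "s \<in> supp (u * ?g)"
          unfolding h_def by blast
        then show ?thesis
        proof cases
          case 1
          then show ?thesis using t fin by simp
        next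
          case 2
          then have cd: "c \<le> i" "d \<le> j" "(i - c, j - d) \<in> supp ?g"
            unfolding s supp_def by (auto simp: cfu split: if_splits)
          then have "(i - c, j - d) \<le> (a, b)" using maxg Max_ge by metis
          then show ?thesis using cd unfolding s abcd(3) by (auto simp: less_eq_prod_def)
        qed
      qed
      have "int p dvd cf h (a + c) (b + d)"
      proof -
        have "cf h (a + c) (b + d) = (1 - cf ?g a b * m) * cf f (a + c) (b + d)"
          by (simp add: h_def cfu k_def algebra_simps)
        moreover have "int p dvd 1 - cf ?g a b * m"
          using m by (simp add: cong_iff_dvd_diff dvd_diff_commute)
        ultimately show ?thesis by simp
      qed
      then have "t \<notin> supp h" unfolding abcd(3) supp_def by simp
      have "red h \<in> ?K"
      proof (cases "supp h = {}")
        case True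
        then show ?thesis using K.zero_closed by (simp add: supp_empty_iff)
      next
        case False
        then have "Max (supp h) \<in> supp h" using InRh by (intro Max_in) (auto simp: InR_def)
        then have "Max (supp h) < t" using le \<open>t \<notin> supp h\<close> by (metis order_le_less)
        then show ?thesis using less.IH[OF _ InRh hI] by blast
      qed
      from K.a_closed[OF this ug] show ?thesis by (simp add: h_def)
    qed
  qed
  have "I \<subseteq> ?K"
  proof
    fix x assume x: "x \<in> I"
    then have xA: "x \<in> carrier A" using I.a_subset by blast
    obtain s where s: "InR s" "(0, 0) \<in> supp s" "InR (s * x)" using InAE[OF carrier_AD(2)[OF xA]] .
    have "red s \<in> carrier A" using s(1) by (intro carrier_AI InR_imp_InA)
    from I.I_l_closed[OF x this] have "red (s * x) \<in> I" by simp
    from poly[OF s(3) this refl] have sx: "red (s * x) \<in> ?K" .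
    obtain r where r: "InA r" "red (s * r) = 1" using ex_inverse_A[OF InR_imp_InA[OF s(1)] s(2)] by blast
    have "red (r * (s * x)) = red (red (s * r) * x)" by (simp add: mult_ac)
    also have "\<dots> = x" using xA by (simp add: r(2) carrier_A)
    finally show "x \<in> ?K" using K.I_l_closed[OF sx carrier_AI[OF r(1)]] by simp
  qed
  then show "\<exists>G\<subseteq>carrier A. finite G \<and> I = Idl\<^bsub>A\<^esub> G"
    using KI gA T(1) by (intro exI[of _ "g ` T"]) auto
qed

subsection \<open>Krull dimension\<close>

text \<open>Since \<open>x\<close> is outside the prime \<open>P\<close>, the factor
  \<open>x ^ m\<close> cancels modulo \<open>P\<close>. What remains in \<open>P\<close> is
  \<open>b m\<close> plus a multiple of \<open>x\<close>, and \<open>x\<close> lies in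
  \<open>Q\<close>.\<close>

lemma lowest_coeff_in_ideal:
  assumes P: "primeideal P A" and Q: "ideal Q A" and PQ: "P \<subseteq> Q"
    and x: "InA x" "red x \<in> Q" "red x \<notin> P"
    and b: "\<And>i. InA (b i)" "red (\<Sum>i\<le>N. x ^ i * b i) \<in> P" "m \<le> N" "\<And>i. i < m \<Longrightarrow> red (b i) = 0"
  shows "red (b m) \<in> Q"
proof -
  interpret P: primeideal P A by (rule P)
  interpret Q: ideal Q A by (rule Q)
  show ?thesis using b
  proof (induction m arbitrary: N b)
    case 0
    show ?case
    proof (cases N)
      case 0
      then show ?thesis using "0.prems" PQ by auto
    next
      case (Suc M)
      define s where "s = (\<Sum>i\<le>M. x ^ i * b (Suc i))"
      have eq: "(\<Sum>i\<le>N. x ^ i * b i) = b 0 + x * s"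
        unfolding Suc s_def by (simp add: sum.atMost_Suc_shift sum_distrib_left mult.assoc del: sum.atMost_Suc)
      have "InA s" unfolding s_def using "0.prems"(1) x(1) by (intro InA_sum InA_mult InA_power)
      then have "red (x * s) \<in> Q" using Q.I_r_closed[OF x(2), of "red s"] carrier_AI by simp
      moreover have "red (b 0 + x * s) \<in> Q" using "0.prems"(2) PQ eq by auto
      ultimately have "red (b 0 + x * s - x * s) \<in> Q" by (intro A_ideal_diff[OF Q])
      then show ?thesis by simp
    qed
  next
    case (Suc m)
    then obtain M where N: "N = Suc M" by (cases N) auto
    define s where "s = (\<Sum>i\<le>M. x ^ i * b (Suc i))"
    have eq: "(\<Sum>i\<le>N. x ^ i * b i) = b 0 + x * s"
      unfolding N s_def by (simp add: sum.atMost_Suc_shift sum_distrib_left mult.assoc del: sum.atMost_Suc)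
    have "InA s" unfolding s_def using Suc.prems(1) x(1) by (intro InA_sum InA_mult InA_power)
    have "red (b 0) = red 0" using Suc.prems(4)[of 0] by simp
    from red_add_cong[OF this refl, of "x * s"] have "red (x * s) \<in> P" using Suc.prems(2) eq by simp
    then have "red x \<otimes>\<^bsub>A\<^esub> red s \<in> P" by simp
    then have "red s \<in> P" using P.I_prime x(1,3) \<open>InA s\<close> carrier_AI by blast
    then show ?case using Suc.IH[of "\<lambda>i. b (Suc i)" M] Suc.prems N unfolding s_def by auto
  qed
qed

text \<open>The dependence relation is available for polynomials only. Multiplying by a denominator,
  a unit of \<open>A\<close>, changes no membership in \<open>P\<close> or \<open>Q\<close>.\<close>

lemma ex_numerator:
  assumes P: "primeideal P A" and Q: "ideal Q A" and x: "x \<in> Q" "x \<notin> P"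
  obtains y where "InR y" "red y \<in> Q" "red y \<notin> P"
proof -
  interpret P: primeideal P A by (rule P)
  interpret Q: ideal Q A by (rule Q)
  have xA: "x \<in> carrier A" using x Q.a_subset by blast
  obtain s where s: "InR s" "(0, 0) \<in> supp s" "InR (s * x)" using InAE[OF carrier_AD(2)[OF xA]] .
  have sA: "red s \<in> carrier A" using s(1) by (intro carrier_AI InR_imp_InA)
  have "P \<subseteq> mm" by (rule proper_ideal_subset_mm[OF P.ideal_axioms P.I_notcarr[symmetric]])
  moreover have "red s \<notin> mm" using s(2) by (simp add: mm_iff)
  ultimately have "red s \<notin> P" by blast
  then have "red s \<otimes>\<^bsub>A\<^esub> x \<notin> P" using P.I_prime[OF sA xA] x(2) by blast
  moreover have "red s \<otimes>\<^bsub>A\<^esub> x \<in> Q" by (rule Q.I_l_closed[OF x(1) sA])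
  ultimately show ?thesis using that[OF s(3)] by simp
qed

text \<open>Polynomials from the three successive differences of the primes satisfy a nontrivial
  relation. Its lowest coefficient in \<open>x\<close> lies in \<open>P1\<close>, the lowest
  coefficient of that in \<open>y\<close> lies in \<open>P2\<close>, and the lowest one of that in
  \<open>z\<close> lies in \<open>P3\<close>; but the last is a nonzero scalar, hence a
  unit.\<close>

lemma no_long_prime_chain:
  assumes "primeideal P0 A" "primeideal P1 A" "primeideal P2 A" "primeideal P3 A"
    "P0 \<subset> P1" "P1 \<subset> P2" "P2 \<subset> P3"
  shows False
proof -
  interpret P0: primeideal P0 A by fact
  interpret P1: primeideal P1 A by fact
  interpret P2: primeideal P2 A by fact
  interpret P3: primeideal P3 A by fact
  obtain x where x: "InR x" "red x \<in> P1" "red x \<notin> P0"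
    using assms(5) ex_numerator[OF assms(1) P1.ideal_axioms] by blast
  obtain y where y: "InR y" "red y \<in> P2" "red y \<notin> P1"
    using assms(6) ex_numerator[OF assms(2) P2.ideal_axioms] by blast
  obtain z where z: "InR z" "red z \<in> P3" "red z \<notin> P2"
    using assms(7) ex_numerator[OF assms(3) P3.ideal_axioms] by blast
  obtain N a where a: "red (polyval N x y z a) = 0" "\<exists>i\<le>N. \<exists>j\<le>N. \<exists>k\<le>N. \<not> int p dvd a i j k"
    using algebraically_dependent[of x y z] x(1) y(1) z(1) unfolding InR_def by blast
  have A: "InA x" "InA y" "InA z" using x y z by (auto intro: InR_imp_InA)
  define c where "c i j = (\<Sum>k\<le>N. z ^ k * of_int (a i j k))" for i j
  define b where "b i = (\<Sum>j\<le>N. y ^ j * c i j)" for i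
  have Ac: "InA (c i j)" for i j unfolding c_def using A by (intro InA_sum InA_mult InA_power) auto
  have Ab: "InA (b i)" for i unfolding b_def using A Ac by (intro InA_sum InA_mult InA_power) auto
  have c0: "red (c i j) = 0" if "\<And>k. k \<le> N \<Longrightarrow> int p dvd a i j k" for i j
  proof -
    have "red (of_int (a i j k)) = red 0" if "k \<le> N" for k
      using \<open>\<And>k. k \<le> N \<Longrightarrow> int p dvd a i j k\<close>[OF that] supp_of_int[of "a i j k"] supp_of_int_00[of "a i j k"]
        supp_empty_iff[of "of_int (a i j k)"] by auto
    then have "red (c i j) = red (\<Sum>k\<le>N. z ^ k * 0)"
      unfolding c_def by (intro red_sum_cong red_mult_cong) auto
    then show ?thesis by simp
  qed
  have b0: "red (b i) = 0" if "\<And>j. j \<le> N \<Longrightarrow> red (c i j) = 0" for i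
  proof -
    have "red (b i) = red (\<Sum>j\<le>N. y ^ j * 0)"
      unfolding b_def using that by (intro red_sum_cong red_mult_cong) auto
    then show ?thesis by simp
  qed
  define i where "i = (LEAST i. \<exists>j\<le>N. \<exists>k\<le>N. \<not> int p dvd a i j k)"
  have ex: "\<exists>i. \<exists>j\<le>N. \<exists>k\<le>N. \<not> int p dvd a i j k" using a(2) by blast
  have i: "\<exists>j\<le>N. \<exists>k\<le>N. \<not> int p dvd a i j k" unfolding i_def by (rule LeastI_ex[OF ex])
  have iN: "i \<le> N"
  proof -
    obtain i' where i': "i' \<le> N" "\<exists>j\<le>N. \<exists>k\<le>N. \<not> int p dvd a i' j k" using a(2) by blast
    have "i \<le> i'" unfolding i_def by (rule Least_le) (rule i'(2))
    then show ?thesis using i'(1) by simp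
  qed
  have i_min: "red (b i') = 0" if "i' < i" for i'
    using not_less_Least[OF that[unfolded i_def]] by (intro b0 c0) auto
  define j where "j = (LEAST j. j \<le> N \<and> (\<exists>k\<le>N. \<not> int p dvd a i j k))"
  have j: "j \<le> N" "\<exists>k\<le>N. \<not> int p dvd a i j k" unfolding j_def using LeastI_ex[OF i] by blast+
  have j_min: "red (c i j') = 0" if "j' < j" for j'
    using not_less_Least[OF that[unfolded j_def]] that j(1) by (intro c0) auto
  define k where "k = (LEAST k. k \<le> N \<and> \<not> int p dvd a i j k)"
  have k: "k \<le> N" "\<not> int p dvd a i j k" unfolding k_def using LeastI_ex[OF j(2)] by blast+
  have k_min: "red (of_int (a i j k')) = 0" if "k' < k" for k'
    using not_less_Least[OF that[unfolded k_def]] that k(1) supp_of_int[of "a i j k'"]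
      supp_of_int_00[of "a i j k'"] supp_empty_iff[of "of_int (a i j k')"] by auto
  have "red (\<Sum>i\<le>N. x ^ i * b i) \<in> P0"
    using a(1) P0.zero_closed by (simp add: polyval_def b_def c_def)
  then have "red (b i) \<in> P1"
    using assms(5) by (intro lowest_coeff_in_ideal[OF assms(1) P1.ideal_axioms _ A(1) x(2,3) Ab _ iN i_min]) auto
  then have "red (c i j) \<in> P2" unfolding b_def using assms(6)
    by (intro lowest_coeff_in_ideal[OF assms(2) P2.ideal_axioms _ A(2) y(2,3) Ac _ j(1) j_min]) auto
  then have "red (of_int (a i j k)) \<in> P3" unfolding c_def using assms(7)
    by (intro lowest_coeff_in_ideal[OF assms(3) P3.ideal_axioms _ A(3) z(2,3) InA_of_int _ k(1) k_min]) auto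
  moreover have "P3 \<subseteq> mm" using proper_ideal_subset_mm[OF P3.ideal_axioms] P3.I_notcarr by blast
  ultimately show False using k(2) by (auto simp: mm_iff supp_of_int_00)
qed

section \<open>A prime between zero and the maximal ideal\<close>

definition U1 :: "(nat \<times> nat) set" where "U1 = {(i, j) \<in> Sg. i > 0}"

text \<open>\<open>J U1\<close> is the kernel of setting the first variable to zero, and series over
  the prime field in the second variable alone have no zero divisors.\<close>

lemma J_U1_prime: "primeideal (J U1) A"
proof (rule primeidealI)
  have "Sg_ideal U1" by (auto simp: Sg_ideal_def U1_def intro: Sg_add)
  then show "ideal (J U1) A" by (rule J_ideal)
  show "cring A" by (rule A_cring)
  have "1 \<notin> J U1" by (simp add: J_def U1_def)
  then show "carrier A \<noteq> J U1" using one_in_A by blast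
  have iff: "x \<in> J U1 \<longleftrightarrow> fps_const (int p) dvd fps_nth x 0" if "x \<in> carrier A" for x
  proof -
    have "supp x \<subseteq> Sg" using InA_supp carrier_AD(2)[OF that] .
    then have "supp x \<subseteq> U1 \<longleftrightarrow> (\<forall>j. (0, j) \<notin> supp x)" unfolding U1_def by (auto intro: gr0I)
    then have "x \<in> J U1 \<longleftrightarrow> (\<forall>j. (0, j) \<notin> supp x)" using that by (simp add: J_def)
    then show ?thesis by (simp add: supp_def cf_def fps_const_dvd_iff)
  qed
  fix x y assume xy: "x \<in> carrier A" "y \<in> carrier A" "x \<otimes>\<^bsub>A\<^esub> y \<in> J U1"
  have "supp (x * y) \<subseteq> U1" using xy(3) by (simp add: J_def)
  then have "(0, j) \<notin> supp (x * y)" for j by (auto simp: U1_def)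
  then have "fps_const (int p) dvd fps_nth (x * y) 0"
    unfolding supp_def cf_def fps_const_dvd_iff by simp
  then have "fps_const (int p) dvd fps_nth x 0 * fps_nth y 0" by simp
  moreover have "prime_elem (fps_const (int p))"
    using prime_int_p by (intro prime_elem_fps_const) auto
  ultimately show "x \<in> J U1 \<or> y \<in> J U1" using iff xy(1,2) by (auto dest: prime_elem_dvd_multD)
qed

lemma krull_dim_A: "krull_dim A = 2"
proof -
  have "chain_length {P. primeideal P A} \<le> enat 2"
  proof (rule chain_length_leI, rule ccontr)
    fix C :: "nat \<Rightarrow> bps set" and k
    assume C: "\<forall>i\<le>k. C i \<in> {P. primeideal P A}" "\<forall>i<k. C i \<subset> C (Suc i)" "\<not> k \<le> 2"
    show False using C no_long_prime_chain[of "C 0" "C 1" "C 2" "C 3"]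
      by (auto simp: numeral_3_eq_3 numeral_2_eq_2)
  qed
  moreover have "enat 2 \<le> chain_length {P. primeideal P A}"
  proof (rule chain_length_geI)
    let ?C = "\<lambda>i::nat. if i = 0 then {0} else if i = 1 then J U1 else mm"
    have "primeideal {0} A" using domain.zeroprimeideal[OF A_domain] by simp
    then show "?C i \<in> {P. primeideal P A}" for i
      using J_U1_prime A.maximalideal_prime[OF mm_maximal] by simp
    have 1: "0 \<in> J U1" "0 \<in> mm" using A.zero_closed by (auto simp: J_def mm_iff)
    have "(n, 0) \<in> Sg" "(0, n) \<in> Sg" using Sg_n[of 1 0] Sg_n[of 0 1] by simp_all
    then have 2: "bmon (n, 0) \<in> J U1" and 3: "bmon (0, n) \<in> mm" "bmon (0, n) \<notin> J U1"
      using bmon_in_A n by (simp_all add: J_def U1_def mm_iff)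
    have 4: "J U1 \<subseteq> mm" by (auto simp: J_def U1_def mm_iff)
    have 5: "bmon (n, 0) \<noteq> 0" by (metis insert_not_empty supp_0 supp_bmon)
    fix i :: nat assume "i < 2"
    then consider "i = 0" | "i = 1" by linarith
    then show "?C i \<subset> ?C (Suc i)" by cases (use 1 2 3 4 5 in auto)
  qed
  ultimately show ?thesis
    unfolding krull_dim_def by (metis enat_numeral numeral_eq_enat order_antisym)
qed

end

subsection \<open>Lengths\<close>

lemma chain_length_mono:
  assumes "F ` \<C> \<subseteq> \<D>" and "\<And>X Y. X \<in> \<C> \<Longrightarrow> Y \<in> \<C> \<Longrightarrow> X \<subset> Y \<Longrightarrow> F X \<subset> F Y"
  shows "chain_length \<C> \<le> chain_length \<D>" unfolding chain_length_def
proof (rule Sup_subset_mono, clarify)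
  fix k C
  assume "\<forall>i\<le>k. C i \<in> \<C>" "\<forall>i<k. C i \<subset> C (Suc i)"
  then show "\<exists>ka. enat k = enat ka \<and> (\<exists>C. (\<forall>i\<le>ka. C i \<in> \<D>) \<and> (\<forall>i<ka. C i \<subset> C (Suc i)))"
    using assms by (intro exI[of _ k] conjI exI[of _ "\<lambda>i. F (C i)"]) (auto simp: Suc_le_eq)
qed

lemma (in ring) submodule_quotient_iff:
  assumes "ideal I R" and R: "cring R"
  shows "submodule N R (quotient_module R I) \<longleftrightarrow> ideal N (R Quot I)"
proof -
  interpret I: ideal I R by fact
  interpret Q: cring "R Quot I" by (rule I.quotient_is_cring[OF R])
  have "submodule N R (quotient_module R I) \<longleftrightarrow> subgroup N (add_monoid (R Quot I)) \<and>
      (\<forall>a\<in>carrier R. \<forall>x\<in>N. (I +> a) \<otimes>\<^bsub>R Quot I\<^esub> x \<in> N)"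
    by (subst submodule_iff[of _ "R Quot I"]) (simp_all add: quotient_module_def)
  also have "\<dots> \<longleftrightarrow> subgroup N (add_monoid (R Quot I)) \<and>
      (\<forall>a\<in>carrier (R Quot I). \<forall>x\<in>N. a \<otimes>\<^bsub>R Quot I\<^esub> x \<in> N)"
    by (auto simp: FactRing_def A_RCOSETS_def')
  also have "\<dots> \<longleftrightarrow> ideal N (R Quot I)"
  proof
    assume *: "subgroup N (add_monoid (R Quot I)) \<and>
      (\<forall>a\<in>carrier (R Quot I). \<forall>x\<in>N. a \<otimes>\<^bsub>R Quot I\<^esub> x \<in> N)"
    then have "N \<subseteq> carrier (add_monoid (R Quot I))" by (intro subgroup.subset) simp
    then have "N \<subseteq> carrier (R Quot I)" by simp
    show "ideal N (R Quot I)"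
    proof (rule idealI[OF Q.ring_axioms])
      show "subgroup N (add_monoid (R Quot I))" using * by blast
      fix a x assume ax: "a \<in> N" "x \<in> carrier (R Quot I)"
      then show "x \<otimes>\<^bsub>R Quot I\<^esub> a \<in> N" using * by blast
      then show "a \<otimes>\<^bsub>R Quot I\<^esub> x \<in> N" using ax \<open>N \<subseteq> carrier (R Quot I)\<close> Q.m_comm by (metis subsetD)
    qed
  next
    assume "ideal N (R Quot I)"
    then interpret N: ideal N "R Quot I" .
    show "subgroup N (add_monoid (R Quot I)) \<and>
      (\<forall>a\<in>carrier (R Quot I). \<forall>x\<in>N. a \<otimes>\<^bsub>R Quot I\<^esub> x \<in> N)" using N.a_subgroup N.I_l_closed by blast
  qed
  finally show ?thesis .
qed

abbreviation ideals_above :: "('a, 'r) ring_scheme \<Rightarrow> 'a set \<Rightarrow> 'a set set" where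
  "ideals_above R I \<equiv> {K. ideal K R \<and> I \<subseteq> K}"

text \<open>The ideals of the quotient ring correspond to the ideals above \<open>I\<close>, with
  the union of cosets as inverse. This moves lengths into \<open>R\<close> itself, where they can be
  counted and transported along isomorphisms.\<close>

lemma (in cring) module_length_quotient:
  assumes I: "ideal I R"
  shows "module_length R (quotient_module R I) = chain_length (ideals_above R I)"
proof -
  let ?C = "ideals_above R I" and ?D = "{K. ideal K (R Quot I)}" and ?f = "\<lambda>J. (+>) I ` J"
  have bij: "bij_betw ?f ?C ?D" by (rule quot_ideal_correspondence[OF I])
  have inv: "\<Union> (?f K) = K" if "K \<in> ?C" for K using ideal_incl_iff[OF I] that by blast
  have "chain_length ?C \<le> chain_length ?D"
  proof (rule chain_length_mono[of ?f])
    fix X Y assume XY: "X \<in> ?C" "Y \<in> ?C" "X \<subset> Y"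
    have "?f X \<subseteq> ?f Y" using XY(3) by blast
    moreover have "?f X \<noteq> ?f Y" using XY inj_onD[OF bij_betw_imp_inj_on[OF bij] _ XY(1,2)] by blast
    ultimately show "?f X \<subset> ?f Y" by blast
  next
    show "?f ` ?C \<subseteq> ?D" using bij_betw_imp_surj_on[OF bij] by simp
  qed
  moreover have "chain_length ?D \<le> chain_length ?C"
  proof (rule chain_length_mono[of Union])
    have ex: "\<exists>X'\<in>?C. X = ?f X'" if "X \<in> ?D" for X
      using that bij_betw_imp_surj_on[OF bij] by (metis (no_types, lifting) imageE)
    show "Union ` ?D \<subseteq> ?C"
    proof (rule image_subsetI)
      fix X assume "X \<in> ?D"
      then obtain X' where X': "X' \<in> ?C" "X = ?f X'" using ex by blast
      show "\<Union> X \<in> ?C" unfolding X'(2) inv[OF X'(1)] by (rule X'(1))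
    qed
    fix X Y assume XY: "X \<in> ?D" "Y \<in> ?D" "X \<subset> Y"
    obtain X' where X': "X' \<in> ?C" "X = ?f X'" using ex[OF XY(1)] by blast
    obtain Y' where Y': "Y' \<in> ?C" "Y = ?f Y'" using ex[OF XY(2)] by blast
    have "\<Union> X \<subseteq> \<Union> Y" using XY(3) by blast
    moreover have "\<Union> X \<noteq> \<Union> Y"
    proof
      assume "\<Union> X = \<Union> Y"
      then have "X' = Y'" unfolding X'(2) Y'(2) inv[OF X'(1)] inv[OF Y'(1)] .
      then show False using X'(2) Y'(2) XY(3) by simp
    qed
    ultimately show "\<Union> X \<subset> \<Union> Y" by blast
  qed
  ultimately show ?thesis unfolding module_length_def submodule_quotient_iff[OF I is_cring] by simp
qed

section \<open>Lengths of quotients by monomial ideals\<close>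

context toric
begin

text \<open>For \<open>V = Sg - U\<close> this is the coordinate vector of \<open>x\<close> modulo
  \<open>J U\<close> in terms of the monomials outside \<open>U\<close>, so the truncations of an
  ideal above \<open>J U\<close> count its elements modulo \<open>J U\<close>.\<close>

definition trunc :: "(nat \<times> nat) set \<Rightarrow> bps \<Rightarrow> nat \<times> nat \<Rightarrow> int" where
  "trunc V x = (\<lambda>t\<in>V. cf x (fst t) (snd t))"

lemma trunc_in_PiE: "x \<in> carrier A \<Longrightarrow> trunc V x \<in> V \<rightarrow>\<^sub>E {0..<int p}"
proof -
  assume "x \<in> carrier A"
  then have "cf x i j = cf x i j mod int p" for i j using cf_red[of x i j] by (simp add: carrier_A)
  then have "cf x i j \<in> {0..<int p}" for i j
    using p_gt_0 by (metis atLeastLessThan_iff of_nat_0_less_iff pos_mod_bound pos_mod_sign)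
  then show ?thesis by (auto simp: trunc_def)
qed

lemma card_trunc_range: "finite V \<Longrightarrow> card (V \<rightarrow>\<^sub>E {0..<int p}) = p ^ card V" by (simp add: card_PiE)

lemma trunc_eq_imp:
  assumes "x \<in> carrier A" "y \<in> carrier A" "trunc (Sg - U) x = trunc (Sg - U) y"
  shows "red (x - y) \<in> J U"
proof -
  have "InA (x - y)"
    using InA_add[OF carrier_AD(2)[OF assms(1)] InA_uminus[OF carrier_AD(2)[OF assms(2)]]] by simp
  moreover have "supp (x - y) \<subseteq> U"
  proof
    fix t assume t: "t \<in> supp (x - y)"
    then have "t \<in> Sg" using InA_supp[OF \<open>InA (x - y)\<close>] by blast
    moreover have "cf x (fst t) (snd t) \<noteq> cf y (fst t) (snd t)" using t by (auto simp: supp_def)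
    ultimately show "t \<in> U"
      using fun_cong[OF assms(3), of t] by (auto simp: trunc_def split: if_splits)
  qed
  ultimately show ?thesis by (simp add: J_def carrier_A)
qed

text \<open>Each proper step in a chain of ideals containing \<open>J U\<close> multiplies the number of
  truncations by at least \<open>p\<close>.\<close>

lemma card_trunc_step:
  assumes fin: "finite (Sg - U)" and K: "ideal K A" "J U \<subseteq> K" and K': "ideal K' A" and sub: "K \<subset> K'"
  shows "p * card (trunc (Sg - U) ` K) \<le> card (trunc (Sg - U) ` K')"
proof -
  let ?V = "Sg - U" and ?t = "trunc (Sg - U)"
  interpret K: ideal K A by (rule K)
  interpret K': ideal K' A by (rule K')
  obtain g where g: "g \<in> K'" "g \<notin> K" using sub by blast
  have gA: "g \<in> carrier A" using g(1) K'.a_subset by blast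
  define r where "r f = inv_into K (?t) f" for f
  have r: "r f \<in> K" "?t (r f) = f" if "f \<in> ?t ` K" for f
    unfolding r_def using that by (auto intro: inv_into_into f_inv_into_f)
  \<comment> \<open>Adding the multiples \<open>c * g\<close> of an element outside \<open>K\<close>
    gives \<open>p\<close> different classes for each class of \<open>K\<close>.\<close>
  define F where "F = (\<lambda>(f, c::int). ?t (red (r f + of_int c * g)))"
  let ?D = "?t ` K \<times> {0..<int p}"
  have int_mem: "red (of_int c) \<in> carrier A" for c by (intro carrier_AI) simp
  have mem: "red (r f + of_int c * g) \<in> K'" if "f \<in> ?t ` K" for f c
    using K'.a_closed[OF subsetD[OF psubset_imp_subset[OF sub] r(1)[OF that]] K'.I_l_closed[OF g(1) int_mem[of c]]]
    by simp
  have "inj_on F ?D"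
  proof (rule inj_onI, clarsimp)
    fix x c x' c'
    assume xK: "x \<in> K" "x' \<in> K" and c: "0 \<le> c" "c < int p" "0 \<le> c'" "c' < int p"
      and eq: "F (?t x, c) = F (?t x', c')"
    let ?f = "?t x" and ?f' = "?t x'"
    have f: "?f \<in> ?t ` K" "?f' \<in> ?t ` K" using xK by auto
    \<comment> \<open>Otherwise \<open>c - c'\<close> times \<open>g\<close> lies in
      \<open>K\<close>, and inverting \<open>c - c'\<close> modulo \<open>p\<close> puts
      \<open>g\<close> into \<open>K\<close>.\<close>
    have cc: "c = c'"
    proof (rule ccontr)
      assume "c \<noteq> c'"
      then have "0 < \<bar>c - c'\<bar>" "\<bar>c - c'\<bar> < int p" using c by linarith+
      then have "\<not> int p dvd c - c'" using zdvd_not_zless by (metis dvd_abs_iff)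
      then obtain m where m: "[(c - c') * m = 1] (mod int p)" by (rule ex_inverse_mod_p)
      have "red (red (r ?f + of_int c * g) - red (r ?f' + of_int c' * g)) \<in> J U"
        using eq mem f K'.a_subset by (intro trunc_eq_imp) (auto simp: F_def)
      then have 1: "red (r ?f + of_int c * g - (r ?f' + of_int c' * g)) \<in> K" using K(2) by auto
      have rK: "red (r ?f) \<in> K" "red (r ?f') \<in> K"
        using r(1)[OF f(1)] r(1)[OF f(2)] K.a_subset carrier_AD(1) by (metis subsetD)+
      from A_ideal_diff[OF K(1) 1 A_ideal_diff[OF K(1) rK]]
      have "red (of_int (c - c') * g) \<in> K" by (simp add: algebra_simps)
      from K.I_l_closed[OF this int_mem[of m]]
      have "red (of_int m * (of_int (c - c') * g)) \<in> K" by (simp only: A_simps red_simps)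
      moreover have "of_int m * (of_int (c - c') * g) = of_int ((c - c') * m) * g"
        by (simp only: of_int_mult mult_ac)
      ultimately have "red (of_int ((c - c') * m) * g) \<in> K" by (simp only:)
      moreover have "red (of_int ((c - c') * m) * g) = red g" using m by (intro red_eqI)
          (metis cf_of_int_mult cong_iff_dvd_diff dvd_mult2 left_diff_distrib mult_1)
      ultimately show False using g(2) gA by (simp add: carrier_AD)
    qed
    have cfr: "cf (r h) i j mod int p = cf (r h) i j" if "h \<in> ?t ` K" for h i j
      using cf_red[of "r h" i j] r(1)[OF that] K.a_subset carrier_AD(1)[of "r h"] by auto
    have "?f t = ?f' t" if "t \<in> ?V" for t
    proof -
      have "?t (red (r ?f + of_int c * g)) t = ?t (red (r ?f' + of_int c * g)) t"
        using eq cc by (simp add: F_def)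
      then have "(cf (r ?f) (fst t) (snd t) + c * cf g (fst t) (snd t)) mod int p =
          (cf (r ?f') (fst t) (snd t) + c * cf g (fst t) (snd t)) mod int p"
        using that by (simp add: trunc_def cf_red)
      then have "cf (r ?f) (fst t) (snd t) mod int p = cf (r ?f') (fst t) (snd t) mod int p"
        by (simp add: mod_eq_dvd_iff)
      then have "?t (r ?f) t = ?t (r ?f') t" using that cfr f by (simp add: trunc_def)
      then show ?thesis using r(2)[OF f(1)] r(2)[OF f(2)] by simp
    qed
    then have "?f = ?f'" by (intro extensionalityI[of _ ?V]) (auto simp: trunc_def)
    then show "?f = ?f' \<and> c = c'" using cc by simp
  qed
  moreover have "F ` ?D \<subseteq> ?t ` K'"
  proof (rule image_subsetI)
    fix z assume "z \<in> ?D"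
    then show "F z \<in> ?t ` K'"
      unfolding F_def case_prod_unfold by (intro imageI mem) (simp add: mem_Times_iff)
  qed
  moreover have "finite (?t ` K')"
  proof (rule finite_subset)
    show "?t ` K' \<subseteq> ?V \<rightarrow>\<^sub>E {0..<int p}"
      by (rule image_subsetI, rule trunc_in_PiE, rule subsetD[OF K'.a_subset])
    show "finite (?V \<rightarrow>\<^sub>E {0..<int p})" using fin by (intro finite_PiE) auto
  qed
  ultimately have "card ?D \<le> card (?t ` K')" by (rule card_inj_on_le)
  then show ?thesis by (simp add: card_cartesian_product mult.commute)
qed

lemma chain_length_le_card:
  assumes fin: "finite (Sg - U)"
    and C: "\<forall>i\<le>k. C i \<in> ideals_above A (J U)" "\<forall>i<k. C i \<subset> C (Suc i)"
  shows "k \<le> card (Sg - U)"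
proof -
  let ?V = "Sg - U"
  have finR: "finite (?V \<rightarrow>\<^sub>E {0..<int p})" using fin by (intro finite_PiE) auto
  have sub: "trunc ?V ` C i \<subseteq> ?V \<rightarrow>\<^sub>E {0..<int p}" if "i \<le> k" for i
  proof -
    interpret ideal "C i" A using C(1) that by auto
    show ?thesis by (rule image_subsetI, rule trunc_in_PiE, rule subsetD[OF a_subset])
  qed
  have "p ^ i \<le> card (trunc ?V ` C i)" if "i \<le> k" for i using that
  proof (induction i)
    case 0
    interpret ideal "C 0" A using C(1) by auto
    have "trunc ?V ` C 0 \<noteq> {}" using zero_closed by blast
    then show ?case using finite_subset[OF sub[of 0] finR] by (simp add: Suc_le_eq card_gt_0_iff)
  next
    case (Suc i)
    have "p * p ^ i \<le> p * card (trunc ?V ` C i)" using Suc by simp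
    also have "\<dots> \<le> card (trunc ?V ` C (Suc i))"
      using C Suc.prems by (intro card_trunc_step fin) auto
    finally show ?case by simp
  qed
  then have "p ^ k \<le> card (trunc ?V ` C k)" by simp
  also have "\<dots> \<le> p ^ card ?V"
    unfolding card_trunc_range[OF fin, symmetric] by (rule card_mono[OF finR sub[OF order_refl]])
  finally show ?thesis by (rule power_le_imp_le_exp[OF p_gt_1])
qed

text \<open>The chain adds one monomial at a time. An exponent of greatest total degree outside
  \<open>U\<close> can be added, because its sums with nonzero elements of \<open>Sg\<close> have
  larger degree and are already in \<open>U\<close>.\<close>

lemma ex_ideal_chain:
  assumes "finite (Sg - U)" "Sg_ideal U"
  shows "\<exists>C. (\<forall>i\<le>card (Sg - U). C i \<in> ideals_above A (J U)) \<and> (\<forall>i<card (Sg - U). C i \<subset> C (Suc i))"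
  using assms
proof (induction "card (Sg - U)" arbitrary: U)
  case 0
  show ?case using J_ideal[OF "0.prems"(2)] unfolding "0.hyps"[symmetric]
    by (intro exI[of _ "\<lambda>_. J U"]) simp
next
  case (Suc k)
  let ?V = "Sg - U"
  have "?V \<noteq> {}" using Suc.hyps(2) by (metis card.empty nat.distinct(1))
  obtain v where v: "v \<in> ?V" "\<And>u. u \<in> ?V \<Longrightarrow> fst u + snd u \<le> fst v + snd v"
  proof -
    let ?S = "(\<lambda>u. fst u + snd u) ` ?V"
    have fin: "finite ?S" using Suc.prems(1) by simp
    have "Max ?S \<in> ?S" using \<open>?V \<noteq> {}\<close> by (intro Max_in[OF fin]) blast
    then obtain v where "v \<in> ?V" "Max ?S = fst v + snd v" by blast
    then show ?thesis using that[of v] Max_ge[OF fin] by (metis imageI)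
  qed
  have "Sg_ideal (insert v U)" unfolding Sg_ideal_def
  proof (intro conjI allI impI)
    show "insert v U \<subseteq> Sg" using v(1) Suc.prems(2) by (auto simp: Sg_ideal_def)
    fix a b c d assume ab: "(a, b) \<in> insert v U" and cd: "(c, d) \<in> Sg"
    show "(a + c, b + d) \<in> insert v U"
    proof (cases "(a, b) \<in> U")
      case True
      then show ?thesis using Sg_idealD[OF Suc.prems(2) _ cd] by blast
    next
      case False
      then have ab: "(a, b) = v" using ab by blast
      then have "(a + c, b + d) \<in> Sg" using v(1) cd Sg_add by blast
      then show ?thesis using v(2)[of "(a + c, b + d)"] ab by (cases "(a + c, b + d) \<in> U") auto
    qed
  qed
  moreover have "Sg - insert v U = ?V - {v}" by blast
  then have card: "card (Sg - insert v U) = k" "finite (Sg - insert v U)"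
    using Suc.hyps(2) Suc.prems(1) v(1) by auto
  ultimately obtain C where C: "\<forall>i\<le>k. C i \<in> ideals_above A (J (insert v U))" "\<forall>i<k. C i \<subset> C (Suc i)"
    using Suc.hyps(1)[of "insert v U"] by metis
  have JU: "J U \<subset> J (insert v U)"
  proof
    show "J U \<subseteq> J (insert v U)" by (auto simp: J_def)
    have "bmon v \<in> J (insert v U)" "bmon v \<notin> J U" using v(1) bmon_in_A by (auto simp: J_def)
    then show "J U \<noteq> J (insert v U)" by blast
  qed
  let ?C = "\<lambda>i. case i of 0 \<Rightarrow> J U | Suc i \<Rightarrow> C i"
  have "?C i \<in> ideals_above A (J U)" if "i \<le> Suc k" for i
    using that C(1) J_ideal[OF Suc.prems(2)] JU by (cases i) auto
  moreover have "?C i \<subset> ?C (Suc i)" if "i < Suc k" for i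
  proof (cases i)
    case 0
    have "J (insert v U) \<subseteq> C 0" using C(1) by blast
    with JU have "J U \<subset> C 0" by (rule psubset_subset_trans)
    then show ?thesis using 0 by simp
  next
    case (Suc j)
    then show ?thesis using C(2) that by simp
  qed
  ultimately show ?case unfolding Suc.hyps(2)[symmetric] by (intro exI[of _ ?C]) blast
qed

lemma length_A_mod_J:
  assumes "finite (Sg - U)" "Sg_ideal U"
  shows "module_length A (quotient_module A (J U)) = enat (card (Sg - U))"
proof -
  obtain C where C: "\<forall>i\<le>card (Sg - U). C i \<in> ideals_above A (J U)"
    "\<forall>i<card (Sg - U). C i \<subset> C (Suc i)" using ex_ideal_chain[OF assms] by blast
  have "chain_length (ideals_above A (J U)) = enat (card (Sg - U))"
    by (rule antisym[OF chain_length_leI[OF chain_length_le_card[OF assms(1)]] chain_length_geI[of _ C]])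
      (use C in auto)
  then show ?thesis using A.module_length_quotient[OF J_ideal[OF assms(2)]] by simp
qed

end

subsection \<open>Free ranks\<close>

abbreviation free_quotient :: "nat \<Rightarrow> nat \<Rightarrow> ('a, 'r) ring_scheme \<Rightarrow> nat \<Rightarrow> bool" where
  "free_quotient p e R N \<equiv> \<exists>f \<in> module_hom R (frobenius_pushforward p e R) (free_module R N).
     f ` carrier (frobenius_pushforward p e R) = carrier (free_module R N)"

lemma free_module_simps [simp]:
  "carrier (free_module R N) = {..<N} \<rightarrow>\<^sub>E carrier R"
  "add (free_module R N) = (\<lambda>x y. \<lambda>i\<in>{..<N}. x i \<oplus>\<^bsub>R\<^esub> y i)"
  "smult (free_module R N) = (\<lambda>a x. \<lambda>i\<in>{..<N}. a \<otimes>\<^bsub>R\<^esub> x i)" by (simp_all add: free_module_def)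

context toric
begin

lemma psi_sum: "finite S \<Longrightarrow> psi e t (sum f S) = red (\<Sum>s\<in>S. psi e t (f s))"
proof (induction S rule: finite_induct)
  case empty
  have "rho (phi (p ^ e) t 0) = 0" by (rule bps_eqI) (simp add: rho_def phi_def)
  then show ?case by (simp add: psi_def)
qed (simp add: psi_add)

definition Bq :: "nat \<Rightarrow> (nat \<times> nat) set" where
  "Bq q = {(i, j) \<in> Sg. i < q \<and> j < q}"

lemma mem_Bq: "t \<in> Bq q \<longleftrightarrow> t \<in> Sg \<and> fst t < q \<and> snd t < q" by (cases t) (simp add: Bq_def)

lemma Bq_eq: "Bq q = Sg - Vq q" by (auto simp: Bq_def Vq_def)

lemma finite_Bq: "finite (Bq q)" by (rule finite_subset[of _ "{..<q} \<times> {..<q}"]) (auto simp: Bq_def)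

text \<open>The functionals \<open>psi\<close> at the exponents in \<open>Bq\<close> are dual to the
  monomials there, so a prescribed tuple \<open>y\<close> is the image of the sum of the
  \<open>y l ^ (p ^ e)\<close> times the \<open>l\<close>-th monomial.\<close>

lemma free_quotient_exists:
  "free_quotient p e A (card (Bq (p ^ e)))"
proof -
  let ?q = "p ^ e"
  let ?N = "card (Bq ?q)"
  obtain b where b: "bij_betw b {..<?N} (Bq ?q)"
    using ex_bij_betw_nat_finite[OF finite_Bq] by (metis atLeast0LessThan)
  have bB: "b l \<in> Sg" "fst (b l) < ?q" "snd (b l) < ?q" if "l < ?N" for l
  proof -
    have "b l \<in> Bq ?q" using bij_betwE[OF b] that by blast
    then show "b l \<in> Sg" "fst (b l) < ?q" "snd (b l) < ?q" by (simp_all add: mem_Bq)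
  qed
  have b_inj: "b l = b m \<longleftrightarrow> l = m" if "l < ?N" "m < ?N" for l m
    using inj_on_eq_iff[OF bij_betw_imp_inj_on[OF b]] that by blast
  let ?f = "\<lambda>x. \<lambda>l\<in>{..<?N}. psi e (b l) x"
  have hom: "?f \<in> module_hom A (frobenius_pushforward p e A) (free_module A ?N)"
    unfolding module_hom_def
  proof (intro CollectI conjI ballI Pi_I)
    fix x assume "x \<in> carrier (frobenius_pushforward p e A)"
    then have x: "x \<in> carrier A" by simp
    show "?f x \<in> carrier (free_module A ?N)" using psi_in_A[OF x] bB by (auto simp: PiE_iff)
    fix y
    show "?f (x \<oplus>\<^bsub>frobenius_pushforward p e A\<^esub> y) = ?f x \<oplus>\<^bsub>free_module A ?N\<^esub> ?f y"
      by (auto simp: psi_add fun_eq_iff)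
  next
    fix a x assume a: "a \<in> carrier A"
    show "?f (a \<odot>\<^bsub>frobenius_pushforward p e A\<^esub> x) = a \<odot>\<^bsub>free_module A ?N\<^esub> ?f x"
      using psi_mult[OF bB(2,3) InA_supp[OF carrier_AD(2)[OF a]]] by (auto simp: fun_eq_iff)
  qed
  have "y \<in> ?f ` carrier A" if y: "y \<in> {..<?N} \<rightarrow>\<^sub>E carrier A" for y
  proof -
    have yA: "y l \<in> carrier A" if "l < ?N" for l using PiE_mem[OF y, of l] that by simp
    define x where "x = (\<Sum>l<?N. y l ^ ?q * bmon (b l))"
    have "InA x" unfolding x_def
      using yA bB carrier_AD(2) by (intro InA_sum InA_mult InA_power InR_imp_InA[OF InR_bmon]) auto
    moreover have "psi e (b m) x = y m" if m: "m < ?N" for m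
    proof -
      have "psi e (b m) x = red (\<Sum>l<?N. psi e (b m) (y l ^ ?q * bmon (b l)))"
        unfolding x_def by (rule psi_sum) simp
      also have "\<dots> = red (\<Sum>l<?N. if l = m then y l else 0)"
      proof (rule arg_cong[of _ _ red], rule sum.cong[OF refl])
        fix l assume "l \<in> {..<?N}"
        then have l: "l < ?N" by simp
        have "psi e (b m) (y l ^ ?q * bmon (b l)) = red (y l * psi e (b m) (bmon (b l)))"
          by (rule psi_mult[OF bB(2,3)[OF m] InA_supp[OF carrier_AD(2)[OF yA[OF l]]]])
        also have "\<dots> = (if l = m then y l else 0)"
          using psi_bmon[OF bB(2,3)[OF m] bB(2,3)[OF l]] b_inj[OF m l] carrier_AD(1)[OF yA[OF l]] by auto
        finally show "psi e (b m) (y l ^ ?q * bmon (b l)) = (if l = m then y l else 0)" .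
      qed
      also have "\<dots> = y m" using m carrier_AD(1)[OF yA[OF m]] by simp
      finally show ?thesis .
    qed
    then have "?f (red x) = y" using y by (auto simp: fun_eq_iff PiE_def extensional_def)
    ultimately show ?thesis using carrier_AI by (metis imageI)
  qed
  then have "carrier (free_module A ?N) \<subseteq> ?f ` carrier (frobenius_pushforward p e A)"
    unfolding frobenius_pushforward_simps free_module_simps by blast
  moreover have "?f ` carrier (frobenius_pushforward p e A) \<subseteq> carrier (free_module A ?N)"
    using hom unfolding module_hom_def by blast
  ultimately have "?f ` carrier (frobenius_pushforward p e A) = carrier (free_module A ?N)" by blast
  with hom show ?thesis by blast
qed

text \<open>By \<open>FL_in_mm\<close> the constant terms of the \<open>N\<close> components depend
  only on the truncation to \<open>Bq\<close>. By surjectivity all \<open>p ^ N\<close> vectors of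
  constant terms occur, and there are at most \<open>p ^ card (Bq (p ^ e))\<close>
  truncations.\<close>

lemma free_quotient_le:
  assumes f: "f \<in> module_hom A (frobenius_pushforward p e A) (free_module A N)"
    and surj: "f ` carrier (frobenius_pushforward p e A) = carrier (free_module A N)"
  shows "N \<le> card (Bq (p ^ e))"
proof -
  let ?V = "Sg - Vq (p ^ e)"
  let ?t = "trunc ?V"
  have finV: "finite ?V" using finite_Bq Bq_eq by metis
  have fA: "f x \<in> {..<N} \<rightarrow>\<^sub>E carrier A" if "x \<in> carrier A" for x
    using f that unfolding module_hom_def by auto
  have FL: "FL e (\<lambda>x. f x l)" if l: "l < N" for l unfolding FL_def
  proof (intro conjI ballI Pi_I)
    fix x assume x: "x \<in> carrier A"
    show "f x l \<in> carrier A" using PiE_mem[OF fA[OF x], of l] l by simp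
    fix y assume y: "y \<in> carrier A"
    have "f (x \<oplus>\<^bsub>A\<^esub> y) = f x \<oplus>\<^bsub>free_module A N\<^esub> f y" using f x y unfolding module_hom_def by auto
    then show "f (red (x + y)) l = red (f x l + f y l)" using l by simp
  next
    fix a x assume ax: "a \<in> carrier A" "x \<in> carrier A"
    have "f (a \<odot>\<^bsub>frobenius_pushforward p e A\<^esub> x) = a \<odot>\<^bsub>free_module A N\<^esub> f x"
      using f ax unfolding module_hom_def frobenius_pushforward_simps(1) by blast
    then show "f (red (a ^ (p ^ e) * x)) l = red (a * f x l)" using l by simp
  qed
  define r where "r x = (\<lambda>l\<in>{..<N}. cf (f x l) 0 0)" for x
  have r_eq: "r x = r y" if xy: "x \<in> carrier A" "y \<in> carrier A" "?t x = ?t y" for x y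
  proof (rule ext)
    fix l
    show "r x l = r y l"
    proof (cases "l < N")
      case True
      note F = FL[OF True]
      have FA: "f z l \<in> carrier A" if "z \<in> carrier A" for z using F that by (auto simp: FL_def)
      have dJ: "red (x - y) \<in> J (Vq (p ^ e))" by (rule trunc_eq_imp[OF xy])
      then have dA: "red (x - y) \<in> carrier A" by (simp add: J_def)
      have "f (red (red (x - y) + y)) l = red (f (red (x - y)) l + f y l)"
        using F dA xy(2) unfolding FL_def by blast
      then have "f x l = red (f (red (x - y)) l + f y l)" using carrier_AD(1)[OF xy(1)] by simp
      then have "cf (f x l) 0 0 = (cf (f (red (x - y)) l) 0 0 + cf (f y l) 0 0) mod int p"
        by (metis cf_red cf_add)
      moreover have "int p dvd cf (f (red (x - y)) l) 0 0"
        using FL_in_mm[OF F dJ] by (simp add: mm_iff supp_def)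
      ultimately have "cf (f x l) 0 0 = cf (f y l) 0 0 mod int p"
        by (metis add_0 dvd_imp_mod_0 mod_add_left_eq)
      also have "\<dots> = cf (f y l) 0 0" using cf_red[of "f y l" 0 0] carrier_AD(1)[OF FA[OF xy(2)]] by simp
      finally show ?thesis using True by (simp add: r_def)
    qed (simp add: r_def)
  qed
  have "{..<N} \<rightarrow>\<^sub>E {0..<int p} \<subseteq> r ` carrier A"
  proof
    fix c assume c: "c \<in> {..<N} \<rightarrow>\<^sub>E {0..<int p}"
    define y where "y = (\<lambda>l\<in>{..<N}. red (of_int (c l)))"
    have "y \<in> {..<N} \<rightarrow>\<^sub>E carrier A" unfolding y_def by (auto intro: carrier_AI)
    then have "y \<in> f ` carrier A" using surj by simp
    then obtain x where x: "y = f x" "x \<in> carrier A" by (rule imageE)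
    have cf_int: "cf (of_int k) 0 0 = k" for k using cf_of_int_mult[of k 1 0 0] by (simp add: cf_one)
    have "r x l = c l" for l
    proof (cases "l < N")
      case True
      then have "r x l = c l mod int p" by (simp add: r_def y_def cf_red cf_int flip: x(1))
      then show ?thesis using PiE_mem[OF c, of l] True by simp
    next
      case False
      then show ?thesis using PiE_arb[OF c, of l] by (simp add: r_def)
    qed
    then show "c \<in> r ` carrier A" using x(2) by (intro image_eqI[of _ _ x]) auto
  qed
  also have "r ` carrier A \<subseteq> (\<lambda>u. r (inv_into (carrier A) (?t) u)) ` (?t ` carrier A)"
  proof (rule image_subsetI)
    fix x assume x: "x \<in> carrier A"
    let ?u = "inv_into (carrier A) (?t) (?t x)"
    have "?t x \<in> ?t ` carrier A" using x by blast
    then have "?u \<in> carrier A" "?t ?u = ?t x" by (auto intro: inv_into_into f_inv_into_f)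
    then have "r x = r ?u" using r_eq x by metis
    then show "r x \<in> (\<lambda>u. r (inv_into (carrier A) (?t) u)) ` (?t ` carrier A)" using x by blast
  qed
  finally have sub: "{..<N} \<rightarrow>\<^sub>E {0..<int p} \<subseteq> (\<lambda>u. r (inv_into (carrier A) (?t) u)) ` (?t ` carrier A)" .
  have subV: "?t ` carrier A \<subseteq> ?V \<rightarrow>\<^sub>E {0..<int p}" by (rule image_subsetI, rule trunc_in_PiE)
  have finP: "finite (?V \<rightarrow>\<^sub>E {0..<int p})" using finV by (intro finite_PiE) auto
  have finT: "finite (?t ` carrier A)" by (rule finite_subset[OF subV finP])
  have "p ^ N = card ({..<N} \<rightarrow>\<^sub>E {0..<int p})" by (simp add: card_PiE)
  also have "\<dots> \<le> card (?t ` carrier A)" by (rule surj_card_le[OF finT sub])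
  also have "\<dots> \<le> p ^ card ?V"
    unfolding card_trunc_range[OF finV, symmetric] by (rule card_mono[OF finP subV])
  finally show ?thesis unfolding Bq_eq by (rule power_le_imp_le_exp[OF p_gt_1])
qed

lemma free_rank_A: "free_rank A (frobenius_pushforward p e A) = card (Bq (p ^ e))"
  unfolding free_rank_def
  by (rule Greatest_equality) (use free_quotient_exists free_quotient_le in blast)+

end

subsection \<open>Counting lattice points\<close>

lemma card_multiples:
  assumes "n > 0"
  shows "card {k. k < M \<and> n dvd k} = (M + n - 1) div n"
proof -
  have "l < (M + n - 1) div n \<longleftrightarrow> n * l < M" for l
  proof -
    have "Suc l \<le> (M + n - 1) div n \<longleftrightarrow> Suc l * n \<le> M + n - 1"
      by (rule less_eq_div_iff_mult_less_eq[OF assms])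
    also have "\<dots> \<longleftrightarrow> n * l < M" using assms by (auto simp: mult.commute)
    finally show ?thesis by (simp add: Suc_le_eq)
  qed
  then have "{k. k < M \<and> n dvd k} = (\<lambda>l. n * l) ` {..<(M + n - 1) div n}" by (auto simp: dvd_def)
  then show ?thesis using assms by (simp add: card_image inj_on_def)
qed

text \<open>A shift by \<open>t\<close> makes the count a difference of two integer quotients; their
  rounding errors lie in [0, 1), so they differ by at most 1.\<close>

lemma card_multiples_interval:
  assumes n: "n > 0"
  shows "\<bar>real (card {i \<in> {m..<m + q}. n dvd i + t}) - real q / real n\<bar> \<le> 1"
proof -
  let ?M = "m + t" and ?I = "{i \<in> {m..<m + q}. n dvd i + t}"
  let ?L = "{k. k < m + t + q \<and> n dvd k}" and ?K = "{k. k < m + t \<and> n dvd k}"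
  have "(\<lambda>i. i + t) ` ?I = ?L - ?K"
  proof (intro equalityI subsetI)
    fix k assume k: "k \<in> ?L - ?K"
    then show "k \<in> (\<lambda>i. i + t) ` ?I" by (intro image_eqI[of _ _ "k - t"]) auto
  qed auto
  then have "card ?I = card (?L - ?K)"
    by (metis (no_types, lifting) card_image inj_on_def add_right_cancel)
  also have "\<dots> = card ?L - card ?K" by (intro card_Diff_subset) auto
  also have "\<dots> = (?M + q + n - 1) div n - (?M + n - 1) div n" by (simp only: card_multiples[OF n])
  finally have eq: "card ?I = (?M + q + n - 1) div n - (?M + n - 1) div n" .
  have le: "(?M + n - 1) div n \<le> (?M + q + n - 1) div n" by (intro div_le_mono) simp
  have div: "real (a div n) \<le> real a / real n" "real a / real n < real (a div n) + 1" for a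
    using floor_divide_of_nat_eq[of a n, where ?'a = real] by linarith+
  have "real (?M + q + n - 1) = real (?M + n - 1) + real q" using n by (simp add: of_nat_diff)
  then have "real (?M + q + n - 1) / real n = real (?M + n - 1) / real n + real q / real n"
    by (simp add: add_divide_distrib)
  then show ?thesis
    unfolding eq of_nat_diff[OF le] using div[of "?M + q + n - 1"] div[of "?M + n - 1"] by linarith
qed

section \<open>Lattice points of the semigroup in squares, and the two limits\<close>

context toric
begin

definition cell :: "nat \<Rightarrow> nat \<times> nat \<Rightarrow> (nat \<times> nat) set" where
  "cell q d = {(i, j) \<in> Sg. i div q = fst d \<and> j div q = snd d}"

lemma mem_cell: "(i, j) \<in> cell q d \<longleftrightarrow> (i, j) \<in> Sg \<and> (i div q, j div q) = d"
  by (cases d) (simp add: cell_def)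

lemma cell_eq:
  assumes "q > 0"
  shows "cell q (a, b) = (\<lambda>(j, i). (i, j)) ` (SIGMA j:{q * b..<q * b + q}. {i \<in> {q * a..<q * a + q}. n dvd i + w * j})"
proof -
  have *: "i div q = a \<longleftrightarrow> q * a \<le> i \<and> i < q * a + q" for i a
    using assms by (metis div_nat_eqI div_times_less_eq_dividend dividend_less_times_div mult.commute
        mult_Suc_right add.commute)
  show ?thesis by (auto simp: cell_def Sg_def *)
qed

lemma finite_cell: "q > 0 \<Longrightarrow> finite (cell q d)" by (cases d) (simp add: cell_eq)

text \<open>Each row of a \<open>q\<close> by \<open>q\<close> square meets the semigroup in one
  residue class modulo \<open>n\<close>, hence in \<open>q / n\<close> points up to an error of 1.
  The \<open>q\<close> rows together err by at most \<open>q\<close>, which is negligible against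
  \<open>q ^ 2\<close>.\<close>

lemma card_cell:
  assumes "q > 0"
  shows "\<bar>real (card (cell q d)) - real q ^ 2 / real n\<bar> \<le> real q"
proof -
  obtain a b where d: "d = (a, b)" by fastforce
  let ?I = "\<lambda>j. {i \<in> {q * a..<q * a + q}. n dvd i + w * j}"
  have "card (cell q d) = (\<Sum>j\<in>{q * b..<q * b + q}. card (?I j))"
    unfolding d cell_eq[OF assms] by (subst card_image) (auto simp: inj_on_def)
  then have eq: "real (card (cell q d)) - real q ^ 2 / real n = (\<Sum>j\<in>{q * b..<q * b + q}. real (card (?I j)) - real q / real n)"
    by (simp add: sum_subtractf power2_eq_square)
  have "\<bar>real (card (cell q d)) - real q ^ 2 / real n\<bar> \<le> (\<Sum>j\<in>{q * b..<q * b + q}. \<bar>real (card (?I j)) - real q / real n\<bar>)"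
    unfolding eq by (rule sum_abs)
  also have "\<dots> \<le> (\<Sum>j\<in>{q * b..<q * b + q}. 1)"
    using n by (intro sum_mono card_multiples_interval) simp
  finally show ?thesis by simp
qed

text \<open>\<open>D\<close> consists of the exponents outside the ideal of \<open>F\<^sub>p[u, v]\<close> generated by the nonconstant
  monomials of the algebra.\<close>

definition D :: "(nat \<times> nat) set" where
  "D = {(a, b). \<forall>i\<le>a. \<forall>j\<le>b. (i, j) \<in> Sg \<longrightarrow> (i, j) = (0, 0)}"

lemma D_iff: "(a, b) \<in> D \<longleftrightarrow> \<not> (\<exists>i\<le>a. \<exists>j\<le>b. (i, j) \<in> Sg \<and> (i, j) \<noteq> (0, 0))"
  unfolding D_def mem_Collect_eq case_prod_conv by meson

lemma D_subset: "D \<subseteq> {..<n} \<times> {..<n}"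
proof (clarsimp simp: D_def)
  fix a b assume *: "\<forall>i\<le>a. \<forall>j\<le>b. (i, j) \<in> Sg \<longrightarrow> i = 0 \<and> j = 0"
  show "a < n \<and> b < n"
    using *[rule_format, of n 0] *[rule_format, of 0 n] Sg_n[of 1 0] Sg_n[of 0 1] n by force
qed

lemma finite_D: "finite D" by (rule finite_subset[OF D_subset]) simp

text \<open>An exponent dominates \<open>q\<close> times \<open>(a, b)\<close> exactly if its
  quotient by \<open>q\<close> dominates \<open>(a, b)\<close>. Within \<open>Sg\<close>, membership
  in \<open>Uq q\<close> thus depends only on the square that contains the exponent, and the squares
  left over are those indexed by \<open>D\<close>.\<close>

lemma complement_Uq:
  assumes "q > 0"
  shows "Sg - Uq q = (\<Union>d\<in>D. cell q d)"
proof -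
  have *: "q * a \<le> i \<longleftrightarrow> a \<le> i div q" for a i
    using less_eq_div_iff_mult_less_eq[OF assms, of a i] by (simp add: mult.commute)
  have Uq: "(i, j) \<in> Uq q \<longleftrightarrow> (i, j) \<in> Sg \<and>
      (\<exists>a\<le>i div q. \<exists>b\<le>j div q. (a, b) \<in> Sg \<and> (a, b) \<noteq> (0, 0))" for i j
    unfolding Uq_def mem_Collect_eq case_prod_conv * by blast
  have cells: "(i, j) \<in> (\<Union>d\<in>D. cell q d) \<longleftrightarrow> (i, j) \<in> Sg \<and> (i div q, j div q) \<in> D" for i j
    unfolding UN_iff mem_cell by blast
  have taut: "P \<and> \<not> (P \<and> Q) \<longleftrightarrow> P \<and> \<not> Q" for P Q by blast
  have mem: "(i, j) \<in> Sg - Uq q \<longleftrightarrow> (i, j) \<in> (\<Union>d\<in>D. cell q d)" for i j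
    unfolding cells Diff_iff Uq D_iff by (rule taut)
  show ?thesis
  proof (rule Set.set_eqI)
    show "t \<in> Sg - Uq q \<longleftrightarrow> t \<in> (\<Union>d\<in>D. cell q d)" for t
      using mem[of "fst t" "snd t"] by (simp only: prod.collapse)
  qed
qed

lemma card_complement_Uq:
  assumes "q > 0"
  shows "\<bar>real (card (Sg - Uq q)) - real (card D) * real q ^ 2 / real n\<bar> \<le> real (card D) * real q"
proof -
  have "card (Sg - Uq q) = (\<Sum>d\<in>D. card (cell q d))" unfolding complement_Uq[OF assms]
    by (rule card_UN_disjoint[OF finite_D]) (auto simp: finite_cell[OF assms], auto simp: cell_def)
  then have eq: "real (card (Sg - Uq q)) - real (card D) * real q ^ 2 / real n =
      (\<Sum>d\<in>D. real (card (cell q d)) - real q ^ 2 / real n)"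
    by (simp add: sum_subtractf)
  have "\<bar>real (card (Sg - Uq q)) - real (card D) * real q ^ 2 / real n\<bar> \<le> (\<Sum>d\<in>D. \<bar>real (card (cell q d)) - real q ^ 2 / real n\<bar>)"
    unfolding eq by (rule sum_abs)
  also have "\<dots> \<le> (\<Sum>d\<in>D. real q)" by (intro sum_mono card_cell assms)
  finally show ?thesis by simp
qed

lemma finite_complement_Uq: "q > 0 \<Longrightarrow> finite (Sg - Uq q)"
  using complement_Uq finite_D finite_cell by simp

lemma Bq_eq_cell: "q > 0 \<Longrightarrow> Bq q = cell q (0, 0)" by (auto simp: Bq_def cell_def div_eq_0_iff)

lemma lim_normalized_count:
  assumes "\<And>q. q > 0 \<Longrightarrow> \<bar>real (c q) - K * real q ^ 2 / real n\<bar> \<le> K * real q"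
  shows "lim (\<lambda>e. real (c (p ^ e)) / real p ^ (e * 2)) = K / real n"
proof (rule limI)
  have p1: "real p > 1" using p_gt_1 by simp
  have bound: "norm (real (c (p ^ e)) / real p ^ (e * 2) - K / real n) \<le> K * (1 / real p) ^ e" for e
  proof -
    have "real (p ^ e) > 0" using p_gt_0 by simp
    have "real (c (p ^ e)) / real p ^ (e * 2) - K / real n =
        (real (c (p ^ e)) - K * real (p ^ e) ^ 2 / real n) / real (p ^ e) ^ 2"
      using p_gt_0 n by (simp add: power_mult field_simps)
    also have "norm \<dots> \<le> K * real (p ^ e) / real (p ^ e) ^ 2"
      using assms[of "p ^ e"] p_gt_0 by (simp add: divide_right_mono)
    also have "\<dots> = K * (1 / real p) ^ e"
      using p_gt_0 by (simp add: power2_eq_square power_divide field_simps)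
    finally show ?thesis .
  qed
  have "(\<lambda>e. K * (1 / real p) ^ e) \<longlonglongrightarrow> K * 0"
    using p1 by (intro tendsto_mult tendsto_const LIMSEQ_realpow_zero) auto
  then have "(\<lambda>e. K * (1 / real p) ^ e) \<longlonglongrightarrow> 0" by simp
  then have "(\<lambda>e. real (c (p ^ e)) / real p ^ (e * 2) - K / real n) \<longlonglongrightarrow> 0"
  proof (rule tendsto_0_le[where K = 1], intro always_eventually allI)
    fix e
    show "norm (real (c (p ^ e)) / real p ^ (e * 2) - K / real n) \<le> norm (K * (1 / real p) ^ e) * 1"
      unfolding mult_1_right real_norm_def[of "K * (1 / real p) ^ e"]
      by (rule order_trans[OF bound abs_ge_self])
  qed
  then show "(\<lambda>e. real (c (p ^ e)) / real p ^ (e * 2)) \<longlonglongrightarrow> K / real n" by (simp add: LIM_zero_iff)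
qed

lemma HK_multiplicity_A: "HK_multiplicity p A = real (card D) / real n"
proof -
  have "module_length A (quotient_module A (frobenius_power p e A (max_ideal A))) = enat (card (Sg - Uq (p ^ e)))" for e
    unfolding max_ideal_A frobenius_power_mm
    using p_gt_0 by (intro length_A_mod_J finite_complement_Uq Sg_ideal_Uq) simp
  then show ?thesis
    using lim_normalized_count[of "\<lambda>q. card (Sg - Uq q)" "real (card D)"] card_complement_Uq
    by (simp add: HK_multiplicity_def krull_dim_A numeral_eq_enat)
qed

lemma normalized_free_rank:
  "lim (\<lambda>e. real (free_rank A (frobenius_pushforward p e A)) / real p ^ (e * 2)) = 1 / real n"
proof -
  have "\<bar>real (card (Bq q)) - 1 * real q ^ 2 / real n\<bar> \<le> 1 * real q" if "q > 0" for q
    using card_cell[OF that, of "(0, 0)"] by (simp add: Bq_eq_cell[OF that])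
  from lim_normalized_count[OF this] show ?thesis by (simp add: free_rank_A)
qed

text \<open>The residue field is the prime field, on which Frobenius is the identity; this makes the
  exponent \<alpha> in the F-signature zero.\<close>

lemma A_power_p: "x \<in> carrier A \<Longrightarrow> x [^]\<^bsub>A\<^esub> p \<ominus>\<^bsub>A\<^esub> x \<in> mm"
proof -
  assume x: "x \<in> carrier A"
  have "int p dvd cf (x ^ p - x) 0 0" using cf_power_prime[OF p, of x 0 0] by simp
  then have "(0, 0) \<notin> supp (x ^ p - x)" by (simp add: supp_def)
  moreover have "x [^]\<^bsub>A\<^esub> p \<ominus>\<^bsub>A\<^esub> x = red (x ^ p - x)" using x by (simp add: a_minus_def A_minus)
  moreover have "x [^]\<^bsub>A\<^esub> p \<ominus>\<^bsub>A\<^esub> x \<in> carrier A" using x by (intro A.minus_closed A.nat_pow_closed)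
  ultimately show ?thesis by (simp add: mm_iff)
qed

end

section \<open>Invariance under ring isomorphisms\<close>

text \<open>The local rings of the product are isomorphic to the rings \<open>A\<close> but live on
  another type, so the invariants have to be transported. One inequality or inclusion suffices each
  time, since the inverse map is an instance of the same locale.\<close>

locale iso_rings = R: cring R + S: cring S for R :: "('a, 'r) ring_scheme" (structure) and S :: "('b, 's) ring_scheme" +
  fixes h
  assumes h: "h \<in> ring_iso R S"
begin

lemma hom: "h \<in> ring_hom R S" and bij: "bij_betw h (carrier R) (carrier S)"
  using h by (auto simp: ring_iso_def)

lemma closed [simp]: "x \<in> carrier R \<Longrightarrow> h x \<in> carrier S"
  and add [simp]: "x \<in> carrier R \<Longrightarrow> y \<in> carrier R \<Longrightarrow> h (x \<oplus> y) = h x \<oplus>\<^bsub>S\<^esub> h y"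
  and mult [simp]: "x \<in> carrier R \<Longrightarrow> y \<in> carrier R \<Longrightarrow> h (x \<otimes> y) = h x \<otimes>\<^bsub>S\<^esub> h y"
  and one [simp]: "h \<one> = \<one>\<^bsub>S\<^esub>"
  using ring_hom_closed[OF hom] ring_hom_add[OF hom] ring_hom_mult[OF hom] ring_hom_one[OF hom] by auto

lemma zero [simp]: "h \<zero> = \<zero>\<^bsub>S\<^esub>" by (rule ring_hom_zero[OF hom R.ring_axioms S.ring_axioms])

lemma inj: "inj_on h (carrier R)" and image_carrier: "h ` carrier R = carrier S"
  using bij by (auto simp: bij_betw_def)

abbreviation g :: "'b \<Rightarrow> 'a" where "g \<equiv> inv_into (carrier R) h"

lemma inv_iso: "g \<in> ring_iso S R" by (rule ring_iso_set_sym[OF R.ring_axioms h])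

lemma converse: "iso_rings S R (g)" by unfold_locales (rule inv_iso)

lemma image_inv_image: "K \<subseteq> carrier S \<Longrightarrow> h ` g ` K = K"
  by (rule image_inv_into_cancel[OF image_carrier])

lemma inv_image_image: "I \<subseteq> carrier R \<Longrightarrow> g ` h ` I = I" using inv_into_image_cancel[OF inj] by blast

lemma pow [simp]: "x \<in> carrier R \<Longrightarrow> h (x [^] (k::nat)) = h x [^]\<^bsub>S\<^esub> k" by (induction k) simp_all

lemma minus [simp]: "x \<in> carrier R \<Longrightarrow> h (\<ominus> x) = \<ominus>\<^bsub>S\<^esub> h x"
  using ring_hom_cring.hom_a_inv[OF ring_hom_cringI[OF R.is_cring S.is_cring hom]] by blast

lemma image_ideal:
  assumes "ideal I R"
  shows "ideal (h ` I) S"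
proof -
  interpret I: ideal I R by fact
  have sub: "I \<subseteq> carrier R" by (rule I.a_subset)
  show ?thesis
  proof (rule S.ideal_if_closed)
    show "h ` I \<subseteq> carrier S" using sub closed by blast
    show "\<zero>\<^bsub>S\<^esub> \<in> h ` I" using I.zero_closed zero by (metis imageI)
  next
    fix x y assume "x \<in> h ` I" "y \<in> h ` I"
    then obtain u v where uv: "u \<in> I" "v \<in> I" "x = h u" "y = h v" by blast
    then have "x \<oplus>\<^bsub>S\<^esub> y = h (u \<oplus> v)" using subsetD[OF sub] by simp
    moreover have "u \<oplus> v \<in> I" using uv(1,2) by (rule I.a_closed)
    ultimately show "x \<oplus>\<^bsub>S\<^esub> y \<in> h ` I" by blast
  next
    fix a x assume "a \<in> carrier S" "x \<in> h ` I"
    then obtain u v where uv: "u \<in> carrier R" "v \<in> I" "a = h u" "x = h v" using image_carrier by blast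
    then have "a \<otimes>\<^bsub>S\<^esub> x = h (u \<otimes> v)" using subsetD[OF sub] by simp
    moreover have "u \<otimes> v \<in> I" using uv(2,1) by (rule I.I_l_closed)
    ultimately show "a \<otimes>\<^bsub>S\<^esub> x \<in> h ` I" by blast
  qed
qed

lemma image_psubset:
  assumes "I \<subseteq> carrier R" "K \<subseteq> carrier R" "I \<subset> K"
  shows "h ` I \<subset> h ` K" using inj_on_image_eq_iff[OF inj assms(1,2)] assms(3) by blast

lemma image_maximal:
  assumes "maximalideal M R"
  shows "maximalideal (h ` M) S"
proof -
  interpret M: maximalideal M R by fact
  interpret C: iso_rings S R "g" by (rule converse)
  have sub: "M \<subseteq> carrier R" by (rule M.a_subset)
  show ?thesis
  proof (rule maximalidealI[OF image_ideal[OF M.ideal_axioms]])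
    show "carrier S \<noteq> h ` M"
      using image_psubset[OF sub order_refl] sub M.I_notcarr image_carrier by blast
  next
    fix K assume K: "ideal K S" "h ` M \<subseteq> K" "K \<subseteq> carrier S"
    let ?K = "g ` K"
    have "M \<subseteq> ?K" using image_mono[OF K(2), of "g"] inv_image_image[OF sub] by simp
    moreover have "?K \<subseteq> carrier R" using K(3) C.closed by blast
    ultimately have "?K = M \<or> ?K = carrier R" using M.I_maximal[OF C.image_ideal[OF K(1)]] by blast
    then show "K = h ` M \<or> K = carrier S" using image_inv_image[OF K(3)] image_carrier by metis
  qed
qed

lemma image_prime:
  assumes "primeideal P R"
  shows "primeideal (h ` P) S"
proof -
  interpret P: primeideal P R by fact
  have sub: "P \<subseteq> carrier R" by (rule P.a_subset)
  show ?thesis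
  proof (rule primeidealI[OF image_ideal[OF P.ideal_axioms] S.is_cring])
    show "carrier S \<noteq> h ` P"
      using image_psubset[OF sub order_refl] sub P.I_notcarr image_carrier by blast
  next
    fix a b assume ab: "a \<in> carrier S" "b \<in> carrier S" "a \<otimes>\<^bsub>S\<^esub> b \<in> h ` P"
    obtain u where u: "u \<in> carrier R" "a = h u" using ab(1) image_carrier by blast
    obtain v where v: "v \<in> carrier R" "b = h v" using ab(2) image_carrier by blast
    have "h (u \<otimes> v) \<in> h ` P" using ab(3) u v by simp
    then have "u \<otimes> v \<in> P" using inj_on_image_mem_iff[OF inj _ sub] u(1) v(1) by blast
    then have "u \<in> P \<or> v \<in> P" using P.I_prime u(1) v(1) by blast
    then show "a \<in> h ` P \<or> b \<in> h ` P" using u(2) v(2) by blast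
  qed
qed

section \<open>Transport of dimension, lengths, Frobenius powers and free ranks\<close>

lemma krull_dim_le: "krull_dim R \<le> krull_dim S" unfolding krull_dim_def
proof (rule chain_length_mono[of "(`) h"])
  show "(`) h ` {P. primeideal P R} \<subseteq> {P. primeideal P S}" using image_prime by blast
  fix X Y assume XY: "X \<in> {P. primeideal P R}" "Y \<in> {P. primeideal P R}" "X \<subset> Y"
  have "Y \<subseteq> carrier R"
    using XY(2) primeideal.axioms(1) ideal.axioms(1) additive_subgroup.a_subset by blast
  then show "h ` X \<subset> h ` Y" using XY(3) by (intro image_psubset) auto
qed

lemma chain_length_ideals_le:
  "chain_length (ideals_above R I) \<le> chain_length (ideals_above S (h ` I))"
proof (rule chain_length_mono[of "(`) h"])
  show "(`) h ` ideals_above R I \<subseteq> ideals_above S (h ` I)" using image_ideal by blast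
  fix X Y assume XY: "X \<in> ideals_above R I" "Y \<in> ideals_above R I" "X \<subset> Y"
  have "Y \<subseteq> carrier R" using XY(2) ideal.axioms(1) additive_subgroup.a_subset by blast
  then show "h ` X \<subset> h ` Y" using XY(3) by (intro image_psubset) auto
qed

lemma frobenius_power_subset:
  assumes "I \<subseteq> carrier R"
  shows "frobenius_power p e S (h ` I) \<subseteq> h ` frobenius_power p e R I"
proof -
  let ?X = "(\<lambda>x. x [^] (p ^ e)) ` I"
  have sub: "?X \<subseteq> carrier R" using assms by auto
  show ?thesis unfolding frobenius_power_def
  proof (rule S.genideal_minimal[OF image_ideal[OF R.genideal_ideal[OF sub]]])
    have "h x [^]\<^bsub>S\<^esub> (p ^ e) \<in> h ` (Idl ?X)" if "x \<in> I" for x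
    proof -
      have "x [^] (p ^ e) \<in> Idl ?X" using R.genideal_self[OF sub] that by blast
      moreover have "h x [^]\<^bsub>S\<^esub> (p ^ e) = h (x [^] (p ^ e))" using that assms by auto
      ultimately show ?thesis by (metis imageI)
    qed
    then show "(\<lambda>x. x [^]\<^bsub>S\<^esub> (p ^ e)) ` h ` I \<subseteq> h ` (Idl ?X)" by blast
  qed
qed

lemma free_quotient_image:
  assumes "free_quotient p e R N"
  shows "free_quotient p e S N"
proof -
  interpret C: iso_rings S R g by (rule converse)
  have hg: "h (g y) = y" if "y \<in> carrier S" for y
    using that image_carrier by (simp add: f_inv_into_f)
  have gh: "g (h x) = x" if "x \<in> carrier R" for x using that inj by simp
  obtain f where f: "f \<in> module_hom R (frobenius_pushforward p e R) (free_module R N)"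
    "f ` carrier R = {..<N} \<rightarrow>\<^sub>E carrier R" using assms by auto
  have f_add: "f (x \<oplus> y) = f x \<oplus>\<^bsub>free_module R N\<^esub> f y" if "x \<in> carrier R" "y \<in> carrier R" for x y
    using f(1) that unfolding module_hom_def frobenius_pushforward_simps by blast
  have f_smult: "f ((a [^] (p ^ e)) \<otimes> x) = a \<odot>\<^bsub>free_module R N\<^esub> f x"
    if "a \<in> carrier R" "x \<in> carrier R" for a x
    using f(1) that unfolding module_hom_def frobenius_pushforward_simps by blast
  have fR: "f x i \<in> carrier R" if "x \<in> carrier R" "i < N" for x i
    using f(2) that by (metis PiE_mem imageI lessThan_iff)
  let ?f = "\<lambda>y. \<lambda>i\<in>{..<N}. h (f (g y) i)"
  have "?f \<in> module_hom S (frobenius_pushforward p e S) (free_module S N)"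
    unfolding module_hom_def frobenius_pushforward_simps
  proof (intro CollectI conjI ballI Pi_I)
    fix x assume x: "x \<in> carrier S"
    then show "?f x \<in> carrier (free_module S N)" using fR C.closed by (simp add: PiE_iff)
    fix y assume y: "y \<in> carrier S"
    show "?f (x \<oplus>\<^bsub>S\<^esub> y) = ?f x \<oplus>\<^bsub>free_module S N\<^esub> ?f y" using x y fR by (simp add: f_add fun_eq_iff)
  next
    fix a x assume ax: "a \<in> carrier S" "x \<in> carrier S"
    show "?f ((a [^]\<^bsub>S\<^esub> (p ^ e)) \<otimes>\<^bsub>S\<^esub> x) = a \<odot>\<^bsub>free_module S N\<^esub> ?f x"
      using ax fR by (simp add: f_smult hg fun_eq_iff)
  qed
  moreover have "?f ` carrier S = {..<N} \<rightarrow>\<^sub>E carrier S"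
  proof (rule equalityI)
    show "?f ` carrier S \<subseteq> {..<N} \<rightarrow>\<^sub>E carrier S" using fR C.closed by (simp add: PiE_iff image_subset_iff)
    show "{..<N} \<rightarrow>\<^sub>E carrier S \<subseteq> ?f ` carrier S"
    proof
      fix y assume y: "y \<in> {..<N} \<rightarrow>\<^sub>E carrier S"
      have yS: "y i \<in> carrier S" if "i < N" for i using PiE_mem[OF y, of i] that by simp
      define z where "z = (\<lambda>i\<in>{..<N}. g (y i))"
      have "z \<in> {..<N} \<rightarrow>\<^sub>E carrier R" using yS unfolding z_def by simp
      then have "z \<in> f ` carrier R" using f(2) by simp
      then obtain x where x: "z = f x" "x \<in> carrier R" by (rule imageE)
      have "?f (h x) i = y i" for i
      proof (cases "i < N")
        case True
        then have "?f (h x) i = h (z i)" using x gh by simp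
        then show ?thesis using True hg[OF yS[OF True]] by (simp add: z_def)
      next
        case False
        then show ?thesis using PiE_arb[OF y, of i] by simp
      qed
      then have "y = ?f (h x)" by (intro ext) simp
      then show "y \<in> ?f ` carrier S" using x(2) closed by blast
    qed
  qed
  ultimately show ?thesis by (intro bexI[of _ ?f]) simp_all
qed

lemma krull_dim_iso: "krull_dim S = krull_dim R"
  using krull_dim_le iso_rings.krull_dim_le[OF converse] by (rule antisym[rotated])

lemma chain_length_ideals_iso:
  assumes "I \<subseteq> carrier R"
  shows "chain_length (ideals_above S (h ` I)) = chain_length (ideals_above R I)"
  using chain_length_ideals_le[of I] iso_rings.chain_length_ideals_le[OF converse, of "h ` I"]
  unfolding inv_image_image[OF assms] by (rule antisym[rotated])

lemma frobenius_power_iso: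
  assumes "I \<subseteq> carrier R"
  shows "frobenius_power p e S (h ` I) = h ` frobenius_power p e R I"
proof (rule equalityI[OF frobenius_power_subset[OF assms]])
  have sub: "(\<lambda>x. x [^]\<^bsub>S\<^esub> (p ^ e)) ` h ` I \<subseteq> carrier S" using assms by auto
  then have sub': "frobenius_power p e S (h ` I) \<subseteq> carrier S" unfolding frobenius_power_def
    using S.genideal_ideal ideal.axioms(1) additive_subgroup.a_subset by blast
  have "h ` I \<subseteq> carrier S" using assms closed by blast
  from iso_rings.frobenius_power_subset[OF converse this, of p e]
  have "frobenius_power p e R I \<subseteq> g ` frobenius_power p e S (h ` I)"
    unfolding inv_image_image[OF assms] .
  then have "h ` frobenius_power p e R I \<subseteq> h ` g ` frobenius_power p e S (h ` I)"
    by (rule image_mono)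
  then show "h ` frobenius_power p e R I \<subseteq> frobenius_power p e S (h ` I)"
    unfolding image_inv_image[OF sub'] .
qed

text \<open>The definite description in \<open>max_ideal\<close> needs uniqueness, which passes to
  \<open>S\<close> because maximal ideals are carried back by the inverse map.\<close>

lemma max_ideal_iso:
  assumes M: "maximalideal M R" and uniq: "\<And>M'. maximalideal M' R \<Longrightarrow> M' = M"
  shows "max_ideal R = M" "max_ideal S = h ` M"
proof -
  show "max_ideal R = M" unfolding max_ideal_def by (rule the_equality) (fact M, fact uniq)
  have "M' = h ` M" if M': "maximalideal M' S" for M'
  proof -
    have "M' \<subseteq> carrier S"
      using M' maximalideal.axioms(1) ideal.axioms(1) additive_subgroup.a_subset by blast
    then show ?thesis
      using uniq[OF iso_rings.image_maximal[OF converse M']] image_inv_image by metis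
  qed
  then show "max_ideal S = h ` M"
    unfolding max_ideal_def using image_maximal[OF M] by (intro the_equality)
qed

lemma HK_multiplicity_iso:
  assumes M: "maximalideal M R" and uniq: "\<And>M'. maximalideal M' R \<Longrightarrow> M' = M"
  shows "HK_multiplicity p S = HK_multiplicity p R"
proof -
  have MR: "M \<subseteq> carrier R"
    using M maximalideal.axioms(1) ideal.axioms(1) additive_subgroup.a_subset by blast
  have mR: "max_ideal R = M" by (rule max_ideal_iso(1)[OF M]) (fact uniq)
  have mS: "max_ideal S = h ` M" by (rule max_ideal_iso(2)[OF M]) (fact uniq)
  have "module_length S (quotient_module S (frobenius_power p e S (max_ideal S))) =
      module_length R (quotient_module R (frobenius_power p e R (max_ideal R)))" for e
  proof -
    have sub: "(\<lambda>x. x [^] (p ^ e)) ` M \<subseteq> carrier R" using MR by auto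
    then have id: "ideal (frobenius_power p e R M) R"
      unfolding frobenius_power_def by (rule R.genideal_ideal)
    then have "frobenius_power p e R M \<subseteq> carrier R"
      using ideal.axioms(1) additive_subgroup.a_subset by blast
    then show ?thesis unfolding mR mS frobenius_power_iso[OF MR]
        R.module_length_quotient[OF id] S.module_length_quotient[OF image_ideal[OF id]]
      by (rule chain_length_ideals_iso)
  qed
  then show ?thesis unfolding HK_multiplicity_def krull_dim_iso by simp
qed

lemma free_rank_iso:
  "free_rank S (frobenius_pushforward p e S) = free_rank R (frobenius_pushforward p e R)"
proof -
  have "free_quotient p e S N \<longleftrightarrow>
    free_quotient p e R N" for N
    by (rule iffI; erule free_quotient_image iso_rings.free_quotient_image[OF converse])
  then show ?thesis unfolding free_rank_def by (simp only:)
qed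

end

lemma (in ring) Quot_carrierE:
  assumes "X \<in> carrier (R Quot I)"
  obtains x where "x \<in> carrier R" "X = I +> x"
  using assms by (auto simp: FactRing_def A_RCOSETS_def')

text \<open>The \<open>p\<close>-th powers exhaust the residue field, so its dimension over them is
  1; uniqueness of the dimension and \<open>p > 1\<close> leave only \<alpha> = 0.\<close>

lemma (in cring) frobenius_exponent_0:
  assumes M: "maximalideal M R" and p: "p > 1"
    and pow: "\<And>x. x \<in> carrier R \<Longrightarrow> x [^] p \<ominus> x \<in> M"
  shows "frobenius_exponent p (R Quot M) = 0"
proof -
  interpret M: maximalideal M R by (rule M)
  let ?k = "R Quot M"
  interpret k: field ?k by (rule M.quotient_is_field[OF is_cring])
  interpret H: ring_hom_ring R ?k "(+>) M" by (rule M.rcos_ring_hom_ring)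
  have "X [^]\<^bsub>?k\<^esub> p = X" if X: "X \<in> carrier ?k" for X
  proof -
    obtain x where x: "x \<in> carrier R" "X = M +> x" using X by (rule Quot_carrierE)
    have "X [^]\<^bsub>?k\<^esub> p = M +> (x [^] p)" unfolding x(2) using x(1) by (simp add: H.hom_nat_pow)
    also have "\<dots> = X"
      unfolding x(2) using quotient_eq_iff_same_a_r_cos[OF M.ideal_axioms, of "x [^] p" x] pow x(1) by simp
    finally show ?thesis .
  qed
  then have img: "(\<lambda>x. x [^]\<^bsub>?k\<^esub> p) ` carrier ?k = carrier ?k" by force
  have sf: "subfield (carrier ?k) ?k" by (rule k.carrier_is_subfield)
  have one: "k.dimension 1 (carrier ?k) (carrier ?k)" by (rule k.dimension_one[OF sf])
  show ?thesis unfolding frobenius_exponent_def img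
  proof (rule the_equality)
    show "k.dimension (p ^ 0) (carrier ?k) (carrier ?k)" using one by simp
    fix \<alpha> assume "k.dimension (p ^ \<alpha>) (carrier ?k) (carrier ?k)"
    then have "p ^ \<alpha> = 1" using k.dimension_is_inj[OF sf _ one] by blast
    then show "\<alpha> = 0" using p by simp
  qed
qed

lemma (in iso_rings) F_signature_iso:
  assumes M: "maximalideal M R" and uniq: "\<And>M'. maximalideal M' R \<Longrightarrow> M' = M" and p: "p > 1"
    and pow: "\<And>x. x \<in> carrier R \<Longrightarrow> x [^] p \<ominus> x \<in> M"
  shows "F_signature p S =
    lim (\<lambda>e. real (free_rank R (frobenius_pushforward p e R)) / real p ^ (e * the_enat (krull_dim R)))"
proof -
  have exp0: "frobenius_exponent p (S Quot (h ` M)) = 0"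
  proof (rule S.frobenius_exponent_0[OF image_maximal[OF M] p])
    fix y assume "y \<in> carrier S"
    then obtain x where x: "x \<in> carrier R" "y = h x" using image_carrier by blast
    have "h (x [^] p \<ominus> x) = y [^]\<^bsub>S\<^esub> p \<ominus>\<^bsub>S\<^esub> y" using x by (simp add: a_minus_def)
    then show "y [^]\<^bsub>S\<^esub> p \<ominus>\<^bsub>S\<^esub> y \<in> h ` M" using pow[OF x(1)] by (metis imageI)
  qed
  have mS: "max_ideal S = h ` M" by (rule max_ideal_iso(2)[OF M]) (fact uniq)
  show ?thesis using exp0 unfolding F_signature_def residue_field_def mS krull_dim_iso free_rank_iso
    by simp
qed

section \<open>Factors of a product of rings\<close>

text \<open>\<open>R \<rightarrow> S\<close> is the projection of a product onto one factor; \<open>\<epsilon>\<close> is the idempotent of that factor.\<close>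

locale ring_factor = R: cring R + S: cring S for R :: "('a, 'r) ring_scheme" (structure) and S :: "('b, 's) ring_scheme" +
  fixes \<pi> \<epsilon>
  assumes hom: "\<pi> \<in> ring_hom R S" and surj: "\<pi> ` carrier R = carrier S"
    and e: "\<epsilon> \<in> carrier R" "\<pi> \<epsilon> = \<one>\<^bsub>S\<^esub>"
    and e_eq: "\<And>x y. x \<in> carrier R \<Longrightarrow> y \<in> carrier R \<Longrightarrow> \<pi> x = \<pi> y \<Longrightarrow> \<epsilon> \<otimes> x = \<epsilon> \<otimes> y"
begin

sublocale ring_hom_cring R S \<pi> using hom by (intro ring_hom_cringI R.is_cring S.is_cring)

lemma vimage_ideal:
  assumes "ideal I S"
  shows "ideal {x \<in> carrier R. \<pi> x \<in> I} R"
proof -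
  interpret I: ideal I S by fact
  show ?thesis by (rule R.ideal_if_closed) (use I.a_closed I.zero_closed I.I_l_closed in auto)
qed

lemma vimage_prime:
  assumes "primeideal I S"
  shows "primeideal {x \<in> carrier R. \<pi> x \<in> I} R"
proof -
  let ?N = "{x \<in> carrier R. \<pi> x \<in> I}"
  interpret I: primeideal I S by fact
  show ?thesis
  proof (rule primeidealI[OF vimage_ideal[OF I.ideal_axioms] R.is_cring])
    have "\<one>\<^bsub>S\<^esub> \<notin> I" using I.one_imp_carrier I.I_notcarr by blast
    then have "\<one> \<notin> ?N" by simp
    then show "carrier R \<noteq> ?N" using R.one_closed by blast
    fix a b assume "a \<in> carrier R" "b \<in> carrier R" "a \<otimes> b \<in> ?N"
    then show "a \<in> ?N \<or> b \<in> ?N" using I.I_prime[of "\<pi> a" "\<pi> b"] by simp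
  qed
qed

text \<open>A prime inside the kernel omits the idempotent \<open>\<epsilon>\<close>, whose image is
  1, but contains its product with any element of the kernel, which is zero. Consequently, in a
  product of two domains an element outside all minimal primes has no zero component.\<close>

lemma kernel_minimal_prime:
  assumes "domain S"
  shows "minimal_prime {x \<in> carrier R. \<pi> x = \<zero>\<^bsub>S\<^esub>} R"
proof -
  let ?P = "{x \<in> carrier R. \<pi> x = \<zero>\<^bsub>S\<^esub>}"
  have prime: "primeideal ?P R" using vimage_prime[OF domain.zeroprimeideal[OF assms]] by simp
  have "Q = ?P"
    if Q: "primeideal Q R" "Q \<subseteq> ?P" for Q
  proof
    interpret Q: primeideal Q R by (rule Q(1))
    have "\<one>\<^bsub>S\<^esub> \<noteq> \<zero>\<^bsub>S\<^esub>" by (rule domain.one_not_zero[OF assms])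
    then have eQ: "\<epsilon> \<notin> Q" using Q(2) e by auto
    show "?P \<subseteq> Q"
    proof
      fix x assume x: "x \<in> ?P"
      then have "\<epsilon> \<otimes> x = \<epsilon> \<otimes> \<zero>" using e_eq[of x "\<zero>"] by simp
      then have "\<epsilon> \<otimes> x \<in> Q" using e(1) Q.zero_closed by simp
      then show "x \<in> Q" using Q.I_prime[OF e(1)] eQ x by blast
    qed
  qed (rule Q(2))
  with prime show ?thesis unfolding minimal_prime_def by blast
qed

lemma vimage_maximal:
  assumes "maximalideal M S"
  shows "maximalideal {x \<in> carrier R. \<pi> x \<in> M} R"
proof -
  interpret M: maximalideal M S by fact
  let ?N = "{x \<in> carrier R. \<pi> x \<in> M}"
  show ?thesis
  proof (rule maximalidealI[OF vimage_ideal[OF M.ideal_axioms]])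
    have "\<one>\<^bsub>S\<^esub> \<notin> M" using M.one_imp_carrier M.I_notcarr by blast
    then have "\<one> \<notin> ?N" by simp
    then show "carrier R \<noteq> ?N" using R.one_closed by blast
    fix K assume K: "ideal K R" "?N \<subseteq> K" "K \<subseteq> carrier R"
    interpret K: ideal K R by (rule K(1))
    have piK: "ideal (\<pi> ` K) S"
    proof (rule S.ideal_if_closed)
      show "\<pi> ` K \<subseteq> carrier S" using K(3) by auto
      show "\<zero>\<^bsub>S\<^esub> \<in> \<pi> ` K" using K.zero_closed hom_zero by (metis imageI)
    next
      fix x y assume "x \<in> \<pi> ` K" "y \<in> \<pi> ` K"
      then obtain u v where uv: "u \<in> K" "v \<in> K" "x = \<pi> u" "y = \<pi> v" by blast
      then have "x \<oplus>\<^bsub>S\<^esub> y = \<pi> (u \<oplus> v)" using subsetD[OF K(3)] by simp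
      then show "x \<oplus>\<^bsub>S\<^esub> y \<in> \<pi> ` K" using K.a_closed[OF uv(1,2)] by blast
    next
      fix a x assume "a \<in> carrier S" "x \<in> \<pi> ` K"
      then obtain u v where uv: "u \<in> carrier R" "v \<in> K" "a = \<pi> u" "x = \<pi> v" using surj by blast
      then have "a \<otimes>\<^bsub>S\<^esub> x = \<pi> (u \<otimes> v)" using subsetD[OF K(3)] by simp
      then show "a \<otimes>\<^bsub>S\<^esub> x \<in> \<pi> ` K" using K.I_l_closed[OF uv(2,1)] by blast
    qed
    have "M \<subseteq> \<pi> ` K"
    proof
      fix m assume m: "m \<in> M"
      then have "m \<in> carrier S" using M.a_subset by blast
      then obtain x where x: "x \<in> carrier R" "m = \<pi> x" using surj by blast
      then have "x \<in> K" using m K(2) by blast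
      then show "m \<in> \<pi> ` K" using x(2) by blast
    qed
    then have "\<pi> ` K = M \<or> \<pi> ` K = carrier S"
      using M.I_maximal[OF piK] piK ideal.axioms(1) additive_subgroup.a_subset by blast
    then show "K = ?N \<or> K = carrier R"
    proof
      assume "\<pi> ` K = M"
      then have "K \<subseteq> ?N" using K(3) by blast
      then show ?thesis using K(2) by blast
    next
      assume "\<pi> ` K = carrier S"
      then have "\<one>\<^bsub>S\<^esub> \<in> \<pi> ` K" by simp
      then obtain k where k: "\<one>\<^bsub>S\<^esub> = \<pi> k" "k \<in> K" by (rule imageE)
      have kR: "k \<in> carrier R" using k(2) K(3) by blast
      \<comment> \<open>An element of \<open>K\<close> with image 1 differs from 1 by an element of
        the kernel, and the kernel is contained in \<open>?N\<close>.\<close>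
      have "\<pi> (\<one> \<ominus> k) = \<zero>\<^bsub>S\<^esub>" using kR k(1) by (simp add: a_minus_def S.r_neg flip: k(1))
      then have "\<pi> (\<one> \<ominus> k) \<in> M" using M.zero_closed by (simp only:)
      moreover have "\<one> \<ominus> k \<in> carrier R" using kR by simp
      ultimately have "\<one> \<ominus> k \<in> ?N" by blast
      then have "(\<one> \<ominus> k) \<oplus> k \<in> K" using K(2) K.a_closed k(2) by blast
      moreover have "(\<one> \<ominus> k) \<oplus> k = \<one>" using kR by (simp add: a_minus_def R.a_assoc R.l_neg)
      ultimately show ?thesis using K.one_imp_carrier by simp
    qed
  qed
qed

definition preimage :: "'b set \<Rightarrow> 'a set" where
  "preimage M = {x \<in> carrier R. \<pi> x \<in> M}"

text \<open>In the localization, \<open>x/s\<close> is identified with the solution \<open>a\<close> of \<open>\<pi> x = a (\<pi> s)\<close>.\<close>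

definition frac_class :: "'b set \<Rightarrow> 'b \<Rightarrow> ('a \<times> 'a) set" where
  "frac_class M a = {(x, s). x \<in> carrier R \<and> s \<in> carrier R - preimage M \<and> \<pi> x = a \<otimes>\<^bsub>S\<^esub> \<pi> s}"

section \<open>The localization of a product at a maximal ideal of a local factor\<close>

context
  fixes M
  assumes dom: "domain S" and M: "maximalideal M S"
    and unit: "\<And>x. x \<in> carrier S \<Longrightarrow> x \<notin> M \<Longrightarrow> \<exists>y\<in>carrier S. x \<otimes>\<^bsub>S\<^esub> y = \<one>\<^bsub>S\<^esub>"
begin

abbreviation "nbar \<equiv> preimage M"
abbreviation "cls \<equiv> frac_class M"

lemma one_notin_M: "\<one>\<^bsub>S\<^esub> \<notin> M"
  using M maximalideal.I_notcarr ideal.one_imp_carrier maximalideal.axioms(1) by metis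

lemma zero_in_M: "\<zero>\<^bsub>S\<^esub> \<in> M"
  using M maximalideal.axioms(1) ideal.axioms(1) additive_subgroup.zero_closed by metis

lemma denominator:
  assumes "s \<in> carrier R - nbar"
  shows "s \<in> carrier R" "\<pi> s \<in> carrier S" "\<pi> s \<noteq> \<zero>\<^bsub>S\<^esub>" "\<pi> s \<notin> M"
  using assms zero_in_M by (auto simp: preimage_def)

lemma denominatorI: "s \<in> carrier R \<Longrightarrow> \<pi> s \<notin> M \<Longrightarrow> s \<in> carrier R - nbar" by (simp add: preimage_def)

lemma cancel:
  assumes "a \<in> carrier S" "b \<in> carrier S" "c \<in> carrier S" "c \<noteq> \<zero>\<^bsub>S\<^esub>"
  shows "a \<otimes>\<^bsub>S\<^esub> c = b \<otimes>\<^bsub>S\<^esub> c \<longleftrightarrow> a = b" using domain.m_rcancel[OF dom assms(4,3,1,2)] .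

lemma mult_denominators:
  assumes s: "s \<in> carrier R - nbar" and t: "t \<in> carrier R - nbar"
  shows "s \<otimes> t \<in> carrier R - nbar"
proof (rule denominatorI)
  note st = denominator[OF s] denominator[OF t]
  show "s \<otimes> t \<in> carrier R" using st by simp
  show "\<pi> (s \<otimes> t) \<notin> M"
    using primeideal.I_prime[OF S.maximalideal_prime[OF M] st(2,6)] st by (simp add: hom_mult) blast
qed

lemma one_denominator: "\<one> \<in> carrier R - nbar" using one_notin_M by (intro denominatorI) auto

lemma e_denominator: "\<epsilon> \<in> carrier R - nbar" using one_notin_M e by (intro denominatorI) auto

text \<open>A relation between fractions maps to one in the domain \<open>S\<close>, where the image
  of \<open>u\<close> cancels. Conversely \<open>\<epsilon>\<close> serves as \<open>u\<close>: it
  is a denominator, and multiplying by it identifies elements with equal image.\<close>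

lemma fraction_eq_cls:
  assumes a: "a \<in> carrier S" and xs: "(x, s) \<in> cls a"
  shows "fraction R nbar x s = cls a"
proof -
  let ?ex = "\<lambda>y t. \<exists>u \<in> carrier R - nbar. u \<otimes> (x \<otimes> t) = u \<otimes> (y \<otimes> s)"
  have x: "x \<in> carrier R" and s: "s \<in> carrier R - nbar" and xa: "\<pi> x = a \<otimes>\<^bsub>S\<^esub> \<pi> s"
    using xs by (auto simp: frac_class_def)
  note s' = denominator[OF s]
  have iff: "?ex y t \<longleftrightarrow> \<pi> y = a \<otimes>\<^bsub>S\<^esub> \<pi> t"
    if y: "y \<in> carrier R" and t: "t \<in> carrier R - nbar" for y t
  proof -
    note t' = denominator[OF t]
    have "\<pi> (x \<otimes> t) = (a \<otimes>\<^bsub>S\<^esub> \<pi> t) \<otimes>\<^bsub>S\<^esub> \<pi> s"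
      using x t' s' a xa S.m_lcomm[of "\<pi> s"] by (simp add: S.m_ac)
    moreover have "\<pi> (y \<otimes> s) = \<pi> y \<otimes>\<^bsub>S\<^esub> \<pi> s" using y s' by simp
    ultimately have eq: "\<pi> (x \<otimes> t) = \<pi> (y \<otimes> s) \<longleftrightarrow> \<pi> y = a \<otimes>\<^bsub>S\<^esub> \<pi> t"
      using cancel[of "a \<otimes>\<^bsub>S\<^esub> \<pi> t" "\<pi> y" "\<pi> s"] a y s' t' by auto
    show ?thesis
    proof
      assume "?ex y t"
      then obtain u where u: "u \<in> carrier R - nbar" "u \<otimes> (x \<otimes> t) = u \<otimes> (y \<otimes> s)" by blast
      note u' = denominator[OF u(1)]
      have "\<pi> (u \<otimes> (x \<otimes> t)) = \<pi> (u \<otimes> (y \<otimes> s))" by (simp only: u(2))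
      then have "\<pi> u \<otimes>\<^bsub>S\<^esub> \<pi> (x \<otimes> t) = \<pi> u \<otimes>\<^bsub>S\<^esub> \<pi> (y \<otimes> s)"
        using u' x y s' t' by (metis R.m_closed hom_mult)
      then have "\<pi> (x \<otimes> t) = \<pi> (y \<otimes> s)"
        using domain.m_lcancel[OF dom u'(3,2)] x y s' t' hom_closed by (metis R.m_closed)
      then show "\<pi> y = a \<otimes>\<^bsub>S\<^esub> \<pi> t" using eq by blast
    next
      assume "\<pi> y = a \<otimes>\<^bsub>S\<^esub> \<pi> t"
      then have "\<epsilon> \<otimes> (x \<otimes> t) = \<epsilon> \<otimes> (y \<otimes> s)" using eq x y s' t' by (intro e_eq) auto
      then show "?ex y t" using e_denominator by blast
    qed
  qed
  have "(y, t) \<in> fraction R nbar x s \<longleftrightarrow> (y, t) \<in> cls a" for y t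
  proof -
    have "(y, t) \<in> fraction R nbar x s \<longleftrightarrow> y \<in> carrier R \<and> t \<in> carrier R - nbar \<and>
        ?ex y t"
      unfolding fraction_def fraction_rel_def using x s by simp
    also have "\<dots> \<longleftrightarrow> (y, t) \<in> cls a" using iff[of y t] unfolding frac_class_def by blast
    finally show ?thesis .
  qed
  then show ?thesis by auto
qed

lemma cls_nonempty:
  assumes "a \<in> carrier S"
  obtains x where "x \<in> carrier R" "\<pi> x = a" "(x, \<one>) \<in> cls a"
proof -
  have "a \<in> \<pi> ` carrier R" using assms surj by simp
  then obtain x where "a = \<pi> x" "x \<in> carrier R" by (rule imageE)
  then show ?thesis using that[of x] one_denominator by (simp add: frac_class_def)
qed

lemma cls_exists:
  assumes x: "x \<in> carrier R" and s: "s \<in> carrier R - nbar"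
  obtains a where "a \<in> carrier S" "(x, s) \<in> cls a"
proof -
  note s' = denominator[OF s]
  obtain y where y: "y \<in> carrier S" "\<pi> s \<otimes>\<^bsub>S\<^esub> y = \<one>\<^bsub>S\<^esub>" using unit[OF s'(2,4)] by blast
  have "\<pi> x \<otimes>\<^bsub>S\<^esub> y \<otimes>\<^bsub>S\<^esub> \<pi> s = \<pi> x \<otimes>\<^bsub>S\<^esub> (\<pi> s \<otimes>\<^bsub>S\<^esub> y)"
    using hom_closed[OF x] y(1) s'(2) by (simp add: S.m_ac)
  then have "(x, s) \<in> cls (\<pi> x \<otimes>\<^bsub>S\<^esub> y)" using x s y by (simp add: frac_class_def)
  then show ?thesis by (rule that[rotated]) (use x y in simp)
qed

lemma carrier_localization: "carrier (localization R nbar) = cls ` carrier S"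
proof -
  have fr: "fraction_rel R nbar `` {(x, s)} = fraction R nbar x s" for x s
    by (simp add: fraction_def)
  show ?thesis
  proof (rule equalityI; rule subsetI)
    fix U assume "U \<in> carrier (localization R nbar)"
    then obtain x s where xs: "x \<in> carrier R" "s \<in> carrier R - nbar" "U = fraction R nbar x s"
      by (auto simp: localization_def quotient_def fr)
    obtain a where "a \<in> carrier S" "(x, s) \<in> cls a" using cls_exists[OF xs(1,2)] .
    then show "U \<in> cls ` carrier S" unfolding xs(3) using fraction_eq_cls by blast
  next
    fix U assume "U \<in> cls ` carrier S"
    then obtain a where a: "a \<in> carrier S" "U = cls a" by blast
    obtain x where x: "x \<in> carrier R" "(x, \<one>) \<in> cls a" using cls_nonempty[OF a(1)] by blast
    have "U = fraction_rel R nbar `` {(x, \<one>)}" unfolding fr fraction_eq_cls[OF a(1) x(2)] a(2) ..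
    then show "U \<in> carrier (localization R nbar)"
      unfolding localization_def using quotientI[of "(x, \<one>)"] x(1) one_denominator by simp
  qed
qed

lemma cls_mult:
  assumes "(x, s) \<in> cls a" "(y, t) \<in> cls b" "a \<in> carrier S" "b \<in> carrier S"
  shows "(x \<otimes> y, s \<otimes> t) \<in> cls (a \<otimes>\<^bsub>S\<^esub> b)"
proof -
  have c: "x \<in> carrier R" "y \<in> carrier R" "s \<in> carrier R - nbar" "t \<in> carrier R - nbar"
    "\<pi> x = a \<otimes>\<^bsub>S\<^esub> \<pi> s" "\<pi> y = b \<otimes>\<^bsub>S\<^esub> \<pi> t" using assms(1,2) by (auto simp: frac_class_def)
  note st = denominator[OF c(3)] denominator[OF c(4)]
  have "\<pi> (x \<otimes> y) = a \<otimes>\<^bsub>S\<^esub> b \<otimes>\<^bsub>S\<^esub> \<pi> (s \<otimes> t)" using c assms(3,4) st by (simp add: S.m_ac)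
  then show ?thesis using c mult_denominators[OF c(3,4)] by (simp add: frac_class_def)
qed

lemma cls_add:
  assumes "(x, s) \<in> cls a" "(y, t) \<in> cls b" "a \<in> carrier S" "b \<in> carrier S"
  shows "((x \<otimes> t) \<oplus> (y \<otimes> s), s \<otimes> t) \<in> cls (a \<oplus>\<^bsub>S\<^esub> b)"
proof -
  have c: "x \<in> carrier R" "y \<in> carrier R" "s \<in> carrier R - nbar" "t \<in> carrier R - nbar"
    "\<pi> x = a \<otimes>\<^bsub>S\<^esub> \<pi> s" "\<pi> y = b \<otimes>\<^bsub>S\<^esub> \<pi> t" using assms(1,2) by (auto simp: frac_class_def)
  note st = denominator[OF c(3)] denominator[OF c(4)]
  have "\<pi> ((x \<otimes> t) \<oplus> (y \<otimes> s)) =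
      a \<otimes>\<^bsub>S\<^esub> (\<pi> s \<otimes>\<^bsub>S\<^esub> \<pi> t) \<oplus>\<^bsub>S\<^esub> b \<otimes>\<^bsub>S\<^esub> (\<pi> s \<otimes>\<^bsub>S\<^esub> \<pi> t)"
    using c assms(3,4) st by (simp add: S.m_ac)
  also have "\<dots> = (a \<oplus>\<^bsub>S\<^esub> b) \<otimes>\<^bsub>S\<^esub> \<pi> (s \<otimes> t)"
    using assms(3,4) st S.l_distr[of a b "\<pi> s \<otimes>\<^bsub>S\<^esub> \<pi> t"] by simp
  finally have "\<pi> ((x \<otimes> t) \<oplus> (y \<otimes> s)) = (a \<oplus>\<^bsub>S\<^esub> b) \<otimes>\<^bsub>S\<^esub> \<pi> (s \<otimes> t)" .
  then show ?thesis using c st mult_denominators[OF c(3,4)] by (simp add: frac_class_def)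
qed

text \<open>The operations of the localization are unions over representatives. All members are the
  same class, and the index sets are nonempty because every class contains a fraction with
  denominator 1.\<close>

lemma Union_cls:
  assumes ab: "a \<in> carrier S" "b \<in> carrier S" "c \<in> carrier S"
    and op: "\<And>x s y t. (x, s) \<in> cls a \<Longrightarrow> (y, t) \<in> cls b \<Longrightarrow> (f x s y t, g s t) \<in> cls c"
  shows "(\<Union>(x, s)\<in>cls a. \<Union>(y, t)\<in>cls b. fraction R nbar (f x s y t) (g s t)) = cls c"
proof -
  obtain x where x: "(x, \<one>) \<in> cls a" using cls_nonempty[OF ab(1)] by blast
  obtain y where y: "(y, \<one>) \<in> cls b" using cls_nonempty[OF ab(2)] by blast
  have *: "fraction R nbar (f x s y t) (g s t) = cls c" if "(x, s) \<in> cls a" "(y, t) \<in> cls b" for x s y t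
    by (rule fraction_eq_cls[OF ab(3) op[OF that]])
  show ?thesis
  proof (rule equalityI)
    show "cls c \<subseteq> (\<Union>(x, s)\<in>cls a. \<Union>(y, t)\<in>cls b. fraction R nbar (f x s y t) (g s t))"
    proof
      fix z assume "z \<in> cls c"
      then have "z \<in> fraction R nbar (f x \<one> y \<one>) (g \<one> \<one>)" using *[OF x y] by simp
      then show "z \<in> (\<Union>(x, s)\<in>cls a. \<Union>(y, t)\<in>cls b. fraction R nbar (f x s y t) (g s t))"
        using x y by blast
    qed
  qed (use * in blast)
qed

lemma cls_iso: "cls \<in> ring_iso S (localization R nbar)" unfolding ring_iso_def
proof (intro CollectI conjI ring_hom_memI)
  show "cls a \<in> carrier (localization R nbar)" if "a \<in> carrier S" for a
    using that carrier_localization by blast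
  show "cls (a \<otimes>\<^bsub>S\<^esub> b) = cls a \<otimes>\<^bsub>localization R nbar\<^esub> cls b"
    if "a \<in> carrier S" "b \<in> carrier S" for a b
    using Union_cls[OF that S.m_closed[OF that], of "\<lambda>x s y t. x \<otimes> y" "\<lambda>s t. s \<otimes> t"] cls_mult that
    by (simp add: localization_def)
  show "cls (a \<oplus>\<^bsub>S\<^esub> b) = cls a \<oplus>\<^bsub>localization R nbar\<^esub> cls b"
    if "a \<in> carrier S" "b \<in> carrier S" for a b
    using Union_cls[OF that S.a_closed[OF that], of "\<lambda>x s y t. (x \<otimes> t) \<oplus> (y \<otimes> s)" "\<lambda>s t. s \<otimes> t"]
      cls_add that
    by (simp add: localization_def)
  have "(\<one>, \<one>) \<in> cls \<one>\<^bsub>S\<^esub>" using one_denominator by (simp add: frac_class_def)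
  then show "cls \<one>\<^bsub>S\<^esub> = \<one>\<^bsub>localization R nbar\<^esub>"
    using fraction_eq_cls[OF S.one_closed] by (simp add: localization_def)
  have "inj_on cls (carrier S)"
  proof (rule inj_onI)
    fix a b assume ab: "a \<in> carrier S" "b \<in> carrier S" "cls a = cls b"
    obtain x where x: "\<pi> x = a" "(x, \<one>) \<in> cls a" using cls_nonempty[OF ab(1)] by blast
    then have "(x, \<one>) \<in> cls b" using ab(3) by simp
    then have "\<pi> x = b" using ab(2) by (simp add: frac_class_def)
    then show "a = b" using x(1) by simp
  qed
  then show "bij_betw cls (carrier S) (carrier (localization R nbar))"
    by (simp add: bij_betw_def carrier_localization)
qed

lemma localization_cring: "cring (localization R nbar)"
proof -
  have "(\<zero>, \<one>) \<in> cls \<zero>\<^bsub>S\<^esub>" using one_denominator by (simp add: frac_class_def)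
  then have "cls \<zero>\<^bsub>S\<^esub> = \<zero>\<^bsub>localization R nbar\<^esub>"
    using fraction_eq_cls[OF S.zero_closed] by (simp add: localization_def)
  then show ?thesis using S.ring_iso_imp_img_cring[OF cls_iso] by simp
qed

lemma iso_localization: "iso_rings S (localization R nbar) cls"
  by (intro iso_rings.intro iso_rings_axioms.intro S.is_cring localization_cring cls_iso)

end

end

section \<open>The product ring\<close>

text \<open>The model is the map from \<open>a\<close> to \<open>(a, 0)\<close>, which preserves
  sums and products but in general not the unit, so it is no ring homomorphism. Ideals and Frobenius
  submodules of a product still pull back along it to the factors.\<close>

locale corner = A: cring A + P: cring P for A :: "('a, 'r) ring_scheme" and P :: "('c, 's) ring_scheme" +
  fixes \<iota>
  assumes closed [simp]: "a \<in> carrier A \<Longrightarrow> \<iota> a \<in> carrier P"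
    and add: "a \<in> carrier A \<Longrightarrow> b \<in> carrier A \<Longrightarrow> \<iota> (a \<oplus>\<^bsub>A\<^esub> b) = \<iota> a \<oplus>\<^bsub>P\<^esub> \<iota> b"
    and mult: "a \<in> carrier A \<Longrightarrow> b \<in> carrier A \<Longrightarrow> \<iota> (a \<otimes>\<^bsub>A\<^esub> b) = \<iota> a \<otimes>\<^bsub>P\<^esub> \<iota> b"
begin

lemma zero: "\<iota> \<zero>\<^bsub>A\<^esub> = \<zero>\<^bsub>P\<^esub>"
  using add[of "\<zero>\<^bsub>A\<^esub>" "\<zero>\<^bsub>A\<^esub>"] P.add.r_cancel_one'[of "\<iota> \<zero>\<^bsub>A\<^esub>" "\<iota> \<zero>\<^bsub>A\<^esub>"] by simp

lemma minus: "a \<in> carrier A \<Longrightarrow> \<iota> (\<ominus>\<^bsub>A\<^esub> a) = \<ominus>\<^bsub>P\<^esub> \<iota> a"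
  using add[of "\<ominus>\<^bsub>A\<^esub> a" a] zero A.l_neg[of a] P.minus_equality[of "\<iota> (\<ominus>\<^bsub>A\<^esub> a)" "\<iota> a"] by simp

text \<open>For \<open>k = 0\<close> the equation would say that the unit is preserved, which fails
  in general; the Frobenius exponents \<open>p ^ e\<close> are positive.\<close>

lemma pow: "a \<in> carrier A \<Longrightarrow> k > 0 \<Longrightarrow> \<iota> (a [^]\<^bsub>A\<^esub> (k::nat)) = \<iota> a [^]\<^bsub>P\<^esub> k"
proof (induction k)
  case (Suc k)
  then show ?case by (cases k) (simp_all add: mult)
qed simp

lemma vimage_ideal:
  assumes "ideal K P"
  shows "ideal {a \<in> carrier A. \<iota> a \<in> K} A"
proof -
  interpret K: ideal K P by fact
  show ?thesis
    by (rule A.ideal_if_closed) (use K.a_closed K.zero_closed K.I_l_closed in \<open>auto simp: add mult zero\<close>)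
qed

lemma vimage_submodule:
  assumes "submodule N P (frobenius_pushforward p e P)" "p > 0"
  shows "submodule {a \<in> carrier A. \<iota> a \<in> N} A (frobenius_pushforward p e A)"
proof -
  let ?M = "{a \<in> carrier A. \<iota> a \<in> N}"
  have N: "subgroup N (add_monoid P)"
    and smult: "\<And>a x. a \<in> carrier P \<Longrightarrow> x \<in> N \<Longrightarrow> (a [^]\<^bsub>P\<^esub> (p ^ e)) \<otimes>\<^bsub>P\<^esub> x \<in> N"
    using assms(1) submodule_iff[of "frobenius_pushforward p e P" P N P] by auto
  have N_add: "x \<oplus>\<^bsub>P\<^esub> y \<in> N" if "x \<in> N" "y \<in> N" for x y using subgroup.m_closed[OF N that] by simp
  have N_zero: "\<zero>\<^bsub>P\<^esub> \<in> N" using subgroup.one_closed[OF N] by simp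
  have N_minus: "\<ominus>\<^bsub>P\<^esub> x \<in> N" if "x \<in> N" for x
    using subgroup.m_inv_closed[OF N that] by (simp add: a_inv_def)
  have "subgroup ?M (add_monoid A)"
  proof (rule A.add.subgroupI)
    show "?M \<noteq> {}" using N_zero zero A.zero_closed by force
    show "\<ominus>\<^bsub>A\<^esub> a \<in> ?M" if "a \<in> ?M" for a using that N_minus by (simp add: minus)
    show "a \<oplus>\<^bsub>A\<^esub> b \<in> ?M"
      if "a \<in> ?M" "b \<in> ?M" for a b using that N_add by (simp add: add)
  qed blast
  moreover have "(r [^]\<^bsub>A\<^esub> (p ^ e)) \<otimes>\<^bsub>A\<^esub> a \<in> ?M"
    if "r \<in> carrier A" "a \<in> ?M" for r a
    using that smult[of "\<iota> r" "\<iota> a"] assms(2) by (simp add: mult pow)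
  ultimately show ?thesis by (subst submodule_iff[of _ A]) simp_all
qed

end

abbreviation F_splits :: "nat \<Rightarrow> nat \<Rightarrow> ('a, 'r) ring_scheme \<Rightarrow> 'a \<Rightarrow> bool" where
  "F_splits p e A c \<equiv>
    \<exists>f\<in>module_hom A (frobenius_pushforward p e A) (regular_module A). f c = \<one>\<^bsub>A\<^esub>"

text \<open>The injection \<open>enc\<close> carries the pairs to another type, so that the product
  can be realized on \<open>nat set\<close>.\<close>

definition prod_ring :: "('a, 'r) ring_scheme \<Rightarrow> ('b, 's) ring_scheme \<Rightarrow> ('a \<times> 'b \<Rightarrow> 'c) \<Rightarrow> 'c ring" where
  "prod_ring A B enc =
     \<lparr>carrier = enc ` (carrier A \<times> carrier B),
      mult = (\<lambda>x y. enc (fst (inv_into UNIV enc x) \<otimes>\<^bsub>A\<^esub> fst (inv_into UNIV enc y), snd (inv_into UNIV enc x) \<otimes>\<^bsub>B\<^esub> snd (inv_into UNIV enc y))),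
      one = enc (\<one>\<^bsub>A\<^esub>, \<one>\<^bsub>B\<^esub>), zero = enc (\<zero>\<^bsub>A\<^esub>, \<zero>\<^bsub>B\<^esub>),
      add = (\<lambda>x y. enc (fst (inv_into UNIV enc x) \<oplus>\<^bsub>A\<^esub> fst (inv_into UNIV enc y), snd (inv_into UNIV enc x) \<oplus>\<^bsub>B\<^esub> snd (inv_into UNIV enc y)))\<rparr>"

locale encoded_product = A: cring A + B: cring B for A :: "('a, 'r) ring_scheme" and B :: "('b, 's) ring_scheme" +
  fixes enc :: "'a \<times> 'b \<Rightarrow> 'c"
  assumes inj: "inj enc"
begin

definition P :: "'c ring" where "P = prod_ring A B enc"
definition p1 :: "'c \<Rightarrow> 'a" where "p1 x = fst (inv_into UNIV enc x)"
definition p2 :: "'c \<Rightarrow> 'b" where "p2 x = snd (inv_into UNIV enc x)"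

lemma p_enc [simp]: "p1 (enc (a, b)) = a" "p2 (enc (a, b)) = b"
  by (simp_all add: p1_def p2_def inv_f_f[OF inj])

lemma P_simps [simp]:
  "enc (a, b) \<otimes>\<^bsub>P\<^esub> enc (c, d) = enc (a \<otimes>\<^bsub>A\<^esub> c, b \<otimes>\<^bsub>B\<^esub> d)"
  "enc (a, b) \<oplus>\<^bsub>P\<^esub> enc (c, d) = enc (a \<oplus>\<^bsub>A\<^esub> c, b \<oplus>\<^bsub>B\<^esub> d)"
  "\<one>\<^bsub>P\<^esub> = enc (\<one>\<^bsub>A\<^esub>, \<one>\<^bsub>B\<^esub>)" "\<zero>\<^bsub>P\<^esub> = enc (\<zero>\<^bsub>A\<^esub>, \<zero>\<^bsub>B\<^esub>)"
  by (simp_all add: P_def prod_ring_def inv_f_f[OF inj])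

lemma enc_in_P [simp]: "enc (a, b) \<in> carrier P \<longleftrightarrow> a \<in> carrier A \<and> b \<in> carrier B"
  using inj by (auto simp: P_def prod_ring_def inj_def)

lemma enc_eq [simp]: "enc (a, b) = enc (c, d) \<longleftrightarrow> a = c \<and> b = d" using inj by (auto simp: inj_def)

lemma P_cases:
  assumes "x \<in> carrier P"
  obtains a b where "a \<in> carrier A" "b \<in> carrier B" "x = enc (a, b)"
  using assms by (auto simp: P_def prod_ring_def)

lemma P_cring: "cring P"
proof (rule cringI)
  show "abelian_group P"
  proof (rule abelian_groupI)
    fix x assume "x \<in> carrier P"
    then obtain a b where x: "a \<in> carrier A" "b \<in> carrier B" "x = enc (a, b)" by (rule P_cases)
    then have "enc (\<ominus>\<^bsub>A\<^esub> a, \<ominus>\<^bsub>B\<^esub> b) \<in> carrier P" "enc (\<ominus>\<^bsub>A\<^esub> a, \<ominus>\<^bsub>B\<^esub> b) \<oplus>\<^bsub>P\<^esub> x = \<zero>\<^bsub>P\<^esub>"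
      by (simp_all add: A.l_neg B.l_neg)
    then show "\<exists>y\<in>carrier P. y \<oplus>\<^bsub>P\<^esub> x = \<zero>\<^bsub>P\<^esub>" by blast
  qed (auto elim!: P_cases simp: A.a_ac B.a_ac)
  show "comm_monoid P" by (rule comm_monoidI) (auto elim!: P_cases simp: A.m_ac B.m_ac)
qed (auto elim!: P_cases simp: A.l_distr B.l_distr)

sublocale P: cring P by (rule P_cring)

sublocale corner1: corner A P "\<lambda>a. enc (a, \<zero>\<^bsub>B\<^esub>)" by unfold_locales auto
sublocale corner2: corner B P "\<lambda>b. enc (\<zero>\<^bsub>A\<^esub>, b)" by unfold_locales auto

lemma factor1: "ring_factor P A p1 (enc (\<one>\<^bsub>A\<^esub>, \<zero>\<^bsub>B\<^esub>))"
proof unfold_locales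
  show "p1 \<in> ring_hom P A" by (rule ring_hom_memI) (auto elim!: P_cases)
  show "p1 ` carrier P = carrier A"
  proof (rule equalityI; rule subsetI)
    fix a assume "a \<in> carrier A"
    then show "a \<in> p1 ` carrier P" by (intro image_eqI[of _ _ "enc (a, \<zero>\<^bsub>B\<^esub>)"]) auto
  qed (auto elim!: P_cases)
qed (auto elim!: P_cases)

lemma factor2: "ring_factor P B p2 (enc (\<zero>\<^bsub>A\<^esub>, \<one>\<^bsub>B\<^esub>))"
proof unfold_locales
  show "p2 \<in> ring_hom P B" by (rule ring_hom_memI) (auto elim!: P_cases)
  show "p2 ` carrier P = carrier B"
  proof (rule equalityI; rule subsetI)
    fix b assume "b \<in> carrier B"
    then show "b \<in> p2 ` carrier P" by (intro image_eqI[of _ _ "enc (\<zero>\<^bsub>A\<^esub>, b)"]) auto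
  qed (auto elim!: P_cases)
qed (auto elim!: P_cases)

lemma P_pow: "a \<in> carrier A \<Longrightarrow> b \<in> carrier B \<Longrightarrow> enc (a, b) [^]\<^bsub>P\<^esub> (k::nat) = enc (a [^]\<^bsub>A\<^esub> k, b [^]\<^bsub>B\<^esub> k)"
  by (induction k) simp_all

lemma P_add_pow_one: "[(k::nat)] \<cdot>\<^bsub>P\<^esub> \<one>\<^bsub>P\<^esub> = enc ([k] \<cdot>\<^bsub>A\<^esub> \<one>\<^bsub>A\<^esub>, [k] \<cdot>\<^bsub>B\<^esub> \<one>\<^bsub>B\<^esub>)"
proof (induction k)
  case (Suc k)
  then show ?case
    using P.add.nat_pow_Suc[of k "\<one>\<^bsub>P\<^esub>"] A.add.nat_pow_Suc[of k "\<one>\<^bsub>A\<^esub>"] B.add.nat_pow_Suc[of k "\<one>\<^bsub>B\<^esub>"]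
    by simp
qed (simp add: P.add.nat_pow_0 A.add.nat_pow_0 B.add.nat_pow_0)

lemma P_characteristic: "has_characteristic A p \<Longrightarrow> has_characteristic B p \<Longrightarrow> has_characteristic P p"
  unfolding has_characteristic_def by (simp add: P_add_pow_one del: P_simps(3))

lemma P_split: "a \<in> carrier A \<Longrightarrow> b \<in> carrier B \<Longrightarrow> enc (a, \<zero>\<^bsub>B\<^esub>) \<oplus>\<^bsub>P\<^esub> enc (\<zero>\<^bsub>A\<^esub>, b) = enc (a, b)"
  by simp

text \<open>Multiplying by the two idempotents splits an element of an ideal into its corner parts
  within that ideal, so generators of the two pullbacks together generate the ideal.\<close>

lemma P_noetherian:
  assumes "noetherian_ring A" "noetherian_ring B"
  shows "noetherian_ring P"
proof (rule P.noetherian_ringI)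
  fix K assume K: "ideal K P"
  interpret K: ideal K P by (rule K)
  let ?i1 = "\<lambda>a. enc (a, \<zero>\<^bsub>B\<^esub>)" and ?i2 = "\<lambda>b. enc (\<zero>\<^bsub>A\<^esub>, b)"
  obtain G1 where G1: "G1 \<subseteq> carrier A" "finite G1" "{a \<in> carrier A. ?i1 a \<in> K} = Idl\<^bsub>A\<^esub> G1"
    using noetherian_ring.finetely_gen[OF assms(1) corner1.vimage_ideal[OF K]] by blast
  obtain G2 where G2: "G2 \<subseteq> carrier B" "finite G2" "{b \<in> carrier B. ?i2 b \<in> K} = Idl\<^bsub>B\<^esub> G2"
    using noetherian_ring.finetely_gen[OF assms(2) corner2.vimage_ideal[OF K]] by blast
  let ?G = "?i1 ` G1 \<union> ?i2 ` G2"
  have "?i1 ` G1 \<subseteq> K" using A.genideal_self[OF G1(1)] unfolding G1(3)[symmetric] by blast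
  moreover have "?i2 ` G2 \<subseteq> K" using B.genideal_self[OF G2(1)] unfolding G2(3)[symmetric] by blast
  ultimately have GK: "?G \<subseteq> K" by blast
  then have G: "?G \<subseteq> carrier P" using K.a_subset by blast
  let ?L = "Idl\<^bsub>P\<^esub> ?G"
  have L: "ideal ?L P" by (rule P.genideal_ideal[OF G])
  interpret L: ideal ?L P by (rule L)
  have GL: "?G \<subseteq> ?L" by (rule P.genideal_self[OF G])
  have sub1: "Idl\<^bsub>A\<^esub> G1 \<subseteq> {a \<in> carrier A. ?i1 a \<in> ?L}"
    using G1(1) GL by (intro A.genideal_minimal[OF corner1.vimage_ideal[OF L]]) blast
  have sub2: "Idl\<^bsub>B\<^esub> G2 \<subseteq> {b \<in> carrier B. ?i2 b \<in> ?L}"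
    using G2(1) GL by (intro B.genideal_minimal[OF corner2.vimage_ideal[OF L]]) blast
  have "K \<subseteq> ?L"
  proof
    fix x assume x: "x \<in> K"
    then have "x \<in> carrier P" using K.a_subset by blast
    then obtain a b where ab: "a \<in> carrier A" "b \<in> carrier B" "x = enc (a, b)" by (rule P_cases)
    have "?i1 \<one>\<^bsub>A\<^esub> \<otimes>\<^bsub>P\<^esub> x \<in> K" by (rule K.I_l_closed[OF x]) simp
    then have "a \<in> Idl\<^bsub>A\<^esub> G1" using ab unfolding G1(3)[symmetric] by simp
    then have 1: "?i1 a \<in> ?L" using sub1 by blast
    have "?i2 \<one>\<^bsub>B\<^esub> \<otimes>\<^bsub>P\<^esub> x \<in> K" by (rule K.I_l_closed[OF x]) simp
    then have "b \<in> Idl\<^bsub>B\<^esub> G2" using ab unfolding G2(3)[symmetric] by simp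
    then have 2: "?i2 b \<in> ?L" using sub2 by blast
    show "x \<in> ?L" using L.a_closed[OF 1 2] unfolding P_split[OF ab(1,2)] ab(3) .
  qed
  then have "K = ?L" using P.genideal_minimal[OF K GK] by blast
  then show "\<exists>G\<subseteq>carrier P. finite G \<and> K = Idl\<^bsub>P\<^esub> G" using G G1(2) G2(2) by blast
qed

lemma P_F_finite:
  assumes "F_finite p A" "F_finite p B" and p: "p > 0"
  shows "F_finite p P"
proof -
  let ?i1 = "\<lambda>a. enc (a, \<zero>\<^bsub>B\<^esub>)" and ?i2 = "\<lambda>b. enc (\<zero>\<^bsub>A\<^esub>, b)"
  obtain G1 where G1: "G1 \<subseteq> carrier A" "finite G1"
    "\<Inter>{N. submodule N A (frobenius_pushforward p 1 A) \<and> G1 \<subseteq> N} = carrier A"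
    using assms(1) unfolding F_finite_def fin_gen_module_def by auto
  obtain G2 where G2: "G2 \<subseteq> carrier B" "finite G2"
    "\<Inter>{N. submodule N B (frobenius_pushforward p 1 B) \<and> G2 \<subseteq> N} = carrier B"
    using assms(2) unfolding F_finite_def fin_gen_module_def by auto
  let ?G = "?i1 ` G1 \<union> ?i2 ` G2"
  have GP: "?G \<subseteq> carrier P" using G1(1) G2(1) by auto
  have "carrier P \<subseteq> N" if N: "submodule N P (frobenius_pushforward p 1 P)" and GN: "?G \<subseteq> N" for N
  proof
    have "G1 \<subseteq> {a \<in> carrier A. ?i1 a \<in> N}" using G1(1) GN by blast
    then have 1: "carrier A \<subseteq> {a \<in> carrier A. ?i1 a \<in> N}"
      using corner1.vimage_submodule[OF N p] G1(3) by blast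
    have "G2 \<subseteq> {b \<in> carrier B. ?i2 b \<in> N}" using G2(1) GN by blast
    then have 2: "carrier B \<subseteq> {b \<in> carrier B. ?i2 b \<in> N}"
      using corner2.vimage_submodule[OF N p] G2(3) by blast
    have sg: "subgroup N (add_monoid P)"
      using N submodule_iff[of "frobenius_pushforward p 1 P" P N P] by simp
    have N_add: "x \<oplus>\<^bsub>P\<^esub> y \<in> N" if "x \<in> N" "y \<in> N" for x y
      using subgroup.m_closed[OF sg that] by simp
    fix x assume "x \<in> carrier P"
    then obtain a b where ab: "a \<in> carrier A" "b \<in> carrier B" "x = enc (a, b)" by (rule P_cases)
    have "?i1 a \<in> N" "?i2 b \<in> N" using 1 2 ab(1,2) by blast+
    then have "?i1 a \<oplus>\<^bsub>P\<^esub> ?i2 b \<in> N" by (rule N_add)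
    then show "x \<in> N" unfolding P_split[OF ab(1,2)] ab(3) .
  qed
  moreover have "submodule (carrier P) P (frobenius_pushforward p 1 P)"
    using P.add.subgroup_self by (subst submodule_iff[of _ P]) auto
  ultimately have "\<Inter>{N. submodule N P (frobenius_pushforward p 1 P) \<and> ?G \<subseteq> N} = carrier P"
    using GP by blast
  then show ?thesis unfolding F_finite_def fin_gen_module_def frobenius_pushforward_simps
    using GP G1(2) G2(2) by (intro exI[of _ ?G]) blast
qed

lemma P_strongly_F_regular:
  assumes dom: "domain A" "domain B"
    and splitA: "\<And>c. c \<in> carrier A \<Longrightarrow> c \<noteq> \<zero>\<^bsub>A\<^esub> \<Longrightarrow> \<exists>e0. \<forall>e\<ge>e0. F_splits p e A c"
    and splitB: "\<And>c. c \<in> carrier B \<Longrightarrow> c \<noteq> \<zero>\<^bsub>B\<^esub> \<Longrightarrow> \<exists>e0. \<forall>e\<ge>e0. F_splits p e B c"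
  shows "strongly_F_regular p P" unfolding strongly_F_regular_def
proof (intro ballI impI)
  fix c assume c: "c \<in> carrier P" "\<forall>Q. minimal_prime Q P \<longrightarrow> c \<notin> Q"
  obtain a b where ab: "a \<in> carrier A" "b \<in> carrier B" "c = enc (a, b)" using c(1) by (rule P_cases)
  have "a \<noteq> \<zero>\<^bsub>A\<^esub>" using c ring_factor.kernel_minimal_prime[OF factor1 dom(1)] ab by auto
  then obtain e1 where e1: "\<forall>e\<ge>e1. F_splits p e A a" using splitA ab(1) by blast
  have "b \<noteq> \<zero>\<^bsub>B\<^esub>" using c ring_factor.kernel_minimal_prime[OF factor2 dom(2)] ab by auto
  then obtain e2 where e2: "\<forall>e\<ge>e2. F_splits p e B b" using splitB ab(2) by blast
  \<comment> \<open>A single \<open>e\<close> has to serve both components, which is why splittings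
    for all large \<open>e\<close> are assumed; the successor makes it positive.\<close>
  define e where "e = Suc (e1 + e2)"
  have "e1 \<le> e" "e2 \<le> e" by (simp_all add: e_def)
  obtain f where f: "f \<in> module_hom A (frobenius_pushforward p e A) (regular_module A)" "f a = \<one>\<^bsub>A\<^esub>"
    using e1 \<open>e1 \<le> e\<close> by blast
  obtain g where g: "g \<in> module_hom B (frobenius_pushforward p e B) (regular_module B)" "g b = \<one>\<^bsub>B\<^esub>"
    using e2 \<open>e2 \<le> e\<close> by blast
  have f': "\<And>x. x \<in> carrier A \<Longrightarrow> f x \<in> carrier A"
    "\<And>x y. x \<in> carrier A \<Longrightarrow> y \<in> carrier A \<Longrightarrow> f (x \<oplus>\<^bsub>A\<^esub> y) = f x \<oplus>\<^bsub>A\<^esub> f y"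
    "\<And>r x. r \<in> carrier A \<Longrightarrow> x \<in> carrier A \<Longrightarrow> f (r [^]\<^bsub>A\<^esub> (p ^ e) \<otimes>\<^bsub>A\<^esub> x) = r \<otimes>\<^bsub>A\<^esub> f x"
    using f(1) by (auto simp: module_hom_def)
  have g': "\<And>x. x \<in> carrier B \<Longrightarrow> g x \<in> carrier B"
    "\<And>x y. x \<in> carrier B \<Longrightarrow> y \<in> carrier B \<Longrightarrow> g (x \<oplus>\<^bsub>B\<^esub> y) = g x \<oplus>\<^bsub>B\<^esub> g y"
    "\<And>r x. r \<in> carrier B \<Longrightarrow> x \<in> carrier B \<Longrightarrow> g (r [^]\<^bsub>B\<^esub> (p ^ e) \<otimes>\<^bsub>B\<^esub> x) = r \<otimes>\<^bsub>B\<^esub> g x"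
    using g(1) by (auto simp: module_hom_def)
  define h where "h x = enc (f (p1 x), g (p2 x))" for x
  have "h \<in> module_hom P (frobenius_pushforward p e P) (regular_module P)"
    unfolding module_hom_def by (auto elim!: P_cases simp: h_def f' g' P_pow)
  moreover have "h (r \<odot>\<^bsub>frobenius_pushforward p e P\<^esub> c) = r" if "r \<in> carrier P" for r
    using that ab f(2) g(2) by (auto elim!: P_cases simp: h_def f' g' P_pow)
  moreover have "e > 0" by (simp add: e_def)
  ultimately show "\<exists>e>0. \<exists>f\<in>module_hom P (frobenius_pushforward p e P) (regular_module P).
      \<forall>r\<in>carrier P. f (r \<odot>\<^bsub>frobenius_pushforward p e P\<^esub> c) = r" by blast
qed

end

section \<open>The two singularities\<close>

context toric
begin

lemma localization_invariants:
  assumes "ring_factor R A \<pi> \<epsilon>"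
  shows "maximalideal {x \<in> carrier R. \<pi> x \<in> mm} R"
    "HK_multiplicity p (localization R {x \<in> carrier R. \<pi> x \<in> mm}) = real (card D) / real n"
    "F_signature p (localization R {x \<in> carrier R. \<pi> x \<in> mm}) = 1 / real n"
proof -
  interpret F: ring_factor R A \<pi> \<epsilon> by fact
  show "maximalideal {x \<in> carrier R. \<pi> x \<in> mm} R" by (rule F.vimage_maximal[OF mm_maximal])
  have unit: "\<exists>y\<in>carrier A. x \<otimes>\<^bsub>A\<^esub> y = \<one>\<^bsub>A\<^esub>" if "x \<in> carrier A" "x \<notin> mm" for x
    using A_unit[OF that] by metis
  have "iso_rings A (localization R (F.preimage mm)) (F.frac_class mm)"
    by (rule F.iso_localization[OF A_domain mm_maximal]) (rule unit)
  then have iso: "iso_rings A (localization R {x \<in> carrier R. \<pi> x \<in> mm}) (F.frac_class mm)"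
    unfolding F.preimage_def .
  show "HK_multiplicity p (localization R {x \<in> carrier R. \<pi> x \<in> mm}) = real (card D) / real n"
    by (rule trans[OF iso_rings.HK_multiplicity_iso[OF iso mm_maximal] HK_multiplicity_A])
      (rule maximal_eq_mm)
  show "F_signature p (localization R {x \<in> carrier R. \<pi> x \<in> mm}) = 1 / real n"
  proof (rule trans[OF iso_rings.F_signature_iso[OF iso mm_maximal _ p_gt_1]])
    show "lim (\<lambda>e. real (free_rank A (frobenius_pushforward p e A)) / real p ^ (e * the_enat (krull_dim A))) = 1 / real n"
      using normalized_free_rank by (simp add: krull_dim_A numeral_eq_enat)
  qed (fact maximal_eq_mm, fact A_power_p)
qed

lemma splittings:
  assumes "c \<in> carrier A" "c \<noteq> \<zero>\<^bsub>A\<^esub>"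
  shows "\<exists>e0. \<forall>e\<ge>e0. F_splits p e A c"
proof -
  obtain e0 where "\<And>e. e \<ge> e0 \<Longrightarrow> \<exists>f. FL e f \<and> f c = 1" using strong_splitting assms by auto
  then show ?thesis unfolding Bex_def module_hom_iff_FL by auto
qed

text \<open>A list form that can be evaluated once \<open>n\<close> and \<open>w\<close> are
  numerals.\<close>

lemma D_eq: "D = set (filter (\<lambda>(a, b). \<forall>i\<in>{..a}. \<forall>j\<in>{..b}. n dvd i + w * j \<longrightarrow> i = 0 \<and> j = 0)
    (List.product [0..<n] [0..<n]))"
proof -
  have "D = D \<inter> {..<n} \<times> {..<n}" using D_subset by blast
  also have "\<dots> = set (filter (\<lambda>(a, b). \<forall>i\<in>{..a}. \<forall>j\<in>{..b}. n dvd i + w * j \<longrightarrow> i = 0 \<and> j = 0)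
    (List.product [0..<n] [0..<n]))" by (auto simp: D_def Sg_def)
  finally show ?thesis .
qed

end

text \<open>The graph of the coefficient function, packed into natural numbers. The type of all
  series is uncountable, so sets of naturals are needed as codes.\<close>

definition code :: "bps \<Rightarrow> nat set" where
  "code x = {prod_encode (i, prod_encode (j, int_encode (cf x i j))) | i j. True}"

lemma inj_code: "inj code"
proof (rule injI, rule bps_eqI)
  fix x y i j assume eq: "code x = code y"
  have "prod_encode (i, prod_encode (j, int_encode (cf x i j))) \<in> code x"
    unfolding code_def by blast
  then have "prod_encode (i, prod_encode (j, int_encode (cf x i j))) \<in> code y" by (simp only: eq)
  then obtain k l where "prod_encode (i, prod_encode (j, int_encode (cf x i j))) =
      prod_encode (k, prod_encode (l, int_encode (cf y k l)))"
    unfolding code_def by blast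
  then show "cf x i j = cf y i j" by (auto simp: prod_encode_eq int_encode_eq)
qed

definition pair_code :: "bps \<times> bps \<Rightarrow> nat set" where
  "pair_code z = (\<lambda>k. 2 * k) ` code (fst z) \<union> (\<lambda>k. 2 * k + 1) ` code (snd z)"

lemma inj_pair_code: "inj pair_code"
proof (rule injI)
  fix x y assume eq: "pair_code x = pair_code y"
  have parity: "2 * k \<noteq> 2 * l + 1" for k l :: nat by presburger
  have mem: "k \<in> code (fst z) \<longleftrightarrow> 2 * k \<in> pair_code z"
    "k \<in> code (snd z) \<longleftrightarrow> 2 * k + 1 \<in> pair_code z" for k z
    unfolding pair_code_def using parity parity[symmetric] by (auto simp: image_iff)
  have "code (fst x) = code (fst y)" "code (snd x) = code (snd y)"
    using eq by (simp_all add: Set.set_eq_iff mem)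
  then show "x = y" using inj_code by (simp add: inj_eq prod_eq_iff)
qed

theorem theoremA:
  fixes p :: nat
  assumes "Factorial_Ring.prime p"
  shows "\<exists>(R :: nat set ring) \<nn>\<^sub>1 \<nn>\<^sub>2.
           cring R \<and> has_characteristic R p \<and>
           noetherian_ring R \<and> F_finite p R \<and> strongly_F_regular p R \<and>
           maximalideal \<nn>\<^sub>1 R \<and> maximalideal \<nn>\<^sub>2 R \<and>
           HK_multiplicity p (localization R \<nn>\<^sub>1) < HK_multiplicity p (localization R \<nn>\<^sub>2) \<and>
           F_signature p (localization R \<nn>\<^sub>1) < F_signature p (localization R \<nn>\<^sub>2)"
proof -
  interpret X: toric p 4 3 3 by unfold_locales (use assms in \<open>auto simp: cong_def\<close>)
  interpret Y: toric p 3 1 1 by unfold_locales (use assms in auto)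
  interpret E: encoded_product X.A Y.A pair_code
    by (intro encoded_product.intro encoded_product_axioms.intro X.A_cring Y.A_cring inj_pair_code)
  \<comment> \<open>The exponents on the two axes with entries below 4, and the exponents of degree
    below 3.\<close>
  have "card X.D = 7" unfolding X.D_eq by code_simp
  moreover have "card Y.D = 6" unfolding Y.D_eq by code_simp
  moreover note X.localization_invariants[OF E.factor1] Y.localization_invariants[OF E.factor2]
  moreover have "strongly_F_regular p E.P"
    by (rule E.P_strongly_F_regular[OF X.A_domain Y.A_domain X.splittings Y.splittings])
  moreover have "F_finite p E.P" by (rule E.P_F_finite[OF X.F_finite_A Y.F_finite_A X.p_gt_0])
  moreover have "noetherian_ring E.P" by (rule E.P_noetherian[OF X.A_noetherian Y.A_noetherian])
  moreover have "has_characteristic E.P p"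
    by (rule E.P_characteristic[OF X.A_characteristic Y.A_characteristic])
  ultimately show ?thesis using E.P_cring
    by (intro exI[of _ E.P] exI[of _ "{x \<in> carrier E.P. E.p1 x \<in> X.mm}"]
        exI[of _ "{x \<in> carrier E.P. E.p2 x \<in> Y.mm}"]) simp
qed

end
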